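(* For any integer $n>0$, we have $$\mathrm{grFrob}\Big(\mathbb{C}\big[\mathbf{x}_{\binom{[n]}{2}}\big]\big/I(n);q\Big)=\sum_{\substack{\lambda\vdash n\\ 2\mid\lambda_i\text{ for } i>1}} q^{\frac{n-\lambda_1}{2}}\cdot s_\lambda.$$
   Context: Let $[n]=\{1,\dots,n\}$ and let $\binom{[n]}{2}$ be the set of 2-element subsets of $[n]$. Let $\mathbb{C}\big[\mathbf{x}_{\binom{[n]}{2}}\big]$ be the polynomial ring in the variables $x_{\{i,j\}}=x_{\{j,i\}}$ indexed by $\binom{[n]}{2}$. The symmetric group $\mathfrak{S}_n$ acts on it by the graded algebra automorphisms determined by $w\cdot x_{\{i,j\}}=x_{\{w(i),w(j)\}}$. $I(n)\subseteq\mathbb{C}\big[\mathbf{x}_{\binom{[n]}{2}}\big]$ is the ideal generated by all sums $\sum_{j\in[n],\,j\neq i}x_{\{i,j\}}$ for $i\in[n]$, and all products $x_S\cdot x_T$ for $S,T\in\binom{[n]}{2}$ with $S\cap T\neq\varnothing$ ($S$ may equal $T$). It is homogeneous and $\mathfrak{S}_n$-stable, so the quotient is a graded $\mathfrak{S}_n$-module. If an $\mathfrak{S}_n$-module $V\cong\bigoplus_{\lambda\vdash n}(V^\lambda)^{\oplus c_\lambda}$, with $V^\lambda$ the Specht modules (irreducibles), then $\mathrm{Frob}(V)=\sum_\lambda c_\lambda s_\lambda$ ($s_\lambda$ the Schur function). For graded $V=\bigoplus_d V_d$, $\mathrm{grFrob}(V;q)=\sum_d q^d\,\mathrm{Frob}(V_d)$.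 *)

theory Defs
  imports
    "HOL-Library.Poly_Mapping"
    "HOL-Algebra.Sym_Groups"
    "HOL-Algebra.QuotRing"
    "HOL-Algebra.Module"
    "HOL-Computational_Algebra.Formal_Power_Series"
begin

section \<open>Complex representations of the symmetric group\<close>

definition complex_field :: "complex ring" where
  "complex_field = \<lparr>carrier = UNIV, mult = (*), one = 1, zero = 0, add = (+)\<rparr>"

text \<open>
  A complex vector space together with the action of permutations. As is usual for
  the module record, the fields \<^const>\<open>mult\<close> and \<^const>\<open>one\<close> play no role.
\<close>

record 'v rep = "(complex, 'v) module" +
  act :: "(nat \<Rightarrow> nat) \<Rightarrow> 'v \<Rightarrow> 'v"

locale sym_module = Module.module complex_field V for n :: nat and V :: "'v rep" +
  assumes act_closed:
      "\<lbrakk>w \<in> carrier (sym_group n); x \<in> carrier V\<rbrakk> \<Longrightarrow> act V w x \<in> carrier V"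
    and act_add:
      "\<lbrakk>w \<in> carrier (sym_group n); x \<in> carrier V; y \<in> carrier V\<rbrakk>
        \<Longrightarrow> act V w (x \<oplus>\<^bsub>V\<^esub> y) = act V w x \<oplus>\<^bsub>V\<^esub> act V w y"
    and act_smult:
      "\<lbrakk>w \<in> carrier (sym_group n); x \<in> carrier V\<rbrakk>
        \<Longrightarrow> act V w (a \<odot>\<^bsub>V\<^esub> x) = a \<odot>\<^bsub>V\<^esub> act V w x"
    and act_one: "x \<in> carrier V \<Longrightarrow> act V \<one>\<^bsub>sym_group n\<^esub> x = x"
    and act_mult:
      "\<lbrakk>w \<in> carrier (sym_group n); u \<in> carrier (sym_group n); x \<in> carrier V\<rbrakk>
        \<Longrightarrow> act V (w \<otimes>\<^bsub>sym_group n\<^esub> u) x = act V w (act V u x)"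

definition sym_iso :: "nat \<Rightarrow> 'v rep \<Rightarrow> 'w rep \<Rightarrow> bool" where
  "sym_iso n V W \<longleftrightarrow> (\<exists>f. bij_betw f (carrier V) (carrier W)
     \<and> (\<forall>x\<in>carrier V. \<forall>y\<in>carrier V. f (x \<oplus>\<^bsub>V\<^esub> y) = f x \<oplus>\<^bsub>W\<^esub> f y)
     \<and> (\<forall>a. \<forall>x\<in>carrier V. f (a \<odot>\<^bsub>V\<^esub> x) = a \<odot>\<^bsub>W\<^esub> f x)
     \<and> (\<forall>w\<in>carrier (sym_group n). \<forall>x\<in>carrier V. f (act V w x) = act W w (f x)))"

text \<open>The external direct sum of a family of representations over a finite index set \<open>J\<close>.\<close>

definition direct_sum :: "'j set \<Rightarrow> ('j \<Rightarrow> 'v rep) \<Rightarrow> ('j \<Rightarrow> 'v) rep" where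
  "direct_sum J M =
     \<lparr>carrier = (\<Pi>\<^sub>E j\<in>J. carrier (M j)), mult = undefined, one = undefined,
      zero = (\<lambda>j\<in>J. \<zero>\<^bsub>M j\<^esub>), add = (\<lambda>x y. \<lambda>j\<in>J. x j \<oplus>\<^bsub>M j\<^esub> y j),
      smult = (\<lambda>a x. \<lambda>j\<in>J. a \<odot>\<^bsub>M j\<^esub> x j), act = (\<lambda>w x. \<lambda>j\<in>J. act (M j) w (x j))\<rparr>"


section \<open>Partitions, Young diagrams and Specht modules\<close>

definition partitions :: "nat \<Rightarrow> nat list set" where
  "partitions n = {l. sorted_wrt (\<ge>) l \<and> 0 \<notin> set l \<and> sum_list l = n}"

text \<open>Rows and columns are numbered from 0.\<close>

definition cells :: "nat list \<Rightarrow> (nat \<times> nat) set" where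
  "cells l = {(i, j). i < length l \<and> j < l ! i}"

text \<open>
  A tableau is a bijective filling of the diagram with \<open>1, \<dots>, n\<close>; its values outside
  the diagram are never used.
\<close>

definition tableaux :: "nat list \<Rightarrow> (nat \<times> nat \<Rightarrow> nat) set" where
  "tableaux l = {T. bij_betw T (cells l) {1..sum_list l}}"

text \<open>
  The tabloid of \<open>T\<close> (its class under permutations of the entries within rows) is
  represented by the list of the sets of entries of its rows.
\<close>

definition tabloid :: "nat list \<Rightarrow> (nat \<times> nat \<Rightarrow> nat) \<Rightarrow> nat set list" where
  "tabloid l T = map (\<lambda>i. T ` {c \<in> cells l. fst c = i}) [0..<length l]"

definition column_stabilizer :: "nat list \<Rightarrow> (nat \<times> nat \<Rightarrow> nat) \<Rightarrow> (nat \<Rightarrow> nat) set" where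
  "column_stabilizer l T = {s \<in> carrier (sym_group (sum_list l)).
     \<forall>j. s ` T ` {c \<in> cells l. snd c = j} = T ` {c \<in> cells l. snd c = j}}"

definition polytabloid :: "nat list \<Rightarrow> (nat \<times> nat \<Rightarrow> nat) \<Rightarrow> nat set list \<Rightarrow>\<^sub>0 complex" where
  "polytabloid l T =
     (\<Sum>s\<in>column_stabilizer l T. Poly_Mapping.single (tabloid l (s \<circ> T)) (of_int (sign s)))"

definition tabloid_scale ::
  "complex \<Rightarrow> (nat set list \<Rightarrow>\<^sub>0 complex) \<Rightarrow> (nat set list \<Rightarrow>\<^sub>0 complex)" where
  "tabloid_scale a = Poly_Mapping.map ((*) a)"

text \<open>The linear extension of the action \<open>w \<cdot> {T} = {w \<circ> T}\<close> on tabloids.\<close>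

definition tabloid_act ::
  "(nat \<Rightarrow> nat) \<Rightarrow> (nat set list \<Rightarrow>\<^sub>0 complex) \<Rightarrow> (nat set list \<Rightarrow>\<^sub>0 complex)" where
  "tabloid_act w v =
     (\<Sum>t\<in>Poly_Mapping.keys v.
        Poly_Mapping.single (map ((`) w) t) (Poly_Mapping.lookup v t))"

definition specht :: "nat list \<Rightarrow> (nat set list \<Rightarrow>\<^sub>0 complex) rep" where
  "specht l =
     \<lparr>carrier = Modules.module.span tabloid_scale (polytabloid l ` tableaux l),
      mult = undefined, one = undefined, zero = 0, add = (+),
      smult = tabloid_scale, act = tabloid_act\<rparr>"


section \<open>Schur functions and Frobenius images\<close>

text \<open>
  Symmetric functions in the variables \<open>x\<^sub>0, x\<^sub>1, \<dots>\<close> are given by their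
  coefficients: the exponent vector \<open>\<alpha> :: nat \<Rightarrow>\<^sub>0 nat\<close> stands for the monomial
  \<open>\<Prod>\<^sub>k x\<^sub>k\<^bsup>\<alpha> k\<^esup>\<close>.
\<close>

type_synonym 'r symfun = "(nat \<Rightarrow>\<^sub>0 nat) \<Rightarrow> 'r"

definition semistandard_tableaux :: "nat list \<Rightarrow> (nat \<times> nat \<Rightarrow> nat) set" where
  "semistandard_tableaux l = {T \<in> cells l \<rightarrow>\<^sub>E UNIV.
     (\<forall>i j j'. (i, j) \<in> cells l \<longrightarrow> (i, j') \<in> cells l \<longrightarrow> j \<le> j' \<longrightarrow> T (i, j) \<le> T (i, j')) \<and>
     (\<forall>i i' j. (i, j) \<in> cells l \<longrightarrow> (i', j) \<in> cells l \<longrightarrow> i < i' \<longrightarrow> T (i, j) < T (i', j))}"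

text \<open>The sum of \<open>x\<^sup>T\<close> over all semistandard tableaux \<open>T\<close> of shape \<open>l\<close>.\<close>

definition schur :: "nat list \<Rightarrow> int symfun" where
  "schur l = (\<lambda>\<alpha>. int (card {T \<in> semistandard_tableaux l.
     \<forall>k. card {c \<in> cells l. T c = k} = Poly_Mapping.lookup \<alpha> k}))"

text \<open>
  \<open>has_Frob n V F\<close>: the symmetric function \<open>F\<close> is the Frobenius image of the module
  \<open>V\<close> over the symmetric group of degree \<open>n\<close>. The decomposition exists for every finite-dimensional
  module and its multiplicities \<open>c\<close> are unique, so this is the graph of \<open>Frob\<close>.
\<close>

definition has_Frob :: "nat \<Rightarrow> 'v rep \<Rightarrow> int symfun \<Rightarrow> bool" where
  "has_Frob n V F \<longleftrightarrow> sym_module n V \<and>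
     (\<exists>c :: nat list \<Rightarrow> nat.
        sym_iso n V (direct_sum (SIGMA l:partitions n. {..<c l}) (\<lambda>(l, k). specht l)) \<and>
        F = (\<lambda>\<alpha>. \<Sum>l\<in>partitions n. int (c l) * schur l \<alpha>))"

text \<open>
  For a graded module given by its homogeneous components \<open>V d\<close>, the graded Frobenius
  image \<open>\<Sum>\<^sub>d q\<^sup>d Frob (V d)\<close> has coefficients in the power series in \<open>q\<close>.
\<close>

definition has_grFrob :: "nat \<Rightarrow> (nat \<Rightarrow> 'v rep) \<Rightarrow> int fps symfun \<Rightarrow> bool" where
  "has_grFrob n V F \<longleftrightarrow>
     (\<exists>G. (\<forall>d. has_Frob n (V d) (G d)) \<and> F = (\<lambda>\<alpha>. Abs_fps (\<lambda>d. G d \<alpha>)))"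


section \<open>The quotient ring\<close>

text \<open>
  Polynomials are finitely supported coefficient functions on monomials, and monomials
  are finitely supported exponent functions on variables; the variable \<open>x\<^sub>S\<close> is indexed
  by the set \<open>S\<close>.
\<close>

type_synonym pair_poly = "(nat set \<Rightarrow>\<^sub>0 nat) \<Rightarrow>\<^sub>0 complex"

definition pairs :: "nat \<Rightarrow> nat set set" where
  "pairs n = {S. S \<subseteq> {1..n} \<and> card S = 2}"

definition X :: "nat set \<Rightarrow> pair_poly" where
  "X S = Poly_Mapping.single (Poly_Mapping.single S 1) 1"

definition Const :: "complex \<Rightarrow> pair_poly" where
  "Const a = Poly_Mapping.single 0 a"

definition poly_ring :: "nat \<Rightarrow> pair_poly ring" where
  "poly_ring n =
     \<lparr>carrier = {p. \<forall>m\<in>Poly_Mapping.keys p. Poly_Mapping.keys m \<subseteq> pairs n},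
      mult = (*), one = 1, zero = 0, add = (+)\<rparr>"

text \<open>Homogeneous polynomials of degree \<open>d\<close>; the zero polynomial is one of them.\<close>

definition homogeneous :: "nat \<Rightarrow> pair_poly \<Rightarrow> bool" where
  "homogeneous d p \<longleftrightarrow> (\<forall>m\<in>Poly_Mapping.keys p.
     (\<Sum>S\<in>Poly_Mapping.keys m. Poly_Mapping.lookup m S) = d)"

text \<open>The substitution \<open>x\<^sub>S \<mapsto> x\<^bsub>w ` S\<^esub>\<close>.\<close>

definition poly_act :: "(nat \<Rightarrow> nat) \<Rightarrow> pair_poly \<Rightarrow> pair_poly" where
  "poly_act w p = (\<Sum>m\<in>Poly_Mapping.keys p. Const (Poly_Mapping.lookup p m) *
     (\<Prod>S\<in>Poly_Mapping.keys m. X (w ` S) ^ Poly_Mapping.lookup m S))"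

definition I_ideal :: "nat \<Rightarrow> pair_poly set" where
  "I_ideal n = Idl\<^bsub>poly_ring n\<^esub>
     ({\<Sum>j\<in>{1..n} - {i}. X {i, j} | i. i \<in> {1..n}} \<union>
      {X S * X T | S T. S \<in> pairs n \<and> T \<in> pairs n \<and> S \<inter> T \<noteq> {}})"

text \<open>
  The degree \<open>d\<close> component of the quotient: the cosets of homogeneous polynomials of
  degree \<open>d\<close>, with the operations of the quotient algebra. As the ideal is stable, the
  elementwise image of \<open>I + p\<close> under \<open>w\<close> is the coset \<open>I + w \<cdot> p\<close>.
\<close>

definition quotient_component :: "nat \<Rightarrow> nat \<Rightarrow> pair_poly set rep" where
  "quotient_component n d = (let R = poly_ring n; I = I_ideal n; Q = R Quot I in
     \<lparr>carrier = {I +>\<^bsub>R\<^esub> p | p. p \<in> carrier R \<and> homogeneous d p},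
      mult = mult Q, one = one Q, zero = zero Q, add = add Q,
      smult = (\<lambda>a A. (I +>\<^bsub>R\<^esub> Const a) \<otimes>\<^bsub>Q\<^esub> A),
      act = (\<lambda>w A. poly_act w ` A)\<rparr>)"

end

theory Submission
  imports Defs
begin

text \<open>
  Products of two intersecting variables lie in the ideal, so the degree \<open>d\<close> part of the quotient is spanned by
  the monomials \<open>x\<^sub>M = \<Prod>\<^bsub>S \<in> M\<^esub> x\<^sub>S\<close> of the matchings \<open>M\<close> with \<open>d\<close> edges. The remaining relations say
  \<open>\<Sum>k. x\<^bsub>M \<union> {{i,k}}\<^esub> = 0\<close> for every matching \<open>M\<close> with \<open>d - 1\<close> edges and every vertex \<open>i\<close> outside \<open>M\<close>, the sum
  ranging over the other unmatched vertices. A tabloid is sent to the sum of the \<open>x\<^sub>M\<close> over the matchings \<open>M\<close>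
  whose edges lie inside its rows and avoid row 0. This map is equivariant, and it is shown to induce an
  isomorphism onto the degree \<open>d\<close> part from the direct sum of the Specht modules of the shapes \<open>l\<close> with
  \<open>l ! 0 = n - 2 d\<close> and all other rows even.

  \<^emph>\<open>Injectivity.\<close> The image \<open>E\<^sub>T\<close> of the polytabloid of \<open>T\<close>, seen as a function on matchings, changes sign under
  transpositions inside the columns of \<open>T\<close>. As \<open>T\<close> has only \<open>n - 2 d\<close> columns, this makes \<open>E\<^sub>T\<close> satisfy the
  exchange relation, which is the dual form of the relations above (\<open>tableau.exchange\<close>); hence pairing with \<open>E\<^sub>T\<close> is
  well defined on the quotient (\<open>matching_pairing_I\<close>). Counting the entries of columns shows that the functions
  \<open>E\<^sub>T\<close> of different shapes are orthogonal (\<open>tableau.orthogonal_shapes\<close>), and that on the Specht module of \<open>T\<close> the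
  pairing is a multiple of the standard form with the polytabloid of \<open>T\<close> (\<open>tableau.tabloid_pairing\<close>). The multiple is
  not zero because the matching that joins neighbouring columns has a positive coefficient in \<open>E\<^sub>T\<close>
  (\<open>tableau.aligned_coefficient_pos\<close>).

  \<^emph>\<open>Surjectivity.\<close> By duality it suffices that a function \<open>g\<close> on matchings vanishes if it satisfies the exchange
  relation and is orthogonal to all \<open>E\<^sub>T\<close> (\<open>polytabloid_orthogonal_vanishes\<close>). The symmetrisations of \<open>g\<close> over
  Young subgroups are treated from the large subgroups down to the trivial one, which gives \<open>g\<close> itself. If the
  symmetrisations over the larger subgroups vanish, then the symmetrisation over the present one behaves like a
  highest weight vector. The exchange relation and the raising relations then express all its values by its
  common value on the matchings inside rows other than row 0. Unless the row sizes form one of the shapes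
  \<open>l\<close>, the function is therefore zero. If they do, it is proportional to a symmetrised \<open>E\<^sub>T\<close>, to which it is orthogonal.
\<close>

declare One_nat_def [simp del] atLeastAtMost_iff [simp del]

abbreviation swap :: "'a \<Rightarrow> 'a \<Rightarrow> 'a \<Rightarrow> 'a" where "swap \<equiv> Transposition.transpose"
abbreviation keys where "keys \<equiv> Poly_Mapping.keys"
abbreviation lookup where "lookup \<equiv> Poly_Mapping.lookup"
abbreviation single where "single \<equiv> Poly_Mapping.single"

section \<open>Young subgroups\<close>

text \<open>
  The Young subgroup that preserves the level sets of \<open>r\<close> on \<open>{1..n}\<close>.
\<close>

definition young_group :: "nat \<Rightarrow> (nat \<Rightarrow> nat) \<Rightarrow> (nat \<Rightarrow> nat) set" where
  "young_group n r = {v. v permutes {1..n} \<and> (\<forall>a\<in>{1..n}. r (v a) = r a)}"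

lemma finite_young_group [simp]: "finite (young_group n r)"
  by (rule finite_subset[OF _ finite_permutations[of "{1..n}"]]) (auto simp: young_group_def)

lemma id_in_young_group [simp]: "id \<in> young_group n r"
  by (simp add: young_group_def permutes_id)

lemma young_group_compose: "u \<in> young_group n r \<Longrightarrow> v \<in> young_group n r \<Longrightarrow> u \<circ> v \<in> young_group n r"
  by (auto simp: young_group_def permutes_compose permutes_in_image)

lemma young_group_inv:
  assumes "u \<in> young_group n r"
  shows "inv' u \<in> young_group n r"
proof -
  have u: "u permutes {1..n}" and c: "\<And>a. a \<in> {1..n} \<Longrightarrow> r (u a) = r a"
    using assms by (auto simp: young_group_def)
  have "r (inv' u a) = r a" if "a \<in> {1..n}" for a
    using c[of "inv' u a"] that permutes_in_image[OF permutes_inv[OF u]] permutes_inverses[OF u] by simp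
  then show ?thesis using permutes_inv[OF u] by (simp add: young_group_def)
qed

lemma swap_in_young_group:
  "a \<in> {1..n} \<Longrightarrow> b \<in> {1..n} \<Longrightarrow> r a = r b \<Longrightarrow> swap a b \<in> young_group n r"
  by (auto simp: young_group_def permutes_swap_id transpose_def)

lemma sum_young_group_left:
  assumes t: "t \<in> young_group n r"
  shows "(\<Sum>v\<in>young_group n r. f (t \<circ> v)) = (\<Sum>v\<in>young_group n r. f v)"
proof -
  have p: "t permutes {1..n}" using t by (simp add: young_group_def)
  show ?thesis
    by (rule sum.reindex_bij_witness[where i = "\<lambda>s. inv' t \<circ> s" and j = "\<lambda>s. t \<circ> s"])
       (auto simp: young_group_compose young_group_inv t comp_assoc[symmetric] permutes_inv_o[OF p])
qed

lemma sum_young_group_right: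
  assumes t: "t \<in> young_group n r"
  shows "(\<Sum>v\<in>young_group n r. f (v \<circ> t)) = (\<Sum>v\<in>young_group n r. f v)"
proof -
  have p: "t permutes {1..n}" using t by (simp add: young_group_def)
  show ?thesis
    by (rule sum.reindex_bij_witness[where i = "\<lambda>s. s \<circ> inv' t" and j = "\<lambda>s. s \<circ> t"])
       (auto simp: young_group_compose young_group_inv t comp_assoc permutes_inv_o[OF p])
qed

section \<open>Tableaux and their column stabilizers\<close>

definition row_of :: "nat list \<Rightarrow> (nat \<times> nat \<Rightarrow> nat) \<Rightarrow> nat \<Rightarrow> nat" where
  "row_of l T a = fst (the_inv_into (cells l) T a)"

definition col_of :: "nat list \<Rightarrow> (nat \<times> nat \<Rightarrow> nat) \<Rightarrow> nat \<Rightarrow> nat" where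
  "col_of l T a = snd (the_inv_into (cells l) T a)"

lemma partitions_antimono:
  assumes "l \<in> partitions n" "i \<le> j" "j < length l"
  shows "l ! j \<le> l ! i"
  using assms by (cases "i = j") (auto simp: partitions_def sorted_wrt_iff_nth_less)

lemma partitions_pos: "l \<in> partitions n \<Longrightarrow> i < length l \<Longrightarrow> l ! i > 0"
  unfolding partitions_def by (metis (mono_tags, lifting) gr0I mem_Collect_eq nth_mem)

locale tableau =
  fixes n :: nat and l :: "nat list" and T :: "nat \<times> nat \<Rightarrow> nat"
  assumes shape: "l \<in> partitions n" and filling: "T \<in> tableaux l"
begin

lemma sum_shape: "sum_list l = n"
  using shape by (simp add: partitions_def)

lemma bij: "bij_betw T (cells l) {1..n}"
  using filling sum_shape by (simp add: tableaux_def)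

lemma entry_mem: "c \<in> cells l \<Longrightarrow> T c \<in> {1..n}"
  using bij by (rule bij_betwE[rule_format])

lemma row_of_entry [simp]: "(i, j) \<in> cells l \<Longrightarrow> row_of l T (T (i, j)) = i"
  using bij by (simp add: row_of_def the_inv_into_f_f bij_betw_def)

lemma col_of_entry [simp]: "(i, j) \<in> cells l \<Longrightarrow> col_of l T (T (i, j)) = j"
  using bij by (simp add: col_of_def the_inv_into_f_f bij_betw_def)

lemma cell_of: "a \<in> {1..n} \<Longrightarrow> (row_of l T a, col_of l T a) \<in> cells l"
  using bij_betwE[OF bij_betw_the_inv_into[OF bij]] by (simp add: row_of_def col_of_def)

lemma entry_cell_of: "a \<in> {1..n} \<Longrightarrow> T (row_of l T a, col_of l T a) = a"
  using bij by (simp add: row_of_def col_of_def f_the_inv_into_f_bij_betw)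

lemma cell_eqI:
  assumes "a \<in> {1..n}" "b \<in> {1..n}" "row_of l T a = row_of l T b" "col_of l T a = col_of l T b"
  shows "a = b"
  using entry_cell_of assms by metis

lemma row_eq: "T ` {c \<in> cells l. fst c = i} = {a \<in> {1..n}. row_of l T a = i}"
proof (intro equalityI subsetI)
  fix a assume "a \<in> T ` {c \<in> cells l. fst c = i}"
  then obtain j where "(i, j) \<in> cells l" "a = T (i, j)" by auto
  then show "a \<in> {a \<in> {1..n}. row_of l T a = i}" using entry_mem by simp
next
  fix a assume "a \<in> {a \<in> {1..n}. row_of l T a = i}"
  then show "a \<in> T ` {c \<in> cells l. fst c = i}"
    using cell_of[of a] entry_cell_of[of a]
    by (intro image_eqI[of _ _ "(row_of l T a, col_of l T a)"]) auto
qed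

lemma column_eq: "T ` {c \<in> cells l. snd c = j} = {a \<in> {1..n}. col_of l T a = j}"
proof (intro equalityI subsetI)
  fix a assume "a \<in> T ` {c \<in> cells l. snd c = j}"
  then obtain i where "(i, j) \<in> cells l" "a = T (i, j)" by auto
  then show "a \<in> {a \<in> {1..n}. col_of l T a = j}" using entry_mem by simp
next
  fix a assume "a \<in> {a \<in> {1..n}. col_of l T a = j}"
  then show "a \<in> T ` {c \<in> cells l. snd c = j}"
    using cell_of[of a] entry_cell_of[of a]
    by (intro image_eqI[of _ _ "(row_of l T a, col_of l T a)"]) auto
qed

lemma tabloid_eq: "tabloid l T = map (\<lambda>i. {a \<in> {1..n}. row_of l T a = i}) [0..<length l]"
  by (simp add: tabloid_def row_eq)

lemma column_stabilizer_iff: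
  "s \<in> column_stabilizer l T \<longleftrightarrow>
     s permutes {1..n} \<and> (\<forall>a\<in>{1..n}. col_of l T (s a) = col_of l T a)"
proof (cases "s permutes {1..n}")
  case True
  have "(\<forall>j. s ` {a \<in> {1..n}. col_of l T a = j} = {a \<in> {1..n}. col_of l T a = j})
      \<longleftrightarrow> (\<forall>a\<in>{1..n}. col_of l T (s a) = col_of l T a)" (is "?L \<longleftrightarrow> ?R")
  proof
    assume ?L then show ?R by blast
  next
    assume R: ?R
    show ?L
    proof
      fix j
      have "s ` {a \<in> {1..n}. col_of l T a = j} \<subseteq> {a \<in> {1..n}. col_of l T a = j}"
        using R permutes_in_image[OF True] by auto
      then show "s ` {a \<in> {1..n}. col_of l T a = j} = {a \<in> {1..n}. col_of l T a = j}"
        by (intro card_subset_eq) (auto simp: card_image permutes_inj_on[OF True])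
    qed
  qed
  then show ?thesis
    using True by (simp add: column_stabilizer_def sym_group_carrier sum_shape column_eq)
qed (simp add: column_stabilizer_def sym_group_carrier sum_shape)

lemma permuted_tableau:
  assumes "u permutes {1..n}"
  shows "tableau n l (u \<circ> T)"
  using shape bij_betw_trans[OF bij permutes_imp_bij[OF assms]] sum_shape
  by unfold_locales (auto simp: tableaux_def)

lemma row_of_permuted:
  assumes u: "u permutes {1..n}" and a: "a \<in> {1..n}"
  shows "row_of l (u \<circ> T) (u a) = row_of l T a"
proof -
  interpret uT: tableau n l "u \<circ> T" by (rule permuted_tableau[OF u])
  show ?thesis
    using uT.row_of_entry[OF cell_of[OF a]] entry_cell_of[OF a] by simp
qed

lemma col_of_permuted:
  assumes u: "u permutes {1..n}" and a: "a \<in> {1..n}"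
  shows "col_of l (u \<circ> T) (u a) = col_of l T a"
proof -
  interpret uT: tableau n l "u \<circ> T" by (rule permuted_tableau[OF u])
  show ?thesis
    using uT.col_of_entry[OF cell_of[OF a]] entry_cell_of[OF a] by simp
qed

lemma column_stabilizer_eq: "column_stabilizer l T = young_group n (col_of l T)"
  by (auto simp: column_stabilizer_iff young_group_def)

lemma finite_column_stabilizer [simp]: "finite (column_stabilizer l T)"
  by (simp add: column_stabilizer_eq)

lemma id_in_column_stabilizer [simp]: "id \<in> column_stabilizer l T"
  by (simp add: column_stabilizer_eq)

lemmas column_stabilizer_inv = young_group_inv[of _ n "col_of l T", folded column_stabilizer_eq]
lemmas swap_in_column_stabilizer =
  swap_in_young_group[of _ n _ "col_of l T", folded column_stabilizer_eq]
lemmas sum_column_stabilizer_left = sum_young_group_left[of _ n "col_of l T", folded column_stabilizer_eq]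

lemma column_stabilizer_permuted:
  assumes u: "u permutes {1..n}"
  shows "column_stabilizer l (u \<circ> T) = (\<lambda>s. u \<circ> s \<circ> inv' u) ` column_stabilizer l T"
proof -
  interpret uT: tableau n l "u \<circ> T" by (rule permuted_tableau[OF u])
  have iu: "inv' u permutes {1..n}" by (rule permutes_inv[OF u])
  have col: "col_of l (u \<circ> T) b = col_of l T (inv' u b)" if "b \<in> {1..n}" for b
    using col_of_permuted[OF u, of "inv' u b"] that permutes_in_image[OF iu] permutes_inverses[OF u]
    by simp
  show ?thesis
  proof (intro equalityI subsetI)
    fix t assume t: "t \<in> column_stabilizer l (u \<circ> T)"
    then have tp: "t permutes {1..n}" by (simp add: uT.column_stabilizer_iff)
    have "inv' u \<circ> t \<circ> u \<in> column_stabilizer l T"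
      using t col_of_permuted[OF u]
      by (auto simp: column_stabilizer_iff uT.column_stabilizer_iff col permutes_in_image[OF tp]
          permutes_in_image[OF u] permutes_inverses[OF u] intro!: permutes_compose u iu)
    moreover have "t = u \<circ> (inv' u \<circ> t \<circ> u) \<circ> inv' u"
      by (simp add: fun_eq_iff permutes_inverses[OF u])
    ultimately show "t \<in> (\<lambda>s. u \<circ> s \<circ> inv' u) ` column_stabilizer l T" by blast
  next
    fix t assume "t \<in> (\<lambda>s. u \<circ> s \<circ> inv' u) ` column_stabilizer l T"
    then obtain s where s: "s \<in> column_stabilizer l T" and t: "t = u \<circ> s \<circ> inv' u" by blast
    have sp: "s permutes {1..n}" using s by (simp add: column_stabilizer_iff)
    show "t \<in> column_stabilizer l (u \<circ> T)"
      using s unfolding t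
      by (auto simp: column_stabilizer_iff uT.column_stabilizer_iff col permutes_in_image[OF sp]
          permutes_in_image[OF u] permutes_in_image[OF iu] permutes_inverses[OF u]
          intro!: permutes_compose u iu)
  qed
qed

lemma sum_column_stabilizer_permuted:
  assumes u: "u permutes {1..n}"
  shows "(\<Sum>s\<in>column_stabilizer l (u \<circ> T). f s) = (\<Sum>s\<in>column_stabilizer l T. f (u \<circ> s \<circ> inv' u))"
proof -
  have "inj_on (\<lambda>s. u \<circ> s \<circ> inv' u) (column_stabilizer l T)"
  proof (rule inj_onI)
    fix s t assume "u \<circ> s \<circ> inv' u = u \<circ> t \<circ> inv' u"
    then have "inv' u \<circ> (u \<circ> s \<circ> inv' u) \<circ> u = inv' u \<circ> (u \<circ> t \<circ> inv' u) \<circ> u" by simp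
    then show "s = t" by (simp add: fun_eq_iff permutes_inverses[OF u])
  qed
  then show ?thesis by (simp add: column_stabilizer_permuted[OF u] sum.reindex)
qed

lemma sign_conj:
  assumes "u permutes {1..n}" "s permutes {1..n}"
  shows "sign (u \<circ> s \<circ> inv' u) = sign s"
proof -
  have "permutation u" "permutation s" "permutation (inv' u)"
    using assms permutes_imp_permutation permutes_inv by blast+
  then show ?thesis
    by (simp add: sign_compose permutation_compose sign_inverse)
qed

section \<open>Dominance\<close>

definition height :: "nat \<Rightarrow> nat" where
  "height j = card {i. (i, j) \<in> cells l}"

text \<open>
  Row lengths decrease weakly, so the cells of a column form an initial segment.
\<close>

lemma column_cells: "{i. (i, j) \<in> cells l} = {..<height j}"
proof -
  let ?A = "{i. (i, j) \<in> cells l}"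
  have fin: "finite ?A" by (rule finite_subset[of _ "{..<length l}"]) (auto simp: cells_def)
  have down: "i' \<in> ?A" if "i \<in> ?A" "i' \<le> i" for i i'
    using that partitions_antimono[OF shape, of i' i] by (auto simp: cells_def)
  have "?A = {..<card ?A}"
  proof (cases "?A = {}")
    case False
    then have "?A = {..Max ?A}" using down fin Max_in by (auto intro: Max_ge)
    then show ?thesis by (metis card_atMost lessThan_Suc_atMost)
  qed simp
  then show ?thesis by (simp add: height_def)
qed

lemma cells_iff: "(i, j) \<in> cells l \<longleftrightarrow> i < height j"
  using column_cells by blast

lemma card_column: "card {a \<in> {1..n}. col_of l T a = j} = height j"
proof -
  have "card {a \<in> {1..n}. col_of l T a = j} = card {c \<in> cells l. snd c = j}"
    unfolding column_eq[symmetric]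
    by (rule card_image) (rule inj_on_subset[OF bij_betw_imp_inj_on[OF bij]], auto)
  also have "{c \<in> cells l. snd c = j} = (\<lambda>i. (i, j)) ` {..<height j}"
    using cells_iff by auto
  also have "card \<dots> = height j" by (simp add: card_image inj_on_def)
  finally show ?thesis .
qed

lemma col_of_less: "a \<in> {1..n} \<Longrightarrow> col_of l T a < l ! 0"
  using cell_of[of a] partitions_antimono[OF shape, of 0 "row_of l T a"] by (auto simp: cells_def)

lemma split_by_column:
  "card {a \<in> {1..n}. P a} = (\<Sum>j<l ! 0. card {a \<in> {1..n}. col_of l T a = j \<and> P a})"
proof -
  have "{a \<in> {1..n}. P a} = (\<Union>j<l ! 0. {a \<in> {1..n}. col_of l T a = j \<and> P a})"
    using col_of_less by auto
  also have "card \<dots> = (\<Sum>j<l ! 0. card {a \<in> {1..n}. col_of l T a = j \<and> P a})"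
    by (rule card_UN_disjoint) auto
  finally show ?thesis .
qed

lemma card_column_upper_own:
  "card {a \<in> {1..n}. col_of l T a = j \<and> row_of l T a \<le> k} = min (height j) (Suc k)"
proof -
  have "{a \<in> {1..n}. col_of l T a = j \<and> row_of l T a \<le> k} = (\<lambda>i. T (i, j)) ` {..<min (height j) (Suc k)}"
    (is "?A = ?f ` ?B")
  proof (intro equalityI subsetI)
    fix a assume "a \<in> ?A"
    then show "a \<in> ?f ` ?B"
      using cell_of[of a] entry_cell_of[of a] by (auto simp: cells_iff intro!: image_eqI[of _ _ "row_of l T a"])
  next
    fix a assume "a \<in> ?f ` ?B"
    then show "a \<in> ?A"
      using entry_mem by (force simp: cells_iff)
  qed
  moreover have "inj_on ?f ?B"
  proof (rule inj_onI)
    fix x y assume "x \<in> ?B" "y \<in> ?B" "T (x, j) = T (y, j)"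
    then show "x = y" by (metis cells_iff row_of_entry lessThan_iff min_less_iff_conj)
  qed
  ultimately show ?thesis by (simp add: card_image)
qed

lemma card_column_upper:
  assumes "inj_on r {a \<in> {1..n}. col_of l T a = j}"
  shows "card {a \<in> {1..n}. col_of l T a = j \<and> r a \<le> k} \<le> min (height j) (Suc k)"
proof -
  have "card {a \<in> {1..n}. col_of l T a = j \<and> r a \<le> k} \<le> card {a \<in> {1..n}. col_of l T a = j}"
    by (rule card_mono) auto
  moreover have "card {a \<in> {1..n}. col_of l T a = j \<and> r a \<le> k} \<le> card {..k}"
    by (rule card_inj_on_le[where f = r]) (auto intro: inj_on_subset[OF assms])
  ultimately show ?thesis by (simp add: card_column)
qed

text \<open>
  If \<open>r\<close> is injective on a column of height \<open>h\<close>, then it takes values up to \<open>k\<close> at most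
  \<open>min h (k + 1)\<close> times there, and the rows of the tableau itself attain this bound. The inequality is
  the sum over all columns.
\<close>

lemma dominance:
  assumes "\<And>j. inj_on r {a \<in> {1..n}. col_of l T a = j}"
  shows "card {a \<in> {1..n}. r a \<le> k} \<le> card {a \<in> {1..n}. row_of l T a \<le> k}"
proof -
  have "card {a \<in> {1..n}. r a \<le> k} \<le> (\<Sum>j<l ! 0. min (height j) (Suc k))"
    unfolding split_by_column[of "\<lambda>a. r a \<le> k"]
    by (intro sum_mono card_column_upper assms)
  also have "\<dots> = card {a \<in> {1..n}. row_of l T a \<le> k}"
    unfolding split_by_column[of "\<lambda>a. row_of l T a \<le> k"]
    by (simp only: card_column_upper_own)
  finally show ?thesis .
qed

text \<open>
  Equality in the sum forces equality in every column; the bound for \<open>k\<close> one less than the height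
  then says that all entries of the column are among those with \<open>r a \<le> k\<close>.
\<close>

lemma dominance_equality:
  assumes inj: "\<And>j. inj_on r {a \<in> {1..n}. col_of l T a = j}"
    and eq: "\<And>k. card {a \<in> {1..n}. r a \<le> k} = card {a \<in> {1..n}. row_of l T a \<le> k}"
    and a: "a \<in> {1..n}"
  shows "r a < height (col_of l T a)"
proof -
  define j where "j = col_of l T a"
  have hpos: "height j > 0" using cell_of[OF a] by (simp add: j_def cells_iff)
  (* For this k the bound min (height j) (Suc k) is the full height. *)
  let ?k = "height j - 1"
  have "(\<Sum>j<l ! 0. card {a \<in> {1..n}. col_of l T a = j \<and> r a \<le> ?k})
      = (\<Sum>j<l ! 0. min (height j) (Suc ?k))"
    using eq[of ?k] unfolding split_by_column[of "\<lambda>a. r a \<le> ?k"]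
      split_by_column[of "\<lambda>a. row_of l T a \<le> ?k"] card_column_upper_own .
  then have "card {a \<in> {1..n}. col_of l T a = j \<and> r a \<le> ?k} = min (height j) (Suc ?k)"
    by (rule sum_mono_inv) (auto intro!: card_column_upper inj simp: j_def col_of_less[OF a] simp del: min.bounded_iff)
  also have "\<dots> = card {a \<in> {1..n}. col_of l T a = j}"
    using hpos by (simp add: card_column)
  finally have "{a \<in> {1..n}. col_of l T a = j \<and> r a \<le> ?k} = {a \<in> {1..n}. col_of l T a = j}"
    by (intro card_subset_eq) auto
  then have "r a \<le> ?k" using a j_def by blast
  then show ?thesis using hpos unfolding j_def by linarith
qed

text \<open>
  The combinatorial core of James's submodule theorem. When the rows of \<open>T'\<close> separate the columns of
  \<open>T\<close>, the equality case of dominance shows that a column of height \<open>h\<close> meets exactly the rows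
  \<open>0, \<dots>, h - 1\<close> of \<open>T'\<close>, so each column of \<open>T\<close> can be sorted by these rows.
\<close>

lemma column_rearrangement:
  assumes "tableau n l T'"
    and inj: "\<And>j. inj_on (row_of l T') {a \<in> {1..n}. col_of l T a = j}"
  obtains s where "s \<in> column_stabilizer l T" "tabloid l (s \<circ> T) = tabloid l T'"
proof -
  interpret T': tableau n l T' by fact
  let ?r = "row_of l T'"
  have row_card: "card {a \<in> {1..n}. ?r a \<le> k} = card {a \<in> {1..n}. row_of l T a \<le> k}" for k
    by (simp only: split_by_column[of "\<lambda>a. row_of l T a \<le> k"] card_column_upper_own
      T'.split_by_column[of "\<lambda>a. ?r a \<le> k"] T'.card_column_upper_own)
  have lt: "?r a < height (col_of l T a)" if "a \<in> {1..n}" for a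
    by (rule dominance_equality[OF inj row_card that])
  have onto: "?r ` {a \<in> {1..n}. col_of l T a = j} = {..<height j}" for j
    using lt by (intro card_subset_eq) (auto simp: card_image[OF inj] card_column)
  define s where "s = (\<lambda>a. if a \<in> {1..n} then
      the_inv_into {b \<in> {1..n}. col_of l T b = col_of l T a} ?r (row_of l T a) else a)"
  have s: "s a \<in> {1..n} \<and> col_of l T (s a) = col_of l T a \<and> ?r (s a) = row_of l T a"
    if a: "a \<in> {1..n}" for a
  proof -
    let ?C = "{b \<in> {1..n}. col_of l T b = col_of l T a}"
    have mem: "row_of l T a \<in> ?r ` ?C" using cell_of[OF a] by (simp add: onto cells_iff)
    have "s a \<in> ?C" using the_inv_into_into[OF inj mem subset_refl] a by (simp add: s_def)
    moreover have "?r (s a) = row_of l T a" using f_the_inv_into_f[OF inj mem] a by (simp add: s_def)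
    ultimately show ?thesis by blast
  qed
  have sp: "s permutes {1..n}"
  proof (rule inj_imp_permutes)
    show "inj_on s {1..n}"
    proof (rule inj_onI)
      fix a b assume ab: "a \<in> {1..n}" "b \<in> {1..n}" "s a = s b"
      have "row_of l T a = row_of l T b" "col_of l T a = col_of l T b"
        using s[OF ab(1)] s[OF ab(2)] unfolding ab(3) by argo+
      then show "a = b" by (rule cell_eqI[OF ab(1,2)])
    qed
    show "s a \<in> {1..n}" if "a \<in> {1..n}" for a using s[OF that] by blast
    show "s a = a" if "a \<notin> {1..n}" for a using that by (simp add: s_def)
  qed simp
  have stab: "s \<in> column_stabilizer l T" using sp s column_stabilizer_iff by blast
  interpret sT: tableau n l "s \<circ> T" by (rule permuted_tableau[OF sp])
  have "row_of l (s \<circ> T) b = ?r b" if b: "b \<in> {1..n}" for b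
  proof -
    have "b \<in> s ` {1..n}" using b permutes_image[OF sp] by simp
    then obtain a where a: "a \<in> {1..n}" "b = s a" by blast
    have "row_of l (s \<circ> T) b = row_of l T a" unfolding a(2) by (rule row_of_permuted[OF sp a(1)])
    also have "\<dots> = ?r b" unfolding a(2) using s[OF a(1)] by argo
    finally show ?thesis .
  qed
  then have "tabloid l (s \<circ> T) = tabloid l T'"
    unfolding sT.tabloid_eq T'.tabloid_eq by (intro map_cong) auto
  with stab show ?thesis using that by blast
qed

end

section \<open>Matchings and their polytabloids\<close>

declare sum_of_bool_mult_eq [simp del] sum_mult_of_bool_eq [simp del]

definition matchings :: "nat \<Rightarrow> nat \<Rightarrow> nat set set set" where
  "matchings n d = {M. M \<subseteq> pairs n \<and> card M = d \<and> pairwise disjnt M}"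

definition matching_act :: "(nat \<Rightarrow> nat) \<Rightarrow> nat set set \<Rightarrow> nat set set" where
  "matching_act w M = (`) w ` M"

lemma finite_pairs [simp]: "finite (pairs n)"
  by (rule finite_subset[of _ "Pow {1..n}"]) (auto simp: pairs_def)

lemma finite_matchings [simp]: "finite (matchings n d)"
  by (rule finite_subset[of _ "Pow (pairs n)"]) (auto simp: matchings_def)

lemma pairsE:
  assumes "S \<in> pairs n"
  obtains a b where "S = {a, b}" "a \<noteq> b" "a \<in> {1..n}" "b \<in> {1..n}"
  using assms by (auto simp: pairs_def card_2_iff)

lemma pair_mem: "a \<in> {1..n} \<Longrightarrow> b \<in> {1..n} \<Longrightarrow> a \<noteq> b \<Longrightarrow> {a, b} \<in> pairs n"
  by (auto simp: pairs_def)

lemma pairs_image: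
  assumes "w permutes {1..n}" "S \<in> pairs n"
  shows "w ` S \<in> pairs n"
  using assms permutes_image[OF assms(1)] permutes_inj_on[OF assms(1)]
  by (auto simp: pairs_def card_image)

lemma matching_vertices: "M \<in> matchings n d \<Longrightarrow> \<Union>M \<subseteq> {1..n}"
  by (auto simp: matchings_def pairs_def)

lemma matching_finite: "M \<in> matchings n d \<Longrightarrow> finite M"
  by (auto simp: matchings_def intro: finite_subset[OF _ finite_pairs])

lemma matching_edge_eqI:
  "M \<in> matchings n d \<Longrightarrow> S \<in> M \<Longrightarrow> S' \<in> M \<Longrightarrow> a \<in> S \<Longrightarrow> a \<in> S' \<Longrightarrow> S = S'"
  by (simp add: matchings_def pairwise_def disjnt_def) blast

lemma card_matching_vertices:
  assumes "M \<subseteq> pairs n" "pairwise disjnt M"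
  shows "card (\<Union>M) = 2 * card M"
proof -
  have "card (\<Union>M) = sum card M"
    using assms by (intro card_Union_disjoint) (auto simp: pairs_def intro: finite_subset)
  also have "\<dots> = (\<Sum>S\<in>M. 2)" using assms by (intro sum.cong) (auto simp: pairs_def)
  finally show ?thesis by simp
qed

lemma matching_edge:
  assumes "M \<in> matchings n d" "a \<in> \<Union>M"
  obtains b where "{a, b} \<in> M" "a \<noteq> b" "a \<in> {1..n}" "b \<in> {1..n}"
proof -
  from assms obtain S where S: "S \<in> M" "a \<in> S" by blast
  then have "S \<in> pairs n" using assms by (auto simp: matchings_def)
  then obtain x y where xy: "S = {x, y}" "x \<noteq> y" "x \<in> {1..n}" "y \<in> {1..n}" by (rule pairsE)
  show ?thesis
  proof (cases "a = x")
    case True then show ?thesis using S xy by (intro that[of y]) auto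
  next
    case False then show ?thesis using S xy by (intro that[of x]) (auto simp: insert_commute)
  qed
qed

lemma matching_remove_edge:
  assumes "M \<in> matchings n d" "S \<in> M"
  obtains e where "d = Suc e" "M - {S} \<in> matchings n e" "\<Union>(M - {S}) = \<Union>M - S"
proof -
  have fin: "finite M" by (rule matching_finite[OF assms(1)])
  have "card M = Suc (card (M - {S}))" using card_Suc_Diff1[OF fin assms(2)] by simp
  moreover have "M - {S} \<in> matchings n (card (M - {S}))"
    using assms by (auto simp: matchings_def pairwise_def)
  moreover have "\<Union>(M - {S}) = \<Union>M - S"
    using matching_edge_eqI[OF assms(1)] assms(2) by auto
  moreover have "card M = d" using assms(1) by (simp add: matchings_def)
  ultimately show ?thesis using that[of "card (M - {S})"] by simp
qed

lemma matching_insert_edge: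
  assumes "M \<in> matchings n e" "a \<in> {1..n}" "b \<in> {1..n}" "a \<noteq> b" "a \<notin> \<Union>M" "b \<notin> \<Union>M"
  shows "insert {a, b} M \<in> matchings n (Suc e)"
proof -
  have "{a, b} \<notin> M" using assms by blast
  then show ?thesis
    using assms matching_finite[OF assms(1)] pair_mem[of a n b]
    by (auto simp: matchings_def pairwise_insert disjnt_def)
qed

lemma matching_act_mem:
  assumes "w permutes {1..n}" "M \<in> matchings n d"
  shows "matching_act w M \<in> matchings n d"
proof -
  have inj: "inj ((`) w)" using permutes_inj[OF assms(1)] by (simp add: inj_image_eq_iff inj_def)
  have "pairwise disjnt ((`) w ` M)"
    using assms(2) permutes_inj[OF assms(1)]
    by (auto simp: matchings_def pairwise_def disjnt_def inj_image_eq_iff image_Int[symmetric])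
  then show ?thesis
    using assms pairs_image[OF assms(1)]
    by (auto simp: matchings_def matching_act_def card_image inj_on_subset[OF inj])
qed

lemma matching_act_id [simp]: "matching_act id M = M"
  by (simp add: matching_act_def)

lemma matching_act_compose: "matching_act (u \<circ> v) M = matching_act u (matching_act v M)"
  by (simp add: matching_act_def image_image image_comp)

lemma matching_act_inv:
  assumes "w permutes S"
  shows "matching_act w (matching_act (inv' w) M) = M" "matching_act (inv' w) (matching_act w M) = M"
  using permutes_inv_o[OF assms] by (simp_all add: matching_act_compose[symmetric])

lemma matching_act_insert [simp]:
  "matching_act w (insert {a, b} M) = insert {w a, w b} (matching_act w M)"
  by (simp add: matching_act_def)

lemma matching_act_fixed:
  assumes "\<And>a. a \<in> \<Union>M \<Longrightarrow> w a = a"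
  shows "matching_act w M = M"
proof -
  have "w ` S = S" if "S \<in> M" for S
    using assms that by (force simp: image_iff)
  then show ?thesis by (simp add: matching_act_def)
qed

lemma Union_matching_act: "\<Union>(matching_act w M) = w ` \<Union>M"
  by (auto simp: matching_act_def)

lemma sum_matching_act:
  assumes "w permutes {1..n}"
  shows "(\<Sum>M\<in>matchings n d. f (matching_act w M)) = (\<Sum>M\<in>matchings n d. f M)"
  by (rule sum.reindex_bij_witness[where i = "matching_act (inv' w)" and j = "matching_act w"])
     (auto simp: matching_act_mem assms permutes_inv matching_act_inv[OF assms])

text \<open>
  Row 0 of a tabloid holds the vertices that stay unmatched; every edge has to lie inside one of the
  other rows.
\<close>

definition compatible :: "nat set list \<Rightarrow> nat set set \<Rightarrow> bool" where
  "compatible t M \<longleftrightarrow> (\<forall>S\<in>M. \<exists>i. 0 < i \<and> i < length t \<and> S \<subseteq> t ! i)"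

lemma compatible_act:
  assumes "inj w"
  shows "compatible (map ((`) w) t) (matching_act w M) \<longleftrightarrow> compatible t M"
proof -
  have "(\<exists>i. 0 < i \<and> i < length t \<and> w ` S \<subseteq> map ((`) w) t ! i) \<longleftrightarrow>
      (\<exists>i. 0 < i \<and> i < length t \<and> S \<subseteq> t ! i)" for S
    by (intro ex_cong1) (auto simp: inj_image_subset_iff[OF assms])
  then show ?thesis by (simp add: compatible_def matching_act_def)
qed

lemma tabloid_permuted: "tabloid l (u \<circ> T) = map ((`) u) (tabloid l T)"
  by (simp add: tabloid_def image_comp)

text \<open>
  Sending a tabloid to the sum of its compatible matchings is equivariant. This is the image of the
  polytabloid of \<open>T\<close> under this map, as a function on matchings.
\<close>

definition matching_polytabloid :: "nat list \<Rightarrow> (nat \<times> nat \<Rightarrow> nat) \<Rightarrow> nat set set \<Rightarrow> int" where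
  "matching_polytabloid l T M =
     (\<Sum>s\<in>column_stabilizer l T. sign s * of_bool (compatible (tabloid l (s \<circ> T)) M))"

text \<open>
  The shapes that contribute to degree \<open>d\<close>: row 0 leaves room for exactly \<open>d\<close> edges, and the other
  rows can be matched perfectly.
\<close>

definition even_tail_shapes :: "nat \<Rightarrow> nat \<Rightarrow> nat list set" where
  "even_tail_shapes n d = {l \<in> partitions n. l \<noteq> [] \<and>
     (\<forall>i. 0 < i \<and> i < length l \<longrightarrow> even (l ! i)) \<and> l ! 0 + 2 * d = n}"

text \<open>
  The condition dual to the linear generators of the ideal. It says that the linear functional with value
  \<open>g N\<close> at the monomial of each matching \<open>N\<close> with \<open>d\<close> edges, and 0 at all other monomials, kills
  \<open>(\<Sum>k. x\<^bsub>{i,k}\<^esub>) x\<^sub>M\<close> for each matching \<open>M\<close> with one edge less that misses \<open>i\<close>. Writing \<open>d = Suc e\<close> makes the condition void in degree 0.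
\<close>

definition exchange_relation :: "nat \<Rightarrow> nat \<Rightarrow> (nat set set \<Rightarrow> 'a::comm_monoid_add) \<Rightarrow> bool" where
  "exchange_relation n d g \<longleftrightarrow> (\<forall>e M i. d = Suc e \<longrightarrow> M \<in> matchings n e \<longrightarrow> i \<in> {1..n} - \<Union>M \<longrightarrow>
     (\<Sum>k\<in>{1..n} - \<Union>M - {i}. g (insert {i, k} M)) = 0)"

context tableau
begin

lemma compatible_tabloid_iff:
  assumes "M \<subseteq> pairs n"
  shows "compatible (tabloid l T) M \<longleftrightarrow> (\<forall>S\<in>M. \<exists>i>0. \<forall>a\<in>S. row_of l T a = i)"
proof -
  have "(\<exists>i. 0 < i \<and> i < length (tabloid l T) \<and> S \<subseteq> tabloid l T ! i) \<longleftrightarrow>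
      (\<exists>i>0. \<forall>a\<in>S. row_of l T a = i)" if "S \<in> M" for S
  proof -
    have "S \<in> pairs n" using assms that by blast
    then obtain a b where S: "S = {a, b}" "a \<noteq> b" "a \<in> {1..n}" "b \<in> {1..n}" by (rule pairsE)
    have "row_of l T a < length l" using cell_of[OF S(3)] by (simp add: cells_def)
    then show ?thesis using S by (auto simp: tabloid_eq)
  qed
  then show ?thesis by (simp add: compatible_def)
qed

lemma antisymmetric:
  assumes t: "t \<in> column_stabilizer l T"
  shows "matching_polytabloid l T (matching_act t M) = sign t * matching_polytabloid l T M"
proof -
  have p: "t permutes {1..n}" using t by (simp add: column_stabilizer_iff)
  have "matching_polytabloid l T (matching_act t M) =
     (\<Sum>s\<in>column_stabilizer l T. sign (t \<circ> s) * of_bool (compatible (tabloid l (t \<circ> s \<circ> T)) (matching_act t M)))"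
    unfolding matching_polytabloid_def
    by (rule sum_column_stabilizer_left[OF t, symmetric])
  also have "\<dots> = (\<Sum>s\<in>column_stabilizer l T. sign t * (sign s * of_bool (compatible (tabloid l (s \<circ> T)) M)))"
  proof (intro sum.cong refl)
    fix s assume "s \<in> column_stabilizer l T"
    then have "s permutes {1..n}" by (simp add: column_stabilizer_iff)
    then have "sign (t \<circ> s) = sign t * sign s"
      using p by (intro sign_compose) (auto intro: permutes_imp_permutation)
    moreover have "compatible (tabloid l (t \<circ> s \<circ> T)) (matching_act t M) = compatible (tabloid l (s \<circ> T)) M"
      by (simp add: comp_assoc tabloid_permuted[of l t] compatible_act permutes_inj[OF p])
    ultimately show "sign (t \<circ> s) * of_bool (compatible (tabloid l (t \<circ> s \<circ> T)) (matching_act t M)) =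
        sign t * (sign s * of_bool (compatible (tabloid l (s \<circ> T)) M))" by simp
  qed
  finally show ?thesis by (simp add: matching_polytabloid_def sum_distrib_left)
qed

lemma equivariant:
  assumes u: "u permutes {1..n}"
  shows "matching_polytabloid l (u \<circ> T) (matching_act u M) = matching_polytabloid l T M"
proof -
  have "u \<circ> s \<circ> inv' u \<circ> (u \<circ> T) = u \<circ> (s \<circ> T)" for s
    by (simp add: fun_eq_iff permutes_inverses[OF u])
  then have "matching_polytabloid l (u \<circ> T) (matching_act u M) =
    (\<Sum>s\<in>column_stabilizer l T. sign (u \<circ> s \<circ> inv' u) * of_bool (compatible (tabloid l (s \<circ> T)) M))"
    by (simp add: matching_polytabloid_def sum_column_stabilizer_permuted[OF u]
        tabloid_permuted[of l u] compatible_act permutes_inj[OF u])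
  also have "\<dots> = matching_polytabloid l T M"
    unfolding matching_polytabloid_def
    by (intro sum.cong refl) (simp add: sign_conj[OF u] column_stabilizer_iff)
  finally show ?thesis .
qed

lemma antisymmetric_transpose:
  assumes "a \<in> {1..n}" "b \<in> {1..n}" "col_of l T a = col_of l T b" "a \<noteq> b"
  shows "matching_polytabloid l T (matching_act (swap a b) M) = - matching_polytabloid l T M"
  using antisymmetric[OF swap_in_column_stabilizer[OF assms(1-3)]] assms(4) by (simp add: sign_swap_id)

text \<open>
  The transposition of two entries that share a column of \<open>T\<close> and a value of \<open>r\<close> permutes the terms of
  the sum and reverses their sign.
\<close>

lemma row_sum_vanishes:
  assumes "\<not> inj_on r {a \<in> {1..n}. col_of l T a = j}"
  shows "(\<Sum>v\<in>young_group n r. matching_polytabloid l T (matching_act v M)) = 0"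
proof -
  obtain a b where ab: "a \<in> {1..n}" "b \<in> {1..n}" "col_of l T a = col_of l T b" "a \<noteq> b" "r a = r b"
    using assms by (auto simp: inj_on_def)
  let ?t = "swap a b"
  have "(\<Sum>v\<in>young_group n r. matching_polytabloid l T (matching_act v M)) =
      (\<Sum>v\<in>young_group n r. matching_polytabloid l T (matching_act (?t \<circ> v) M))"
    by (rule sum_young_group_left[symmetric]) (use ab in \<open>auto intro: swap_in_young_group\<close>)
  also have "\<dots> = - (\<Sum>v\<in>young_group n r. matching_polytabloid l T (matching_act v M))"
    by (simp add: matching_act_compose antisymmetric_transpose[OF ab(1-4)] sum_negf)
  finally show ?thesis by simp
qed

lemma tabloid_pairing_permuted:
  assumes s: "s \<in> column_stabilizer l T"
  shows "(\<Sum>M\<in>matchings n d. of_bool (compatible (map ((`) s) t) M) * matching_polytabloid l T M) =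
     sign s * (\<Sum>M\<in>matchings n d. of_bool (compatible t M) * matching_polytabloid l T M)"
proof -
  have p: "s permutes {1..n}" using s by (simp add: column_stabilizer_iff)
  have "(\<Sum>M\<in>matchings n d. of_bool (compatible (map ((`) s) t) M) * matching_polytabloid l T M) =
    (\<Sum>M\<in>matchings n d. of_bool (compatible (map ((`) s) t) (matching_act s M)) * matching_polytabloid l T (matching_act s M))"
    by (rule sum_matching_act[OF p, symmetric])
  then show ?thesis
    by (simp add: compatible_act permutes_inj[OF p] antisymmetric[OF s] sum_distrib_left mult.left_commute)
qed

lemma row_of_tabloid_eq:
  assumes "tableau n l T'" "tabloid l T = tabloid l T'" "a \<in> {1..n}"
  shows "row_of l T a = row_of l T' a"
proof -
  interpret T': tableau n l T' by fact
  have i: "row_of l T a < length l" using cell_of[OF assms(3)] by (simp add: cells_def)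
  have "tabloid l T ! row_of l T a = tabloid l T' ! row_of l T a" using assms(2) by simp
  then have "{b \<in> {1..n}. row_of l T b = row_of l T a} = {b \<in> {1..n}. row_of l T' b = row_of l T a}"
    using i unfolding tabloid_eq T'.tabloid_eq by simp
  then have "a \<in> {b \<in> {1..n}. row_of l T' b = row_of l T a}" using assms(3) by blast
  then show ?thesis by simp
qed

lemma tabloid_transpose_rows:
  assumes "a \<in> {1..n}" "b \<in> {1..n}" "row_of l T a = row_of l T b"
  shows "map ((`) (swap a b)) (tabloid l T) = tabloid l T"
proof -
  have "swap a b ` {c \<in> {1..n}. row_of l T c = i} = {c \<in> {1..n}. row_of l T c = i}" for i
    using assms by (cases "row_of l T a = i") (auto simp: transpose_def image_iff)
  then show ?thesis by (simp add: tabloid_eq)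
qed

text \<open>
  Again a transposition: it fixes the tabloid and reverses the sign of the matching polytabloid.
\<close>

lemma tabloid_pairing_vanishes:
  assumes "tableau n l' T'" "\<not> inj_on (row_of l' T') {a \<in> {1..n}. col_of l T a = j}"
  shows "(\<Sum>M\<in>matchings n d. of_bool (compatible (tabloid l' T') M) * matching_polytabloid l T M) = 0"
proof -
  interpret T': tableau n l' T' by fact
  obtain a b where ab: "a \<in> {1..n}" "b \<in> {1..n}" "col_of l T a = col_of l T b" "a \<noteq> b"
    "row_of l' T' a = row_of l' T' b"
    using assms(2) by (auto simp: inj_on_def)
  show ?thesis
    using tabloid_pairing_permuted[OF swap_in_column_stabilizer[OF ab(1-3)], of "tabloid l' T'" d] ab(4)
    by (simp add: T'.tabloid_transpose_rows[OF ab(1,2,5)] sign_swap_id)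
qed

text \<open>
  By antisymmetry each column permutation can be moved from one factor of the pairing to the other,
  where its sign cancels, so all terms of the signed sum contribute equally.
\<close>

lemma norm_matching_polytabloid:
  "(\<Sum>M\<in>matchings n d. matching_polytabloid l T M * matching_polytabloid l T M) =
     int (card (column_stabilizer l T)) *
       (\<Sum>M\<in>matchings n d. of_bool (compatible (tabloid l T) M) * matching_polytabloid l T M)"
proof -
  let ?P = "matching_polytabloid l T"
  have "(\<Sum>M\<in>matchings n d. ?P M * ?P M) =
     (\<Sum>M\<in>matchings n d. \<Sum>s\<in>column_stabilizer l T. sign s * (of_bool (compatible (tabloid l (s \<circ> T)) M) * ?P M))"
    by (subst (2) matching_polytabloid_def) (simp add: sum_distrib_left sum_distrib_right mult_ac)
  also have "\<dots> = (\<Sum>s\<in>column_stabilizer l T. sign s *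
       (\<Sum>M\<in>matchings n d. of_bool (compatible (map ((`) s) (tabloid l T)) M) * ?P M))"
    by (subst sum.swap) (simp add: sum_distrib_left tabloid_permuted)
  also have "\<dots> = (\<Sum>s\<in>column_stabilizer l T.
       (\<Sum>M\<in>matchings n d. of_bool (compatible (tabloid l T) M) * ?P M))"
    by (intro sum.cong refl) (simp add: tabloid_pairing_permuted)
  finally show ?thesis by simp
qed

lemma polytabloid_coefficient:
  "lookup (polytabloid l T) t =
     of_int (\<Sum>s\<in>column_stabilizer l T. of_bool (tabloid l (s \<circ> T) = t) * sign s)"
  by (simp add: polytabloid_def lookup_sum lookup_single when_def of_bool_def)
     (intro sum.cong refl; simp)

lemma row_stable_column_stable:
  assumes s: "s \<in> column_stabilizer l T" and eq: "tabloid l (s \<circ> T) = tabloid l T"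
  shows "s = id"
proof
  fix a
  have p: "s permutes {1..n}" using s by (simp add: column_stabilizer_iff)
  show "s a = id a"
  proof (cases "a \<in> {1..n}")
    case True
    then have sa: "s a \<in> {1..n}" using permutes_in_image[OF p] by simp
    have "row_of l T (s a) = row_of l (s \<circ> T) (s a)"
      by (rule row_of_tabloid_eq[OF permuted_tableau[OF p] eq[symmetric] sa])
    also have "\<dots> = row_of l T a" by (rule row_of_permuted[OF p True])
    finally have "row_of l T (s a) = row_of l T a" .
    moreover have "col_of l T (s a) = col_of l T a" using s True column_stabilizer_iff by blast
    ultimately show ?thesis using cell_eqI[OF sa True] by simp
  next
    case False then show ?thesis using permutes_not_in[OF p] by simp
  qed
qed

text \<open>
  As functions of the tabloid of \<open>T'\<close>, both sides are antisymmetric under the column stabilizer of \<open>T\<close>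
  and vanish unless the tabloid arises from \<open>T\<close> by a column permutation. Hence they are proportional, and
  the factor is found at the tabloid of \<open>T\<close>, whose coefficient in the polytabloid is 1.
\<close>

lemma tabloid_pairing:
  assumes T': "tableau n l T'"
  shows "of_int (\<Sum>M\<in>matchings n d. of_bool (compatible (tabloid l T') M) * matching_polytabloid l T M) =
    of_int (\<Sum>M\<in>matchings n d. of_bool (compatible (tabloid l T) M) * matching_polytabloid l T M) *
      lookup (polytabloid l T) (tabloid l T')" (is "of_int (?B T') = of_int ?c * _")
proof (cases "\<forall>j. inj_on (row_of l T') {a \<in> {1..n}. col_of l T a = j}")
  case False
  then obtain j where j: "\<not> inj_on (row_of l T') {a \<in> {1..n}. col_of l T a = j}" by blast
  have "tabloid l (s \<circ> T) \<noteq> tabloid l T'" if s: "s \<in> column_stabilizer l T" for s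
  proof
    assume eq: "tabloid l (s \<circ> T) = tabloid l T'"
    have p: "s permutes {1..n}" using s by (simp add: column_stabilizer_iff)
    interpret sT: tableau n l "s \<circ> T" by (rule permuted_tableau[OF p])
    have "inj_on (row_of l T') {a \<in> {1..n}. col_of l T a = j}"
    proof (rule inj_onI)
      fix a b assume ab: "a \<in> {a \<in> {1..n}. col_of l T a = j}" "b \<in> {a \<in> {1..n}. col_of l T a = j}"
        "row_of l T' a = row_of l T' b"
      have mem: "a \<in> s ` {1..n}" "b \<in> s ` {1..n}" using ab permutes_image[OF p] by auto
      then obtain a' b' where a': "a = s a'" "a' \<in> {1..n}" and b': "b = s b'" "b' \<in> {1..n}" by blast
      have "row_of l T a' = row_of l T b'"
        using ab sT.row_of_tabloid_eq[OF T' eq, of a] sT.row_of_tabloid_eq[OF T' eq, of b]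
          row_of_permuted[OF p a'(2)] row_of_permuted[OF p b'(2)] a'(1) b'(1) by simp
      moreover have "col_of l T a' = col_of l T b'"
        using s ab a' b' by (auto simp: column_stabilizer_iff)
      ultimately show "a = b" using cell_eqI[OF a'(2) b'(2)] a'(1) b'(1) by simp
    qed
    then show False using j by simp
  qed
  then have "lookup (polytabloid l T) (tabloid l T') = 0"
    by (simp add: polytabloid_coefficient)
  then show ?thesis using tabloid_pairing_vanishes[OF T' j, of d] by (simp only: of_int_0 mult_zero_right)
next
  case True
  obtain s where s: "s \<in> column_stabilizer l T" and eq: "tabloid l (s \<circ> T) = tabloid l T'"
    by (rule column_rearrangement[OF T']) (use True in auto)
  have p: "s permutes {1..n}" using s by (simp add: column_stabilizer_iff)
  have "?B T' = sign s * ?c"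
    using tabloid_pairing_permuted[OF s, of "tabloid l T" d] by (simp only: eq[symmetric] tabloid_permuted)
  moreover have "(\<Sum>t\<in>column_stabilizer l T. of_bool (tabloid l (t \<circ> T) = tabloid l T') * sign t) = sign s"
  proof -
    have "(\<Sum>t\<in>column_stabilizer l T. of_bool (tabloid l (t \<circ> T) = tabloid l T') * sign t) =
       (\<Sum>t\<in>column_stabilizer l T. of_bool (tabloid l (s \<circ> t \<circ> T) = tabloid l T') * sign (s \<circ> t))"
      by (rule sum_column_stabilizer_left[OF s, symmetric])
    also have "\<dots> = (\<Sum>t\<in>column_stabilizer l T. if t = id then sign s else 0)"
    proof (intro sum.cong refl)
      fix t assume t: "t \<in> column_stabilizer l T"
      have "tabloid l (s \<circ> t \<circ> T) = tabloid l T' \<longleftrightarrow> map ((`) s) (tabloid l (t \<circ> T)) = map ((`) s) (tabloid l T)"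
        by (simp add: eq[symmetric] comp_assoc tabloid_permuted[of l s])
      also have "\<dots> \<longleftrightarrow> tabloid l (t \<circ> T) = tabloid l T"
        using permutes_inj[OF p] by (intro inj_eq inj_mapI) (simp add: inj_def inj_image_eq_iff)
      also have "\<dots> \<longleftrightarrow> t = id" using row_stable_column_stable[OF t] by auto
      finally show "of_bool (tabloid l (s \<circ> t \<circ> T) = tabloid l T') * sign (s \<circ> t) = (if t = id then sign s else 0)"
        by simp
    qed
    also have "\<dots> = sign s" by (simp add: sum.delta)
    finally show ?thesis .
  qed
  ultimately show ?thesis by (simp only: polytabloid_coefficient of_int_mult mult.commute)
qed

lemma card_row: "card {a \<in> {1..n}. row_of l T a = i} = (if i < length l then l ! i else 0)"
proof -
  have "card {a \<in> {1..n}. row_of l T a = i} = card {c \<in> cells l. fst c = i}"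
    unfolding row_eq[symmetric]
    by (rule card_image) (rule inj_on_subset[OF bij_betw_imp_inj_on[OF bij]], auto)
  also have "{c \<in> cells l. fst c = i} = (if i < length l then {i} \<times> {..<l ! i} else {})"
    by (auto simp: cells_def)
  finally show ?thesis by (auto simp: card_cartesian_product)
qed

lemma card_upper_rows_Suc:
  "card {a \<in> {1..n}. row_of l T a \<le> Suc k} = card {a \<in> {1..n}. row_of l T a \<le> k} +
     card {a \<in> {1..n}. row_of l T a = Suc k}"
  by (subst card_Un_disjoint[symmetric]) (auto intro!: arg_cong[where f = card])

lemma shape_determined:
  assumes T': "tableau n l' T'"
    and eq: "\<And>k. card {a \<in> {1..n}. row_of l T a \<le> k} = card {a \<in> {1..n}. row_of l' T' a \<le> k}"
  shows "l = l'"
proof -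
  interpret T': tableau n l' T' by fact
  have rows: "(if i < length l then l ! i else 0) = (if i < length l' then l' ! i else 0)" for i
  proof (cases i)
    case 0 then show ?thesis using eq[of 0] card_row[of 0] T'.card_row[of 0]
      by (simp split: if_splits)
  next
    case (Suc k)
    then show ?thesis
      using eq[of k] eq[of "Suc k"] card_upper_rows_Suc[of k] T'.card_upper_rows_Suc[of k]
        card_row[of i] T'.card_row[of i] by simp
  qed
  have pos: "i < length l \<Longrightarrow> l ! i > 0" "i < length l' \<Longrightarrow> l' ! i > 0" for i
    using partitions_pos[OF shape] partitions_pos[OF T'.shape] by auto
  have "i < length l \<longleftrightarrow> i < length l'" for i using rows[of i] pos[of i] by (auto split: if_splits)
  then have len: "length l = length l'" by (metis linorder_neqE_nat less_irrefl)
  show ?thesis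
  proof (rule nth_equalityI[OF len])
    show "l ! i = l' ! i" if "i < length l" for i using rows[of i] len that by simp
  qed
qed

lemma pairing_nonzero_dominance:
  assumes T': "tableau n l' T'"
    and nz: "(\<Sum>M\<in>matchings n d. matching_polytabloid l' T' M * matching_polytabloid l T M) \<noteq> 0"
  shows "card {a \<in> {1..n}. row_of l' T' a \<le> k} \<le> card {a \<in> {1..n}. row_of l T a \<le> k}"
proof -
  interpret T': tableau n l' T' by fact
  have "(\<Sum>M\<in>matchings n d. matching_polytabloid l' T' M * matching_polytabloid l T M) =
     (\<Sum>s\<in>column_stabilizer l' T'. sign s *
        (\<Sum>M\<in>matchings n d. of_bool (compatible (tabloid l' (s \<circ> T')) M) * matching_polytabloid l T M))"
    unfolding matching_polytabloid_def[of l' T'] sum_distrib_left sum_distrib_right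
    by (subst sum.swap) (simp add: mult_ac)
  then obtain s where s: "s \<in> column_stabilizer l' T'" and nz':
    "(\<Sum>M\<in>matchings n d. of_bool (compatible (tabloid l' (s \<circ> T')) M) * matching_polytabloid l T M) \<noteq> 0"
    using nz by (metis (no_types, lifting) sum.neutral mult_zero_right)
  have p: "s permutes {1..n}" using s by (simp add: T'.column_stabilizer_iff)
  have sT': "tableau n l' (s \<circ> T')" by (rule T'.permuted_tableau[OF p])
  interpret sT': tableau n l' "s \<circ> T'" by fact
  have "card {a \<in> {1..n}. row_of l' (s \<circ> T') a \<le> k} \<le> card {a \<in> {1..n}. row_of l T a \<le> k}"
    by (rule dominance) (use tabloid_pairing_vanishes[OF sT'] nz' in blast)
  moreover have "card {a \<in> {1..n}. row_of l' (s \<circ> T') a \<le> k} = card {a \<in> {1..n}. row_of l' T' a \<le> k}"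
    by (simp only: sT'.split_by_column[of "\<lambda>a. row_of l' (s \<circ> T') a \<le> k"] sT'.card_column_upper_own
       T'.split_by_column[of "\<lambda>a. row_of l' T' a \<le> k"] T'.card_column_upper_own)
  ultimately show ?thesis by simp
qed

text \<open>
  A nonzero pairing would make each of the two shapes dominate the other.
\<close>

lemma orthogonal_shapes:
  assumes T': "tableau n l' T'" and "l \<noteq> l'"
  shows "(\<Sum>M\<in>matchings n d. matching_polytabloid l' T' M * matching_polytabloid l T M) = 0"
proof (rule ccontr)
  interpret T': tableau n l' T' by fact
  assume nz: "(\<Sum>M\<in>matchings n d. matching_polytabloid l' T' M * matching_polytabloid l T M) \<noteq> 0"
  then have nz': "(\<Sum>M\<in>matchings n d. matching_polytabloid l T M * matching_polytabloid l' T' M) \<noteq> 0"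
    by (simp add: mult.commute)
  have "l = l'"
    by (rule shape_determined[OF T'])
       (intro order_antisym pairing_nonzero_dominance[OF T' nz]
         T'.pairing_nonzero_dominance[OF tableau_axioms nz'])
  then show False using \<open>l \<noteq> l'\<close> by simp
qed

text \<open>
  The vertices \<open>k\<close> that can be joined to \<open>i\<close> number \<open>n - 2 e - 1 = l ! 0 + 1\<close>, one more than there are
  columns. Two of them share a column, and swapping these two permutes the terms of the sum and reverses
  their sign.
\<close>

lemma exchange:
  assumes "l \<in> even_tail_shapes n d"
  shows "exchange_relation n d (matching_polytabloid l T)"
  unfolding exchange_relation_def
proof (intro allI impI)
  fix e M i assume d: "d = Suc e" and M: "M \<in> matchings n e" and i: "i \<in> {1..n} - \<Union>M"
  let ?A = "{1..n} - \<Union>M - {i}"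
  have sub: "\<Union>M \<subseteq> {1..n}" by (rule matching_vertices[OF M])
  have "card (\<Union>M) = 2 * e" using M card_matching_vertices[of M n] by (simp add: matchings_def)
  then have "card ?A = n - 2 * e - 1"
    using i sub by (simp add: card_Diff_subset finite_subset[OF sub])
  moreover have "l ! 0 + 2 * d = n" using assms by (simp add: even_tail_shapes_def)
  ultimately have "card ?A > card {..<l ! 0}" using d by simp
  moreover have "col_of l T ` ?A \<subseteq> {..<l ! 0}" using col_of_less by auto
  ultimately have "\<not> inj_on (col_of l T) ?A"
    by (metis card_inj_on_le finite_lessThan not_le)
  then obtain a b where ab: "a \<in> ?A" "b \<in> ?A" "col_of l T a = col_of l T b" "a \<noteq> b"
    by (auto simp: inj_on_def)
  let ?t = "swap a b"
  have fixed: "?t x = x" if "x \<in> insert i (\<Union>M)" for x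
    using that ab by (auto simp: transpose_def)
  have "(\<Sum>k\<in>?A. matching_polytabloid l T (insert {i, k} M)) =
      (\<Sum>k\<in>?A. matching_polytabloid l T (insert {i, ?t k} M))"
    by (rule sum.reindex_bij_witness[where i = "?t" and j = "?t"])
       (use ab in \<open>auto simp: transpose_def split: if_splits\<close>)
  also have "\<dots> = (\<Sum>k\<in>?A. matching_polytabloid l T (matching_act ?t (insert {i, k} M)))"
    using fixed matching_act_fixed[of M ?t] by simp
  also have "\<dots> = - (\<Sum>k\<in>?A. matching_polytabloid l T (insert {i, k} M))"
    using ab antisymmetric_transpose[of a b] by (simp add: sum_negf del: matching_act_insert)
  finally show "(\<Sum>k\<in>?A. matching_polytabloid l T (insert {i, k} M)) = 0" by simp
qed

section \<open>Nonvanishing\<close>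

text \<open>
  Columns are paired as 0-1, 2-3, and so on; a row of even length is a union of such pairs.
\<close>

definition partner :: "nat \<Rightarrow> nat" where
  "partner j = (if even j then Suc j else j - 1)"

lemma partner_partner [simp]: "partner (partner j) = j"
  by (cases "even j") (auto simp: partner_def elim!: oddE)

lemma even_partner [simp]: "even (partner j) \<longleftrightarrow> odd j"
  by (cases "even j") (auto simp: partner_def elim!: oddE)

lemma partner_cell:
  assumes "l \<in> even_tail_shapes n d" "(i, j) \<in> cells l" "0 < i"
  shows "(i, partner j) \<in> cells l"
proof -
  have i: "i < length l" "j < l ! i" and ev: "even (l ! i)"
    using assms by (auto simp: cells_def even_tail_shapes_def)
  have "Suc j < l ! i" if "even j" using i ev that by (metis Suc_lessI even_Suc)
  then show ?thesis using i by (auto simp: cells_def partner_def)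
qed

text \<open>
  The involution that exchanges neighbours outside row 0; it is extended by the identity so that it
  becomes a permutation.
\<close>

definition mate :: "nat \<Rightarrow> nat" where
  "mate a = (if a \<in> {1..n} \<and> 0 < row_of l T a then T (row_of l T a, partner (col_of l T a)) else a)"

lemma mate:
  assumes "l \<in> even_tail_shapes n d" "a \<in> {1..n}" "0 < row_of l T a"
  shows "mate a \<in> {1..n}" "row_of l T (mate a) = row_of l T a" "col_of l T (mate a) = partner (col_of l T a)"
proof -
  have c: "(row_of l T a, partner (col_of l T a)) \<in> cells l"
    by (rule partner_cell[OF assms(1) cell_of[OF assms(2)] assms(3)])
  show "mate a \<in> {1..n}" "row_of l T (mate a) = row_of l T a" "col_of l T (mate a) = partner (col_of l T a)"
    using c assms entry_mem[OF c] by (simp_all add: mate_def)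
qed

lemma mate_row_0: "a \<in> {1..n} \<Longrightarrow> row_of l T a = 0 \<Longrightarrow> mate a = a"
  by (simp add: mate_def)

lemma mate_mate:
  assumes "l \<in> even_tail_shapes n d"
  shows "mate (mate a) = a"
proof (cases "a \<in> {1..n} \<and> 0 < row_of l T a")
  case True
  then have a: "a \<in> {1..n}" "0 < row_of l T a" by auto
  note m = mate[OF assms a]
  have m2: "0 < row_of l T (mate a)" using m(2) a(2) by argo
  note m' = mate[OF assms m(1) m2]
  show ?thesis
  proof (rule cell_eqI[OF m'(1) a(1)])
    show "row_of l T (mate (mate a)) = row_of l T a" using m'(2) m(2) by argo
    show "col_of l T (mate (mate a)) = col_of l T a" unfolding m'(3) m(3) by simp
  qed
next
  case False
  then have "mate a = a" by (auto simp: mate_def)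
  then show ?thesis by simp
qed

lemma mate_permutes:
  assumes "l \<in> even_tail_shapes n d"
  shows "mate permutes {1..n}"
proof (rule inj_imp_permutes)
  show "inj_on mate {1..n}" by (rule inj_onI) (metis mate_mate[OF assms])
  show "mate a \<in> {1..n}" if "a \<in> {1..n}" for a
    using mate(1)[OF assms that] mate_row_0[OF that] that by (cases "row_of l T a = 0") auto
  show "mate a = a" if "a \<notin> {1..n}" for a using that by (simp add: mate_def)
qed simp

definition aligned_matching :: "nat set set" where
  "aligned_matching = (\<lambda>a. {a, mate a}) ` {a \<in> {1..n}. 0 < row_of l T a}"

lemma aligned_matching:
  assumes shp: "l \<in> even_tail_shapes n d"
  shows "aligned_matching \<in> matchings n d"
proof -
  let ?A = "{a \<in> {1..n}. 0 < row_of l T a}"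
  note mm = mate_mate[OF shp] and m = mate[OF shp]
  have ne: "mate a \<noteq> a" if "a \<in> ?A" for a
  proof
    assume "mate a = a"
    then have "col_of l T a = partner (col_of l T a)" using m(3)[of a] that by simp
    then show False using even_partner[of "col_of l T a"] by simp
  qed
  have sub: "aligned_matching \<subseteq> pairs n"
    using ne m(1) by (auto simp: aligned_matching_def intro!: pair_mem) (metis ne)
  have disj: "pairwise disjnt aligned_matching"
    unfolding pairwise_def
  proof (intro ballI impI)
    fix S S' assume "S \<in> aligned_matching" "S' \<in> aligned_matching" "S \<noteq> S'"
    then obtain a b where ab: "S = {a, mate a}" "S' = {b, mate b}" unfolding aligned_matching_def by blast
    have "a \<noteq> b" using \<open>S \<noteq> S'\<close> ab by blast
    moreover have "a \<noteq> mate b"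
    proof
      assume "a = mate b"
      then have "S = S'" using ab mm[of b] by (simp add: insert_commute)
      then show False using \<open>S \<noteq> S'\<close> by contradiction
    qed
    moreover have "mate a \<noteq> b" "mate a \<noteq> mate b" using calculation mm[of a] mm[of b] by metis+
    ultimately show "disjnt S S'" using ab by (auto simp: disjnt_def)
  qed
  have "\<Union>aligned_matching = ?A"
    using m by (auto simp: aligned_matching_def)
  moreover have "card ?A = n - l ! 0"
  proof -
    have "?A = {1..n} - {a \<in> {1..n}. row_of l T a = 0}" by auto
    moreover have "card {a \<in> {1..n}. row_of l T a = 0} = l ! 0"
      using card_row[of 0] shp by (simp add: even_tail_shapes_def)
    ultimately show ?thesis by (simp add: card_Diff_subset)
  qed
  ultimately have "2 * card aligned_matching = n - l ! 0" using card_matching_vertices[OF sub disj] by simp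
  then show ?thesis using sub disj shp by (auto simp: matchings_def even_tail_shapes_def)
qed

text \<open>
  A column permutation \<open>s\<close> for which the aligned matching is still compatible fixes row 0 and permutes
  partner columns in parallel, and so does its inverse \<open>v\<close>. The part of \<open>v\<close> on the odd columns is therefore the
  conjugate by \<open>mate\<close> of its part \<open>u\<close> on the even columns, and \<open>v\<close> has the sign of \<open>u\<close> squared.
\<close>

lemma sign_aligned:
  assumes shp: "l \<in> even_tail_shapes n d" and s: "s \<in> column_stabilizer l T"
    and comp: "compatible (tabloid l (s \<circ> T)) aligned_matching"
  shows "sign s = 1"
proof -
  have p: "s permutes {1..n}" using s by (simp add: column_stabilizer_iff)
  interpret sT: tableau n l "s \<circ> T" by (rule permuted_tableau[OF p])
  define v where "v = inv' s"
  have vp: "v permutes {1..n}" unfolding v_def by (rule permutes_inv[OF p])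
  have vmem: "v a \<in> {1..n}" if "a \<in> {1..n}" for a using that permutes_in_image[OF vp] by simp
  have vcol: "col_of l T (v a) = col_of l T a" if "a \<in> {1..n}" for a
    using column_stabilizer_inv[OF s] that by (simp add: v_def column_stabilizer_iff)
  have vrow: "row_of l (s \<circ> T) a = row_of l T (v a)" if "a \<in> {1..n}" for a
    using row_of_permuted[OF p vmem[OF that]] by (simp add: v_def permutes_inverses[OF p])
  note mm = mate_mate[OF shp] and m = mate[OF shp]
  have "aligned_matching \<subseteq> pairs n" using aligned_matching[OF shp] by (simp add: matchings_def)
  note comp' = comp[unfolded sT.compatible_tabloid_iff[OF this]]
  have edge: "0 < row_of l T (v a) \<and> row_of l T (v (mate a)) = row_of l T (v a)"
    if a: "a \<in> {1..n}" "0 < row_of l T a" for a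
  proof -
    have "{a, mate a} \<in> aligned_matching" using a by (auto simp: aligned_matching_def)
    from comp'[rule_format, OF this]
    obtain i where "0 < i" "row_of l (s \<circ> T) a = i" "row_of l (s \<circ> T) (mate a) = i" by auto
    then show ?thesis using vrow[OF a(1)] vrow[OF m(1)[OF a]] by simp
  qed
  let ?A = "{a \<in> {1..n}. 0 < row_of l T a}"
  have "v ` ?A = ?A"
    using edge vmem by (intro endo_inj_surj) (auto intro: permutes_inj_on[OF vp])
  then have row0: "row_of l T (v a) = 0" if "a \<in> {1..n}" "row_of l T a = 0" for a
  proof -
    have "v a \<notin> v ` ?A" using that permutes_inj[OF vp] by (auto simp: inj_image_mem_iff)
    then show ?thesis using vmem[OF that(1)] \<open>v ` ?A = ?A\<close> by auto
  qed
  have fix0: "v a = a" if "a \<in> {1..n}" "row_of l T a = 0" for a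
    by (rule cell_eqI[OF vmem[OF that(1)] that(1)]) (simp_all only: row0[OF that] that(2) vcol[OF that(1)])
  have comm: "v (mate a) = mate (v a)" if a: "a \<in> {1..n}" "0 < row_of l T a" for a
  proof -
    have va: "v a \<in> {1..n}" "0 < row_of l T (v a)" using a edge vmem by auto
    show ?thesis
    proof (rule cell_eqI)
      show "v (mate a) \<in> {1..n}" "mate (v a) \<in> {1..n}" by (rule vmem m(1) a va)+
      show "row_of l T (v (mate a)) = row_of l T (mate (v a))" using edge[OF a] m(2)[OF va] by argo
      show "col_of l T (v (mate a)) = col_of l T (mate (v a))"
        using vcol[OF m(1)[OF a]] vcol[OF a(1)] m(3)[OF va] m(3)[OF a] by argo
    qed
  qed
  define u where "u a = (if a \<in> {1..n} \<and> even (col_of l T a) then v a else a)" for a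
  have up: "u permutes {1..n}"
  proof (rule inj_imp_permutes)
    show "inj_on u {1..n}"
    proof (rule inj_onI)
      fix a b assume ab: "a \<in> {1..n}" "b \<in> {1..n}" "u a = u b"
      have ucol: "col_of l T (u c) = col_of l T c" if "c \<in> {1..n}" for c
        using vcol[OF that] by (simp add: u_def)
      have "col_of l T a = col_of l T b" using ucol[OF ab(1)] ucol[OF ab(2)] unfolding ab(3) by argo
      then have "a = b \<or> v a = v b" using ab by (simp add: u_def split: if_splits)
      then show "a = b" using injD[OF permutes_inj[OF vp]] by blast
    qed
    show "u a \<in> {1..n}" if "a \<in> {1..n}" for a using that vmem by (simp add: u_def)
    show "u a = a" if "a \<notin> {1..n}" for a using that by (auto simp: u_def)
  qed simp
  have mp: "mate permutes {1..n}" by (rule mate_permutes[OF shp])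
  have minv: "inv' mate = mate"
    by (rule inv_unique_comp) (simp_all add: fun_eq_iff mm)
  have "v a = u (mate (u (mate a)))" for a
  proof (cases "a \<in> {1..n}")
    case False
    then have "mate a = a" "u a = a" "v a = a"
      using permutes_not_in[OF vp] permutes_not_in[OF up] permutes_not_in[OF mp] by auto
    then show ?thesis by simp
  next
    case a: True
    show ?thesis
    proof (cases "row_of l T a = 0")
      case True
      then have "mate a = a" "u a = a" "v a = a" using a fix0 mate_row_0 by (auto simp: u_def)
      then show ?thesis by simp
    next
      case False
      then have r: "0 < row_of l T a" by simp
      show ?thesis
      proof (cases "even (col_of l T a)")
        case True
        then have "u (mate a) = mate a" using m(3)[OF a r] by (simp add: u_def)
        then show ?thesis using mm a True by (simp add: u_def)
      next
        case False
        then have "u (mate a) = v (mate a)" using m[OF a r] by (simp add: u_def)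
        also have "\<dots> = mate (v a)" by (rule comm[OF a r])
        finally show ?thesis using mm a vcol[OF a] False by (simp add: u_def)
      qed
    qed
  qed
  then have "v = u \<circ> (mate \<circ> u \<circ> inv' mate)" by (simp add: fun_eq_iff minv)
  moreover have "sign (mate \<circ> u \<circ> inv' mate) = sign u" by (rule sign_conj[OF mp up])
  moreover have "permutation u" "permutation (mate \<circ> u \<circ> inv' mate)"
    using up mp permutes_inv[OF mp] by (auto intro!: permutes_imp_permutation[of "{1..n}"] permutes_compose)
  ultimately have "sign v = 1" by (simp add: sign_compose)
  then show ?thesis using permutes_imp_permutation[OF _ p] by (simp add: v_def sign_inverse)
qed

text \<open>
  All terms are nonnegative, and the identity contributes 1.
\<close>

lemma aligned_coefficient_pos:
  assumes shp: "l \<in> even_tail_shapes n d"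
  shows "matching_polytabloid l T aligned_matching > 0"
  unfolding matching_polytabloid_def
proof (rule sum_pos2[of _ id])
  have "aligned_matching \<subseteq> pairs n" using aligned_matching[OF shp] by (simp add: matchings_def)
  then have "compatible (tabloid l T) aligned_matching"
    using mate[OF shp] by (auto simp: compatible_tabloid_iff aligned_matching_def)
  then show "0 < sign id * of_bool (compatible (tabloid l (id \<circ> T)) aligned_matching)" by simp
  show "0 \<le> sign s * of_bool (compatible (tabloid l (s \<circ> T)) aligned_matching)"
    if "s \<in> column_stabilizer l T" for s
    using sign_aligned[OF shp that] by (cases "compatible (tabloid l (s \<circ> T)) aligned_matching") auto
qed simp_all

lemma norm_pos:
  assumes shp: "l \<in> even_tail_shapes n d"
  shows "(\<Sum>M\<in>matchings n d. matching_polytabloid l T M * matching_polytabloid l T M) > 0"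
  by (rule sum_pos2[OF _ aligned_matching[OF shp]]) (use aligned_coefficient_pos[OF shp] in auto)

lemma pairing_with_tabloid_pos:
  assumes shp: "l \<in> even_tail_shapes n d"
  shows "(\<Sum>M\<in>matchings n d. of_bool (compatible (tabloid l T) M) * matching_polytabloid l T M) > 0"
  using norm_pos[OF shp] unfolding norm_matching_polytabloid by (auto simp: zero_less_mult_iff)

end

section \<open>Functions orthogonal to the polytabloids\<close>

lemma exchange_relationD:
  assumes "exchange_relation n d g" "d = Suc e" "M \<in> matchings n e" "i \<in> {1..n}" "i \<notin> \<Union>M"
  shows "(\<Sum>k\<in>{1..n} - \<Union>M - {i}. g (insert {i, k} M)) = 0"
  using assms unfolding exchange_relation_def by blast

lemma sum_zero_or_value:
  fixes x :: "'a::semiring_1"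
  assumes "finite A" "\<And>a. a \<in> A \<Longrightarrow> f a = 0 \<or> f a = x"
  shows "\<exists>k. sum f A = of_nat k * x"
proof -
  have "sum f A = (\<Sum>a\<in>A. if f a = 0 then 0 else x)"
    using assms(2) by (intro sum.cong) auto
  also have "\<dots> = of_nat (card {a \<in> A. f a \<noteq> 0}) * x"
    using assms(1) by (subst sum.mono_neutral_right[of A "{a \<in> A. f a \<noteq> 0}"]) auto
  finally show ?thesis by blast
qed

lemma matching_two_edges:
  assumes "M \<in> matchings n d" "{a, a'} \<in> M" "{b, b'} \<in> M" "{a, a'} \<noteq> {b, b'}"
  obtains R where "M = insert {a, a'} (insert {b, b'} R)" "a \<notin> \<Union>R" "a' \<notin> \<Union>R" "b \<notin> \<Union>R" "b' \<notin> \<Union>R"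
    "{a, a'} \<inter> {b, b'} = {}" "R \<subseteq> M" "{a, a'} \<notin> R" "{b, b'} \<notin> R"
proof -
  define R where "R = M - {{a, a'}, {b, b'}}"
  have disj: "S \<inter> S' = {}" if "S \<in> M" "S' \<in> M" "S \<noteq> S'" for S S'
    using assms(1) that by (auto simp: matchings_def pairwise_def disjnt_def)
  have *: "x \<notin> \<Union>R" if "x \<in> {a, a'} \<union> {b, b'}" for x
  proof
    assume "x \<in> \<Union>R"
    then obtain S where S: "S \<in> M" "S \<noteq> {a, a'}" "S \<noteq> {b, b'}" "x \<in> S" by (auto simp: R_def)
    then show False using disj[OF S(1) assms(2) S(2)] disj[OF S(1) assms(3) S(3)] that by blast
  qed
  show ?thesis
  proof (rule that)
    show "M = insert {a, a'} (insert {b, b'} R)" using assms by (auto simp: R_def)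
    show "{a, a'} \<inter> {b, b'} = {}" using disj assms by blast
    show "a \<notin> \<Union>R" "a' \<notin> \<Union>R" "b \<notin> \<Union>R" "b' \<notin> \<Union>R" using * by simp_all
  qed (auto simp: R_def)
qed

definition row_matched :: "(nat \<Rightarrow> nat) \<Rightarrow> nat set set \<Rightarrow> bool" where
  "row_matched r M \<longleftrightarrow> (\<forall>S\<in>M. \<exists>i>0. \<forall>a\<in>S. r a = i)"

text \<open>
  The analogue of a highest weight vector: \<open>g\<close> is invariant under the Young subgroup of \<open>r\<close> and is
  killed when a vertex \<open>b\<close> is moved to an earlier row \<open>i\<close>. The identity together with the transpositions
  \<open>(b c)\<close>, for \<open>c\<close> in row \<open>i\<close>, represents the cosets that have to be added when row \<open>i\<close> is enlarged by \<open>b\<close>.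
  The lemmas below show that such a function is determined by its common value on the matchings all of
  whose edges lie inside rows other than row 0.
\<close>

locale highest_weight =
  fixes n d :: nat and r :: "nat \<Rightarrow> nat" and g :: "nat set set \<Rightarrow> complex"
  assumes exchange: "exchange_relation n d g"
    and invariant: "u \<in> young_group n r \<Longrightarrow> g (matching_act u M) = g M"
    and raising: "b \<in> {1..n} \<Longrightarrow> i < r b \<Longrightarrow> M \<in> matchings n d \<Longrightarrow>
      g M + (\<Sum>c\<in>{c \<in> {1..n}. r c = i}. g (matching_act (swap b c) M)) = 0"
begin

text \<open>
  Induction on the number of matched vertices in row 0. For an edge \<open>{a, q}\<close> with \<open>a\<close> in row 0, the
  exchange relation at \<open>q\<close> lets \<open>a\<close> be replaced by any free vertex \<open>k\<close>. For \<open>k\<close> in row 0 this gives \<open>g M\<close>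
  again by invariance, and otherwise a matching with fewer matched vertices in row 0. So a positive multiple
  of \<open>g M\<close> is zero.
\<close>

lemma vanishes_if_vanishes_off_row_0:
  assumes base: "\<And>M. M \<in> matchings n d \<Longrightarrow> \<forall>a\<in>\<Union>M. r a \<noteq> 0 \<Longrightarrow> g M = 0"
    and "M \<in> matchings n d"
  shows "g M = 0"
  using assms(2)
proof (induction "card {a \<in> \<Union>M. r a = 0}" arbitrary: M rule: less_induct)
  case less
  show ?case
  proof (cases "\<forall>a\<in>\<Union>M. r a \<noteq> 0")
    case True then show ?thesis using base less.prems by blast
  next
    case False
    then obtain a where a: "a \<in> \<Union>M" "r a = 0" by blast
    obtain q where q: "{a, q} \<in> M" "a \<noteq> q" "a \<in> {1..n}" "q \<in> {1..n}"
      by (rule matching_edge[OF less.prems a(1)])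
    obtain e where e: "d = Suc e" "M - {{a, q}} \<in> matchings n e" "\<Union>(M - {{a, q}}) = \<Union>M - {a, q}"
      by (rule matching_remove_edge[OF less.prems q(1)])
    define R where "R = M - {{a, q}}"
    have R: "R \<in> matchings n e" "\<Union>R = \<Union>M - {a, q}" using e by (simp_all add: R_def)
    have M: "M = insert {q, a} R" using q(1) by (auto simp: R_def insert_commute)
    have fin: "finite (\<Union>M)" by (rule finite_subset[OF matching_vertices[OF less.prems]]) simp
    let ?A = "{1..n} - \<Union>R - {q}"
    have sum0: "(\<Sum>k\<in>?A. g (insert {q, k} R)) = 0"
      by (rule exchange_relationD[OF exchange e(1) R(1) q(4)]) (use R in auto)
    have val: "g (insert {q, k} R) = (if r k = 0 then g M else 0)" if k: "k \<in> ?A" for k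
    proof (cases "r k = 0")
      case True
      let ?t = "swap a k"
      have "matching_act ?t R = R"
        by (rule matching_act_fixed) (use R k in \<open>auto simp: transpose_def\<close>)
      moreover have "?t q = q" using q k by (auto simp: transpose_def)
      ultimately have "insert {q, k} R = matching_act ?t M" by (simp add: M)
      moreover have "?t \<in> young_group n r" using q k a True by (intro swap_in_young_group) auto
      ultimately show ?thesis using invariant True by simp
    next
      case False
      have N: "insert {q, k} R \<in> matchings n d"
        unfolding e(1) by (rule matching_insert_edge[OF R(1) q(4)]) (use k R in auto)
      have sub: "{x \<in> \<Union>(insert {q, k} R). r x = 0} \<subset> {x \<in> \<Union>M. r x = 0}"
      proof (rule psubsetI)
        show "{x \<in> \<Union>(insert {q, k} R). r x = 0} \<subseteq> {x \<in> \<Union>M. r x = 0}"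
        proof
          fix x assume x: "x \<in> {x \<in> \<Union>(insert {q, k} R). r x = 0}"
          then have "x = q \<or> x \<in> \<Union>R" using False by auto
          moreover have "q \<in> \<Union>M" using q(1) by blast
          moreover have "\<Union>R \<subseteq> \<Union>M" unfolding R(2) by (rule Diff_subset)
          ultimately have "x \<in> \<Union>M" by (metis subsetD)
          then show "x \<in> {x \<in> \<Union>M. r x = 0}" using x by simp
        qed
        have "a \<notin> \<Union>(insert {q, k} R)" using q(2) R(2) False a(2) by auto
        then show "{x \<in> \<Union>(insert {q, k} R). r x = 0} \<noteq> {x \<in> \<Union>M. r x = 0}" using a by blast
      qed
      have "card {x \<in> \<Union>(insert {q, k} R). r x = 0} < card {x \<in> \<Union>M. r x = 0}"
        by (rule psubset_card_mono[OF finite_subset[OF _ fin] sub]) blast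
      then show ?thesis using less.hyps[OF _ N] False by simp
    qed
    have "(\<Sum>k\<in>?A. g (insert {q, k} R)) = of_nat (card {k \<in> ?A. r k = 0}) * g M"
    proof -
      have "(\<Sum>k\<in>?A. g (insert {q, k} R)) = (\<Sum>k\<in>?A. if r k = 0 then g M else 0)"
        by (intro sum.cong refl val)
      also have "\<dots> = (\<Sum>k\<in>{k \<in> ?A. r k = 0}. g M)"
        by (rule sum.inter_filter[symmetric]) simp
      finally show ?thesis by simp
    qed
    moreover have "a \<in> {k \<in> ?A. r k = 0}" using a q R by auto
    then have "card {k \<in> ?A. r k = 0} \<noteq> 0" by (auto simp: card_eq_0_iff)
    ultimately show ?thesis using sum0 by auto
  qed
qed

text \<open>
  If row 0 is unmatched, then raising an unmatched vertex \<open>b\<close> to row 0 only swaps unmatched vertices, and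
  the relation is a positive multiple of \<open>g M\<close>.
\<close>

lemma vanishes_if_unmatched_off_row_0:
  assumes M: "M \<in> matchings n d" "\<forall>a\<in>\<Union>M. r a \<noteq> 0" and b: "b \<in> {1..n}" "b \<notin> \<Union>M" "r b \<noteq> 0"
  shows "g M = 0"
proof -
  have "matching_act (swap b c) M = M" if "r c = 0" for c
  proof (rule matching_act_fixed)
    fix a assume a: "a \<in> \<Union>M"
    then have "a \<noteq> b" "r a \<noteq> 0" using M(2) b(2) by blast+
    then show "swap b c a = a" using that by (auto simp: transpose_def)
  qed
  then have "g M + of_nat (card {c \<in> {1..n}. r c = 0}) * g M = 0"
    using raising[OF b(1) _ M(1), of 0] b(3) by simp
  then have "of_nat (Suc (card {c \<in> {1..n}. r c = 0})) * g M = 0" by (simp add: algebra_simps)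
  then show ?thesis by (simp only: mult_eq_0_iff of_nat_eq_0_iff) simp
qed

text \<open>
  Induction on the number of edges between different rows. Take such an edge \<open>{p, b}\<close> with \<open>p\<close> in the
  earlier row and raise \<open>b\<close> to the row of \<open>p\<close>. The transposition of \<open>b\<close> with a vertex \<open>c\<close> of this row fixes
  \<open>M\<close> if \<open>c = p\<close>. If \<open>c\<close> is matched inside the row, it gives a matching in the orbit of \<open>M\<close> under the Young
  subgroup. Otherwise it turns two edges between rows into the edge \<open>{p, c}\<close> inside the row and one other
  edge, so the induction hypothesis applies. An unmatched \<open>c\<close> need not be
  considered, by the previous lemma. Again a positive multiple of \<open>g M\<close> is zero.
\<close>

lemma vanishes_off_row_0_if_vanishes_row_matched:
  assumes base: "\<And>M. M \<in> matchings n d \<Longrightarrow> row_matched r M \<Longrightarrow> g M = 0"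
    and "M \<in> matchings n d" "\<forall>a\<in>\<Union>M. r a \<noteq> 0"
  shows "g M = 0"
  using assms(2,3)
proof (induction "card {S \<in> M. \<not> (\<exists>i. \<forall>a\<in>S. r a = i)}" arbitrary: M rule: less_induct)
  case less
  let ?off = "\<lambda>M. {S \<in> M. \<not> (\<exists>i. \<forall>a\<in>S. r a = i)}"
  note M = less.prems(1)
  have fin: "finite M" by (rule matching_finite[OF M])
  show ?case
  proof (cases "?off M = {}")
    case True
    have "row_matched r M"
      unfolding row_matched_def
    proof
      fix S assume S: "S \<in> M"
      then obtain i where i: "\<forall>a\<in>S. r a = i" using True by blast
      have "S \<in> pairs n" using S M by (auto simp: matchings_def)
      then obtain a b where "S = {a, b}" by (rule pairsE)
      then have "i > 0" using i less.prems(2) S by auto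
      then show "\<exists>i>0. \<forall>a\<in>S. r a = i" using i by blast
    qed
    then show ?thesis using base M by blast
  next
    case False
    then obtain S where S: "S \<in> M" "\<not> (\<exists>i. \<forall>a\<in>S. r a = i)" by blast
    have "S \<in> pairs n" using S M by (auto simp: matchings_def)
    then obtain x y where xy: "S = {x, y}" "x \<in> {1..n}" "y \<in> {1..n}" by (rule pairsE)
    have "r x \<noteq> r y" using S(2) xy by auto
    then obtain p b where pb: "S = {p, b}" "r p < r b" "p \<in> {1..n}" "b \<in> {1..n}"
      using xy by (metis insert_commute linorder_neqE_nat)
    show ?thesis
    proof (cases "\<exists>c\<in>{1..n}. c \<notin> \<Union>M \<and> r c \<noteq> 0")
      case True then show ?thesis using vanishes_if_unmatched_off_row_0[OF M less.prems(2)] by blast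
    next
      case allmatched: False
      have rp: "r p \<noteq> 0" using less.prems(2) S pb by auto
      have zero_or_same: "g (matching_act (swap b c) M) = 0
          \<or> g (matching_act (swap b c) M) = g M"
        if c: "c \<in> {c \<in> {1..n}. r c = r p}" for c
      proof -
        let ?t = "swap b c"
        have cb: "c \<noteq> b" using c pb by auto
        have "c \<in> \<Union>M" using allmatched c rp by auto
        then obtain c' where c': "{c, c'} \<in> M" "c \<noteq> c'" by (rule matching_edge[OF M])
        have pbM: "{p, b} \<in> M" using S pb by simp
        show ?thesis
        proof (cases "{p, b} = {c, c'}")
          case True
          then have "c = p" using cb by auto
          have "w ` S' = S'" if "S' \<in> M" and w: "w = ?t" for S' w
          proof (cases "S' = {p, b}")
            case True then show ?thesis using \<open>c = p\<close> w by auto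
          next
            case False
            then have "p \<notin> S'" "b \<notin> S'" using matching_edge_eqI[OF M \<open>S' \<in> M\<close> pbM] by auto
            then show ?thesis using \<open>c = p\<close> w by (force simp: transpose_def image_iff)
          qed
          then have "matching_act ?t M = M" by (simp add: matching_act_def)
          then show ?thesis by simp
        next
          case False
          obtain R where R: "M = insert {p, b} (insert {c, c'} R)" "p \<notin> \<Union>R" "b \<notin> \<Union>R" "c \<notin> \<Union>R" "c' \<notin> \<Union>R"
            "{p, b} \<inter> {c, c'} = {}" "R \<subseteq> M" "{p, b} \<notin> R" "{c, c'} \<notin> R"
            by (rule matching_two_edges[OF M pbM c'(1) False])
          have pbr: "p \<noteq> b" using pb by auto
          have "matching_act ?t R = R"
            by (rule matching_act_fixed) (use R in \<open>auto simp: transpose_def\<close>)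
          moreover have "?t p = p" "?t c' = c'" using R(6) pbr c'(2) by (auto simp: transpose_def)
          ultimately have N: "matching_act ?t M = insert {p, c} (insert {b, c'} R)"
            by (simp add: R(1))
          show ?thesis
          proof (cases "r c' = r p")
            case True
            let ?s = "swap p c'"
            have c'n: "c' \<in> {1..n}" using c'(1) matching_vertices[OF M] by auto
            have "matching_act ?s R = R"
              by (rule matching_act_fixed) (use R in \<open>auto simp: transpose_def\<close>)
            moreover have "?s b = b" "?s c = c" using R(6) pbr c'(2) by (auto simp: transpose_def)
            ultimately have "matching_act ?s M = insert {c', b} (insert {c, p} R)"
              by (simp add: R(1))
            also have "\<dots> = matching_act ?t M" unfolding N by (simp add: insert_commute)
            finally have "matching_act ?s M = matching_act ?t M" .
            moreover have "?s \<in> young_group n r" using True pb c'n by (intro swap_in_young_group) auto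
            ultimately show ?thesis using invariant by metis
          next
            case r': False
            have tp: "?t permutes {1..n}" using pb c by (intro permutes_swap_id) auto
            have Nm: "matching_act ?t M \<in> matchings n d" by (rule matching_act_mem[OF tp M])
            have "\<Union>(insert {p, c} (insert {b, c'} R)) = \<Union>(insert {p, b} (insert {c, c'} R))" by auto
            then have Un: "\<Union>(matching_act ?t M) = \<Union>M" unfolding N R(1)[symmetric] .
            have "?off (matching_act ?t M) \<subseteq> insert {b, c'} (?off R)" unfolding N using c by auto
            then have "card (?off (matching_act ?t M)) \<le> card (insert {b, c'} (?off R))"
              using fin finite_subset[OF R(7)] by (intro card_mono) auto
            also have "\<dots> \<le> Suc (card (?off R))" by (rule card_insert_le_m1[of "Suc _", simplified]) simp
            also have "\<dots> < card (insert {p, b} (insert {c, c'} (?off R)))"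
              using R False finite_subset[OF R(7) fin] by simp
            also have "\<dots> \<le> card (?off M)"
              using fin S pb c'(1) r' c R(7) by (intro card_mono) auto
            finally have "card (?off (matching_act ?t M)) < card (?off M)" .
            then show ?thesis using less.hyps[OF _ Nm] less.prems(2) by (simp add: Un)
          qed
        qed
      qed
      have "\<exists>k. (\<Sum>c\<in>{c \<in> {1..n}. r c = r p}. g (matching_act (swap b c) M)) = of_nat k * g M"
        by (rule sum_zero_or_value) (simp, rule zero_or_same)
      then obtain k where "(\<Sum>c\<in>{c \<in> {1..n}. r c = r p}. g (matching_act (swap b c) M)) = of_nat k * g M" ..
      then have "of_nat (Suc k) * g M = 0" using raising[OF pb(4,2) M] by (simp add: algebra_simps)
      then show ?thesis by (simp only: mult_eq_0_iff of_nat_eq_0_iff) simp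
    qed
  qed
qed

lemma determined_by_row_matched:
  assumes "\<And>M. M \<in> matchings n d \<Longrightarrow> row_matched r M \<Longrightarrow> g M = 0" and "M \<in> matchings n d"
  shows "g M = 0"
  using assms vanishes_if_vanishes_off_row_0 vanishes_off_row_0_if_vanishes_row_matched by blast

lemma row_matched_off_row_0: "row_matched r M \<Longrightarrow> \<forall>a\<in>\<Union>M. r a \<noteq> 0"
  by (force simp: row_matched_def)

lemma row_matched_covers:
  assumes "M \<in> matchings n d" "row_matched r M" "g M \<noteq> 0"
  shows "\<Union>M = {a \<in> {1..n}. r a \<noteq> 0}"
  using assms vanishes_if_unmatched_off_row_0[OF assms(1) row_matched_off_row_0[OF assms(2)]]
    row_matched_off_row_0[OF assms(2)] matching_vertices[OF assms(1)] by blast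

lemma vanishes_unless_first_row:
  assumes "card {a \<in> {1..n}. r a = 0} + 2 * d \<noteq> n" "M \<in> matchings n d"
  shows "g M = 0"
proof (rule determined_by_row_matched[OF _ assms(2)], rule ccontr)
  fix M assume M: "M \<in> matchings n d" "row_matched r M" "g M \<noteq> 0"
  have "card (\<Union>M) = 2 * d" using M(1) card_matching_vertices[of M n] by (simp add: matchings_def)
  moreover have "{a \<in> {1..n}. r a = 0} = {1..n} - \<Union>M" unfolding row_matched_covers[OF M] by auto
  moreover have "card ({1..n} - \<Union>M) + card (\<Union>M) = n"
    using matching_vertices[OF M(1)] card_mono[OF _ matching_vertices[OF M(1)]]
    by (simp add: card_Diff_subset finite_subset)
  ultimately show False using assms(1) by simp
qed

lemma vanishes_unless_even_rows:
  assumes "i > 0" "odd (card {a \<in> {1..n}. r a = i})" "M \<in> matchings n d"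
  shows "g M = 0"
proof (rule determined_by_row_matched[OF _ assms(3)], rule ccontr)
  fix M assume M: "M \<in> matchings n d" "row_matched r M" "g M \<noteq> 0"
  let ?N = "{S \<in> M. \<forall>a\<in>S. r a = i}"
  have "\<Union>?N = {a \<in> {1..n}. r a = i}"
  proof (intro equalityI subsetI)
    fix a assume "a \<in> \<Union>?N"
    then show "a \<in> {a \<in> {1..n}. r a = i}" using matching_vertices[OF M(1)] by auto
  next
    fix a assume a: "a \<in> {a \<in> {1..n}. r a = i}"
    then have "a \<in> \<Union>M" using row_matched_covers[OF M] assms(1) by auto
    then obtain S where "S \<in> M" "a \<in> S" by blast
    moreover from this obtain j where "\<forall>a\<in>S. r a = j" using M(2) by (auto simp: row_matched_def)
    ultimately show "a \<in> \<Union>?N" using a by auto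
  qed
  moreover have "card (\<Union>?N) = 2 * card ?N"
    using M(1) by (intro card_matching_vertices[of _ n]) (auto simp: matchings_def pairwise_def)
  ultimately show False using assms(2) by simp
qed

text \<open>
  Swapping two vertices of the same row creates one edge of \<open>N\<close> in \<open>M\<close> without destroying another, so the
  two matchings are joined by swaps inside rows.
\<close>

lemma constant_on_row_matched:
  assumes "M \<in> matchings n d" "row_matched r M" "N \<in> matchings n d" "row_matched r N" "\<Union>M = \<Union>N"
  shows "g M = g N"
  using assms(1,2,5)
proof (induction "card (N - M)" arbitrary: M rule: less_induct)
  case less
  note M = less.prems(1)
  have finN: "finite N" by (rule matching_finite[OF assms(3)])
  show ?case
  proof (cases "N \<subseteq> M")
    case True
    have "card N = card M" using M assms(3) by (simp add: matchings_def)
    then have "N = M" using True matching_finite[OF M] by (intro card_subset_eq) auto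
    then show ?thesis by simp
  next
    case False
    then obtain S where S: "S \<in> N" "S \<notin> M" by blast
    have "S \<in> pairs n" using S assms(3) by (auto simp: matchings_def)
    then obtain a b where ab: "S = {a, b}" "a \<noteq> b" "a \<in> {1..n}" "b \<in> {1..n}" by (rule pairsE)
    have rab: "r a = r b" using assms(4) S(1) ab(1) by (auto simp: row_matched_def)
    have mem: "a \<in> \<Union>M" "b \<in> \<Union>M" using S(1) ab(1) less.prems(3) by auto
    obtain a' where a': "{a, a'} \<in> M" "a \<noteq> a'" "a' \<in> {1..n}" by (rule matching_edge[OF M mem(1)])
    obtain b' where b': "{b, b'} \<in> M" "b \<noteq> b'" "b' \<in> {1..n}" by (rule matching_edge[OF M mem(2)])
    have ne: "{a, a'} \<noteq> {b, b'}" using a' b' ab S by auto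
    obtain R where R: "M = insert {a, a'} (insert {b, b'} R)" "a \<notin> \<Union>R" "a' \<notin> \<Union>R" "b \<notin> \<Union>R" "b' \<notin> \<Union>R"
      "{a, a'} \<inter> {b, b'} = {}" "R \<subseteq> M" "{a, a'} \<notin> R" "{b, b'} \<notin> R"
      by (rule matching_two_edges[OF M a'(1) b'(1) ne])
    have ra': "r a' = r a" "r b' = r b" using less.prems(2) a'(1) b'(1) by (auto simp: row_matched_def)
    have rpos: "r a > 0" using row_matched_off_row_0[OF less.prems(2)] mem by auto
    let ?t = "swap a' b"
    have t: "?t \<in> young_group n r" using a'(3) ab(4) ra' rab by (intro swap_in_young_group) auto
    have tp: "?t permutes {1..n}" using t by (simp add: young_group_def)
    have "matching_act ?t R = R"
      by (rule matching_act_fixed) (use R in \<open>auto simp: transpose_def\<close>)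
    moreover have "?t a = a" "?t b' = b'" using R(6) a'(2) b'(2) by (auto simp: transpose_def)
    ultimately have N': "matching_act ?t M = insert {a, b} (insert {a', b'} R)"
      by (simp add: R(1))
    have Rm: "row_matched r R" using less.prems(2) R(7) unfolding row_matched_def by blast
    have "row_matched r (matching_act ?t M)"
      using Rm rpos rab ra' unfolding N' by (auto simp: row_matched_def)
    moreover have "\<Union>(matching_act ?t M) = \<Union>N"
      unfolding N' less.prems(3)[symmetric] by (subst R(1)) auto
    moreover have "card (N - matching_act ?t M) < card (N - M)"
    proof (rule psubset_card_mono)
      have "{a, a'} \<notin> N" "{b, b'} \<notin> N"
        using matching_edge_eqI[OF assms(3) S(1), of "{a, a'}" a] matching_edge_eqI[OF assms(3) S(1), of "{b, b'}" b]
          a'(1) b'(1) S(2) ab(1) by auto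
      then have "N - matching_act ?t M \<subseteq> N - M" unfolding N' by (subst R(1)) auto
      moreover have "S \<in> N - M" "S \<notin> N - matching_act ?t M" using S ab(1) by (auto simp: N')
      ultimately show "N - matching_act ?t M \<subset> N - M" by blast
    qed (use finN in auto)
    ultimately have "g (matching_act ?t M) = g N"
      using less.hyps matching_act_mem[OF tp M] by blast
    then show ?thesis using invariant[OF t] by simp
  qed
qed

end

lemma matching_act_image_complement:
  assumes "u permutes {1..n}"
  shows "{1..n} - \<Union>(matching_act u M) - {u i} = u ` ({1..n} - \<Union>M - {i})"
  using permutes_inj[OF assms] permutes_image[OF assms]
  by (simp add: Union_matching_act image_set_diff)

lemma exchange_relation_act:
  assumes g: "exchange_relation n d g" and u: "u permutes {1..n}"
  shows "exchange_relation n d (\<lambda>M. g (matching_act u M))"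
  unfolding exchange_relation_def
proof (intro allI impI)
  fix e M i assume d: "d = Suc e" and M: "M \<in> matchings n e" and i: "i \<in> {1..n} - \<Union>M"
  have ui: "u i \<in> {1..n}" "u i \<notin> \<Union>(matching_act u M)"
    using i permutes_in_image[OF u] permutes_inj[OF u] by (auto simp: Union_matching_act inj_image_mem_iff)
  have "0 = (\<Sum>k\<in>{1..n} - \<Union>(matching_act u M) - {u i}. g (insert {u i, k} (matching_act u M)))"
    by (rule exchange_relationD[OF g d matching_act_mem[OF u M] ui, symmetric])
  also have "\<dots> = (\<Sum>k\<in>{1..n} - \<Union>M - {i}. g (matching_act u (insert {i, k} M)))"
    unfolding matching_act_image_complement[OF u]
    by (subst sum.reindex) (use permutes_inj_on[OF u] in auto)
  finally show "(\<Sum>k\<in>{1..n} - \<Union>M - {i}. g (matching_act u (insert {i, k} M))) = 0" by simp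
qed

lemma exchange_relation_sum:
  assumes "\<And>v. v \<in> V \<Longrightarrow> exchange_relation n d (f v)"
  shows "exchange_relation n d (\<lambda>M. \<Sum>v\<in>V. f v M)"
  unfolding exchange_relation_def
proof (intro allI impI)
  fix e M i assume h: "d = Suc e" "M \<in> matchings n e" "i \<in> {1..n} - \<Union>M"
  have "(\<Sum>k\<in>{1..n} - \<Union>M - {i}. \<Sum>v\<in>V. f v (insert {i, k} M)) =
     (\<Sum>v\<in>V. \<Sum>k\<in>{1..n} - \<Union>M - {i}. f v (insert {i, k} M))" by (rule sum.swap)
  also have "\<dots> = 0"
  proof (rule sum.neutral, rule ballI)
    fix v assume "v \<in> V"
    from exchange_relationD[OF assms[OF this] h(1,2)] h(3)
    show "(\<Sum>k\<in>{1..n} - \<Union>M - {i}. f v (insert {i, k} M)) = 0" by blast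
  qed
  finally show "(\<Sum>k\<in>{1..n} - \<Union>M - {i}. \<Sum>v\<in>V. f v (insert {i, k} M)) = 0" .
qed

lemma exchange_relation_of_int:
  assumes "exchange_relation n d f"
  shows "exchange_relation n d (\<lambda>M. of_int (f M) :: 'a::ring_1)"
  using assms unfolding exchange_relation_def of_int_sum[symmetric] by auto

lemma exchange_relation_diff:
  fixes g h :: "nat set set \<Rightarrow> complex"
  assumes "exchange_relation n d g" "exchange_relation n d h"
  shows "exchange_relation n d (\<lambda>M. g M - c * h M)"
  using assms unfolding exchange_relation_def sum_subtractf sum_distrib_left[symmetric] by auto

text \<open>
  An element \<open>v\<close> of the Young subgroup of \<open>r(b := i)\<close> is uniquely \<open>u \<circ> (b c)\<close> with \<open>c = v\<inverse> b\<close> in row \<open>i\<close> of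
  \<open>r(b := i)\<close> and \<open>u\<close> fixing \<open>b\<close>. Such a \<open>u\<close> lies in the Young subgroup of \<open>r\<close>, so \<open>g\<close> does not see it and the
  sum is a positive multiple of the raising relation.
\<close>

lemma raising_from_row_sum:
  fixes g :: "nat set set \<Rightarrow> complex"
  assumes inv: "\<And>u M. u \<in> young_group n r \<Longrightarrow> g (matching_act u M) = g M"
    and b: "b \<in> {1..n}" "i < r b"
    and zero: "(\<Sum>v\<in>young_group n (r(b := i)). g (matching_act v M)) = 0"
  shows "g M + (\<Sum>c\<in>{c \<in> {1..n}. r c = i}. g (matching_act (swap b c) M)) = 0"
proof -
  let ?r = "r(b := i)" and ?t = "swap b"
  define C where "C = insert b {c \<in> {1..n}. r c = i}"
  define H where "H = {u \<in> young_group n ?r. u b = b}"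
  have Cn: "c \<in> C \<Longrightarrow> c \<in> {1..n} \<and> ?r c = i" for c using b by (auto simp: C_def)
  have t: "c \<in> C \<Longrightarrow> ?t c \<in> young_group n ?r" for c
    using Cn[of c] b by (intro swap_in_young_group) auto
  have H: "u \<in> young_group n r" if u: "u \<in> H" for u
  proof -
    have up: "u permutes {1..n}" "u b = b" and ur: "\<And>a. a \<in> {1..n} \<Longrightarrow> ?r (u a) = ?r a"
      using u by (auto simp: H_def young_group_def)
    have "r (u a) = r a" if "a \<in> {1..n}" for a
    proof (cases "a = b")
      case False
      then have "u a \<noteq> b" using up permutes_inj[OF up(1)] by (metis injD)
      then show ?thesis using ur[OF that] False by simp
    qed (simp add: up)
    then show ?thesis using up by (simp add: young_group_def)
  qed
  have "0 = (\<Sum>v\<in>young_group n ?r. g (matching_act v M))" using zero by simp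
  also have "\<dots> = (\<Sum>(c, u)\<in>C \<times> H. g (matching_act (u \<circ> ?t c) M))"
  proof (rule sum.reindex_bij_witness[where i = "\<lambda>(c, u). u \<circ> ?t c" and j = "\<lambda>v. (inv' v b, v \<circ> ?t (inv' v b))"])
    fix v assume v: "v \<in> young_group n ?r"
    have vp: "v permutes {1..n}" using v by (simp add: young_group_def)
    have iv: "inv' v b \<in> {1..n}" using permutes_in_image[OF permutes_inv[OF vp]] b by simp
    have "?r (inv' v b) = i" using young_group_inv[OF v] b by (auto simp: young_group_def)
    then have c: "inv' v b \<in> C" using iv by (auto simp: C_def split: if_splits)
    then show "(inv' v b, v \<circ> ?t (inv' v b)) \<in> C \<times> H"
      using young_group_compose[OF v t[OF c]] by (simp add: H_def permutes_inverses[OF vp])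
    show "(case (inv' v b, v \<circ> ?t (inv' v b)) of (c, u) \<Rightarrow> u \<circ> ?t c) = v"
      by (simp add: comp_assoc)
    show "(case (inv' v b, v \<circ> ?t (inv' v b)) of (c, u) \<Rightarrow> g (matching_act (u \<circ> ?t c) M)) = g (matching_act v M)"
      by (simp add: comp_assoc)
  next
    fix p assume p: "p \<in> C \<times> H"
    obtain c u where cu: "p = (c, u)" "c \<in> C" "u \<in> H" using p by auto
    have u: "u \<in> young_group n ?r" "u b = b" "u permutes {1..n}" using cu(3) by (auto simp: H_def young_group_def)
    show "(case p of (c, u) \<Rightarrow> u \<circ> ?t c) \<in> young_group n ?r"
      using young_group_compose[OF u(1) t[OF cu(2)]] by (simp add: cu(1))
    have "inj (u \<circ> ?t c)" using permutes_inj[OF u(3)] by (intro inj_compose) auto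
    then have "inv' (u \<circ> ?t c) b = c" using u(2) by (intro inv_f_eq) auto
    then show "(inv' (case p of (c, u) \<Rightarrow> u \<circ> ?t c) b, (case p of (c, u) \<Rightarrow> u \<circ> ?t c) \<circ>
       ?t (inv' (case p of (c, u) \<Rightarrow> u \<circ> ?t c) b)) = p"
      by (simp add: cu(1) comp_assoc)
  qed
  also have "\<dots> = (\<Sum>(c, u)\<in>C \<times> H. g (matching_act (?t c) M))"
    using inv[OF H] by (intro sum.cong refl) (auto simp: matching_act_compose)
  also have "\<dots> = of_nat (card H) * (\<Sum>c\<in>C. g (matching_act (?t c) M))"
    by (simp add: sum.cartesian_product[symmetric] sum_distrib_left)
  finally have "of_nat (card H) * (\<Sum>c\<in>C. g (matching_act (?t c) M)) = 0" by simp
  moreover have "card H \<noteq> 0"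
  proof -
    have "id \<in> H" by (simp add: H_def)
    moreover have "finite H" by (simp add: H_def)
    ultimately show ?thesis by auto
  qed
  ultimately have "(\<Sum>c\<in>C. g (matching_act (?t c) M)) = 0" by simp
  moreover have "b \<notin> {c \<in> {1..n}. r c = i}" using b by simp
  ultimately show ?thesis by (simp add: C_def)
qed

definition row_sum :: "nat \<Rightarrow> (nat \<Rightarrow> nat) \<Rightarrow> (nat set set \<Rightarrow> 'a::comm_monoid_add) \<Rightarrow> nat set set \<Rightarrow> 'a" where
  "row_sum n r g M = (\<Sum>v\<in>young_group n r. g (matching_act v M))"

lemma row_sum_invariant:
  assumes "u \<in> young_group n r"
  shows "row_sum n r g (matching_act u M) = row_sum n r g M"
  unfolding row_sum_def matching_act_compose[symmetric] by (rule sum_young_group_right[OF assms])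

lemma exchange_relation_row_sum:
  assumes "exchange_relation n d g"
  shows "exchange_relation n d (row_sum n r g)"
  unfolding row_sum_def[abs_def]
  by (intro exchange_relation_sum exchange_relation_act[OF assms]) (simp add: young_group_def)

lemma tableau_of_rows:
  assumes n: "n > 0" and dec: "\<And>i j. i < j \<Longrightarrow> card {a \<in> {1..n}. r a = j} \<le> card {a \<in> {1..n}. r a = i}"
  obtains l T where "tableau n l T" "l \<noteq> []" "\<And>a. a \<in> {1..n} \<Longrightarrow> row_of l T a = r a"
    "\<And>i. i < length l \<Longrightarrow> l ! i = card {a \<in> {1..n}. r a = i}"
proof -
  let ?A = "\<lambda>i. {a \<in> {1..n}. r a = i}"
  define m where "m = Suc (Max (r ` {1..n}))"
  have rm: "r a < m" if "a \<in> {1..n}" for a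
    using that by (auto simp: m_def less_Suc_eq_le intro!: Max_ge)
  have "Max (r ` {1..n}) \<in> r ` {1..n}" using n by (intro Max_in) (auto simp: atLeastAtMost_iff)
  then obtain a where "a \<in> ?A (m - 1)" by (auto simp: m_def)
  then have last: "card (?A (m - 1)) > 0" by (auto simp: card_gt_0_iff)
  (* All rows up to the last one that occurs are nonempty, because the sizes decrease. *)
  have pos: "card (?A i) > 0" if "i < m" for i
  proof (cases "i = m - 1")
    case False
    then have "i < m - 1" using that by simp
    from dec[OF this] last show ?thesis by linarith
  qed (use last in simp)
  define l where "l = map (\<lambda>i. card (?A i)) [0..<m]"
  have len: "length l = m" and nth: "\<And>i. i < m \<Longrightarrow> l ! i = card (?A i)" by (simp_all add: l_def)
  have UN: "(\<Union>i<m. ?A i) = {1..n}" using rm by auto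
  have "sum_list l = (\<Sum>i<m. card (?A i))"
    by (simp add: sum_list_sum_nth len nth atLeast0LessThan)
  also have "\<dots> = card (\<Union>i<m. ?A i)" by (rule card_UN_disjoint[symmetric]) auto
  finally have sum: "sum_list l = n" unfolding UN by simp
  have "sorted_wrt (\<ge>) l" unfolding sorted_wrt_iff_nth_less using dec nth len by auto
  moreover have "0 \<notin> set l"
  proof
    assume "0 \<in> set l"
    then obtain i where "i < m" "card (?A i) = 0" unfolding l_def by force
    with pos[of i] show False by linarith
  qed
  ultimately have part: "l \<in> partitions n" using sum by (simp add: partitions_def)
  have "\<exists>h. bij_betw h {..<card (?A i)} (?A i)" for i
    using ex_bij_betw_nat_finite[of "?A i"] by (simp add: atLeast0LessThan)
  then obtain h where h: "\<And>i. bij_betw (h i) {..<card (?A i)} (?A i)" by metis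
  define T where "T = (\<lambda>(i, j). h i j)"
  have hA: "h i j \<in> ?A i" if "j < card (?A i)" for i j
    using bij_betwE[OF h[of i]] that by blast
  have cells: "(i, j) \<in> cells l \<longleftrightarrow> i < m \<and> j < card (?A i)" for i j
    using nth by (auto simp: cells_def len)
  have "bij_betw T (cells l) {1..n}"
    unfolding bij_betw_def
  proof
    show "inj_on T (cells l)"
    proof (rule inj_onI)
      fix x y assume xy: "x \<in> cells l" "y \<in> cells l" "T x = T y"
      obtain i j i' j' where e: "x = (i, j)" "y = (i', j')" by (cases x, cases y) auto
      have eq: "h i j = h i' j'" using xy(3) by (simp add: e T_def)
      have "i = r (h i j)" "i' = r (h i' j')" using hA[of j i] hA[of j' i'] xy e by (auto simp: cells)
      then have "i = i'" using eq by simp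
      moreover have "j = j'"
        using inj_onD[OF bij_betw_imp_inj_on[OF h[of i]], of j j'] eq xy e \<open>i = i'\<close> by (auto simp: cells)
      ultimately show "x = y" by (simp add: e)
    qed
    show "T ` cells l = {1..n}"
    proof (intro equalityI subsetI)
      fix a assume "a \<in> T ` cells l"
      then obtain i j where "(i, j) \<in> cells l" "a = h i j" by (auto simp: T_def)
      then show "a \<in> {1..n}" using hA[of j i] by (auto simp: cells)
    next
      fix a assume a: "a \<in> {1..n}"
      then have "a \<in> h (r a) ` {..<card (?A (r a))}" using h[of "r a"] by (simp add: bij_betw_def)
      then obtain j where "j < card (?A (r a))" "a = h (r a) j" by auto
      then show "a \<in> T ` cells l"
        using rm[OF a] by (intro image_eqI[of _ _ "(r a, j)"]) (auto simp: T_def cells)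
    qed
  qed
  then have tab: "tableau n l T" using part sum by unfold_locales (simp_all add: tableaux_def)
  interpret tableau n l T by (rule tab)
  have rows: "row_of l T a = r a" if a: "a \<in> {1..n}" for a
  proof -
    let ?i = "row_of l T a" and ?j = "col_of l T a"
    have "a = h ?i ?j" using entry_cell_of[OF a] by (simp add: T_def)
    moreover have "?j < card (?A ?i)" using cell_of[OF a] by (simp add: cells)
    ultimately show ?thesis using hA[of ?j ?i] by auto
  qed
  show ?thesis
  proof (rule that[OF tab _ rows])
    show "l \<noteq> []" using len by (auto simp: m_def)
    show "l ! i = card (?A i)" if "i < length l" for i using that nth len by simp
  qed
qed

text \<open>
  After raising \<open>b\<close>, the rows up to \<open>i\<close> contain one entry too many for dominance.
\<close>

lemma (in tableau) raised_rows_meet_column_twice: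
  assumes rows: "\<And>a. a \<in> {1..n} \<Longrightarrow> row_of l T a = r a" and b: "b \<in> {1..n}" "i < r b"
  shows "\<exists>j. \<not> inj_on (r(b := i)) {a \<in> {1..n}. col_of l T a = j}"
proof (rule ccontr)
  assume "\<not> ?thesis"
  then have inj: "inj_on (r(b := i)) {a \<in> {1..n}. col_of l T a = j}" for j by blast
  have "insert b {a \<in> {1..n}. row_of l T a \<le> i} \<subseteq> {a \<in> {1..n}. (r(b := i)) a \<le> i}"
    using b rows by auto
  then have "card (insert b {a \<in> {1..n}. row_of l T a \<le> i}) \<le> card {a \<in> {1..n}. (r(b := i)) a \<le> i}"
    by (intro card_mono) auto
  moreover have "b \<notin> {a \<in> {1..n}. row_of l T a \<le> i}" using b rows by auto
  ultimately show False using dominance[OF inj, of i] by simp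
qed

lemma (in tableau) highest_weight_row_sum:
  assumes shp: "l \<in> even_tail_shapes n d" and rows: "\<And>a. a \<in> {1..n} \<Longrightarrow> row_of l T a = r a"
  shows "highest_weight n d r (\<lambda>M. of_int (row_sum n r (matching_polytabloid l T) M))"
proof
  show "exchange_relation n d (\<lambda>M. complex_of_int (row_sum n r (matching_polytabloid l T) M))"
    by (intro exchange_relation_of_int exchange_relation_row_sum exchange shp)
  show inv: "complex_of_int (row_sum n r (matching_polytabloid l T) (matching_act u M)) =
      complex_of_int (row_sum n r (matching_polytabloid l T) M)" if "u \<in> young_group n r" for u M
    by (simp add: row_sum_invariant[OF that])
  fix b i M assume b: "b \<in> {1..n}" "i < r b"
  have "(\<Sum>v\<in>young_group n (r(b := i)). row_sum n r (matching_polytabloid l T) (matching_act v M)) =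
    (\<Sum>u\<in>young_group n r. \<Sum>v\<in>young_group n (r(b := i)). matching_polytabloid l T (matching_act u (matching_act v M)))"
    unfolding row_sum_def by (rule sum.swap)
  also have "\<dots> = 0"
  proof (rule sum.neutral, rule ballI)
    fix u assume u: "u \<in> young_group n r"
    have up: "u permutes {1..n}" using u by (simp add: young_group_def)
    have iu: "inv' u permutes {1..n}" by (rule permutes_inv[OF up])
    interpret uT: tableau n l "inv' u \<circ> T" by (rule permuted_tableau[OF iu])
    have "row_of l (inv' u \<circ> T) a = r a" if a: "a \<in> {1..n}" for a
    proof -
      have ua: "u a \<in> {1..n}" using a permutes_in_image[OF up] by simp
      show ?thesis using row_of_permuted[OF iu ua] rows[OF ua] u a
        by (simp add: young_group_def permutes_inverses[OF up])
    qed
    from uT.raised_rows_meet_column_twice[OF this b]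
    obtain j where j: "\<not> inj_on (r(b := i)) {a \<in> {1..n}. col_of l (inv' u \<circ> T) a = j}" by blast
    have "matching_polytabloid l T (matching_act u N) = matching_polytabloid l (inv' u \<circ> T) N" for N
      using equivariant[OF iu, of "matching_act u N"] by (simp add: matching_act_inv[OF up])
    then show "(\<Sum>v\<in>young_group n (r(b := i)). matching_polytabloid l T (matching_act u (matching_act v M))) = 0"
      using uT.row_sum_vanishes[OF j] by simp
  qed
  finally have "(\<Sum>v\<in>young_group n (r(b := i)). complex_of_int (row_sum n r (matching_polytabloid l T) (matching_act v M))) = 0"
    by (simp add: of_int_sum[symmetric] del: of_int_sum)
  then show "complex_of_int (row_sum n r (matching_polytabloid l T) M) +
      (\<Sum>c\<in>{c \<in> {1..n}. r c = i}. complex_of_int (row_sum n r (matching_polytabloid l T)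
         (matching_act (swap b c) M))) = 0"
    using raising_from_row_sum[where g = "\<lambda>M. complex_of_int (row_sum n r (matching_polytabloid l T) M)"
          and n = n and r = r and b = b and i = i and M = M] inv b by blast
qed

text \<open>
  The pairing of the symmetrised matching polytabloid with the tabloid of \<open>T\<close>, which the Young subgroup
  fixes, is a positive multiple of the pairing before symmetrisation.
\<close>

lemma (in tableau) row_sum_nonzero:
  assumes shp: "l \<in> even_tail_shapes n d" and rows: "\<And>a. a \<in> {1..n} \<Longrightarrow> row_of l T a = r a"
  obtains M where "M \<in> matchings n d" "row_matched r M" "row_sum n r (matching_polytabloid l T) M \<noteq> 0"
proof -
  let ?P = "matching_polytabloid l T"
  let ?B = "\<Sum>M\<in>matchings n d. of_bool (compatible (tabloid l T) M) * ?P M"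
  have tab: "map ((`) v) (tabloid l T) = tabloid l T" if v: "v \<in> young_group n r" for v
  proof -
    have vp: "v permutes {1..n}" using v by (simp add: young_group_def)
    interpret vT: tableau n l "v \<circ> T" by (rule permuted_tableau[OF vp])
    have "row_of l (v \<circ> T) a = row_of l T a" if a: "a \<in> {1..n}" for a
    proof -
      have va: "inv' v a \<in> {1..n}" using a permutes_in_image[OF permutes_inv[OF vp]] by simp
      show ?thesis using row_of_permuted[OF vp va] rows[OF va] rows[OF a] young_group_inv[OF v] a
        by (simp add: young_group_def permutes_inverses[OF vp])
    qed
    then have "tabloid l (v \<circ> T) = tabloid l T" unfolding vT.tabloid_eq tabloid_eq by (intro map_cong) auto
    then show ?thesis by (simp add: tabloid_permuted)
  qed
  have "(\<Sum>M\<in>matchings n d. of_bool (compatible (tabloid l T) M) * row_sum n r ?P M) =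
     (\<Sum>v\<in>young_group n r. \<Sum>M\<in>matchings n d. of_bool (compatible (tabloid l T) M) * ?P (matching_act v M))"
    unfolding row_sum_def sum_distrib_left by (rule sum.swap)
  also have "\<dots> = (\<Sum>v\<in>young_group n r. ?B)"
  proof (rule sum.cong[OF refl])
    fix v assume v: "v \<in> young_group n r"
    have vp: "v permutes {1..n}" using v by (simp add: young_group_def)
    have "compatible (tabloid l T) M = compatible (tabloid l T) (matching_act v M)" for M
      using compatible_act[OF permutes_inj[OF vp], of "tabloid l T" M] by (simp add: tab[OF v])
    then show "(\<Sum>M\<in>matchings n d. of_bool (compatible (tabloid l T) M) * ?P (matching_act v M)) = ?B"
      using sum_matching_act[OF vp, of "\<lambda>M. of_bool (compatible (tabloid l T) M) * ?P M" d] by simp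
  qed
  also have "\<dots> = int (card (young_group n r)) * ?B" by simp
  also have "\<dots> > 0"
  proof -
    have "young_group n r \<noteq> {}" using id_in_young_group[of n r] by blast
    then have "card (young_group n r) > 0" by (simp add: card_gt_0_iff)
    then have "int (card (young_group n r)) > 0" by linarith
    then show ?thesis using pairing_with_tabloid_pos[OF shp] by (rule mult_pos_pos)
  qed
  finally have "(\<Sum>M\<in>matchings n d. of_bool (compatible (tabloid l T) M) * row_sum n r ?P M) \<noteq> 0" by simp
  then obtain M where M: "M \<in> matchings n d" "of_bool (compatible (tabloid l T) M) * row_sum n r ?P M \<noteq> 0"
    by (rule sum.not_neutral_contains_not_neutral)
  have sub: "M \<subseteq> pairs n" using M by (simp add: matchings_def)
  have "row_matched r M"
    unfolding row_matched_def
  proof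
    fix S assume S: "S \<in> M"
    have "compatible (tabloid l T) M" using M(2) by (auto split: if_splits)
    then obtain i where "i > 0" "\<forall>a\<in>S. row_of l T a = i"
      using S unfolding compatible_tabloid_iff[OF sub] by blast
    moreover have "S \<subseteq> {1..n}" using S matching_vertices[OF M(1)] by auto
    ultimately show "\<exists>i>0. \<forall>a\<in>S. r a = i" using rows by (metis subsetD)
  qed
  then show ?thesis using M by (intro that) auto
qed

text \<open>
  The values \<open>g M = \<phi> x\<^sub>M\<close> of a linear functional \<open>\<phi>\<close> that kills the ideal and all matching polytabloids
  have these two properties.
\<close>

definition polytabloid_orthogonal :: "nat \<Rightarrow> nat \<Rightarrow> (nat set set \<Rightarrow> complex) \<Rightarrow> bool" where
  "polytabloid_orthogonal n d g \<longleftrightarrow> exchange_relation n d g \<and>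
     (\<forall>l T. l \<in> even_tail_shapes n d \<longrightarrow> T \<in> tableaux l \<longrightarrow>
        (\<Sum>M\<in>matchings n d. g M * of_int (matching_polytabloid l T M)) = 0)"

lemma polytabloid_orthogonal_act:
  assumes g: "polytabloid_orthogonal n d g" and u: "u permutes {1..n}"
  shows "polytabloid_orthogonal n d (\<lambda>M. g (matching_act u M))"
  unfolding polytabloid_orthogonal_def
proof (intro conjI allI impI)
  show "exchange_relation n d (\<lambda>M. g (matching_act u M))"
    using g by (intro exchange_relation_act u) (simp add: polytabloid_orthogonal_def)
  fix l T assume l: "l \<in> even_tail_shapes n d" "T \<in> tableaux l"
  interpret tableau n l T using l by unfold_locales (auto simp: even_tail_shapes_def)
  interpret uT: tableau n l "u \<circ> T" by (rule permuted_tableau[OF u])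
  have "(\<Sum>M\<in>matchings n d. g (matching_act u M) * of_int (matching_polytabloid l T M)) =
     (\<Sum>M\<in>matchings n d. g (matching_act u M) * of_int (matching_polytabloid l (u \<circ> T) (matching_act u M)))"
    by (simp add: equivariant[OF u])
  also have "\<dots> = (\<Sum>M\<in>matchings n d. g M * of_int (matching_polytabloid l (u \<circ> T) M))"
    by (rule sum_matching_act[OF u])
  also have "\<dots> = 0" using g l(1) uT.filling by (auto simp: polytabloid_orthogonal_def)
  finally show "(\<Sum>M\<in>matchings n d. g (matching_act u M) * of_int (matching_polytabloid l T M)) = 0" .
qed

lemma polytabloid_orthogonal_row_sum:
  assumes "polytabloid_orthogonal n d g"
  shows "polytabloid_orthogonal n d (row_sum n r g)"
proof -
  have s: "polytabloid_orthogonal n d (\<lambda>M. g (matching_act v M))" if "v \<in> young_group n r" for v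
    using polytabloid_orthogonal_act[OF assms] that by (simp add: young_group_def)
  have "(\<Sum>M\<in>matchings n d. row_sum n r g M * of_int (matching_polytabloid l T M)) = 0"
    if "l \<in> even_tail_shapes n d" "T \<in> tableaux l" for l T
  proof -
    have "(\<Sum>M\<in>matchings n d. row_sum n r g M * of_int (matching_polytabloid l T M)) =
      (\<Sum>v\<in>young_group n r. \<Sum>M\<in>matchings n d. g (matching_act v M) * of_int (matching_polytabloid l T M))"
      unfolding row_sum_def sum_distrib_right by (rule sum.swap)
    also have "\<dots> = 0" using s that by (intro sum.neutral) (auto simp: polytabloid_orthogonal_def)
    finally show ?thesis .
  qed
  then show ?thesis
    using exchange_relation_row_sum assms by (auto simp: polytabloid_orthogonal_def)
qed

lemma sum_swap_rows_less:
  fixes i j n :: nat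
  assumes "i < j" "card {a \<in> {1..n}. r a = i} < card {a \<in> {1..n}. r a = j}"
  shows "(\<Sum>a\<in>{1..n}. swap i j (r a)) < (\<Sum>a\<in>{1..n}. r a)"
proof -
  let ?A = "\<lambda>i. {a \<in> {1..n}. r a = i}" and ?B = "{a \<in> {1..n}. r a \<noteq> i \<and> r a \<noteq> j}"
  have split: "(\<Sum>a\<in>{1..n}. f (r a)) = card (?A i) * f i + card (?A j) * f j + (\<Sum>a\<in>?B. f (r a))" for f :: "nat \<Rightarrow> nat"
  proof -
    have "{1..n} = ?A i \<union> ?A j \<union> ?B" by auto
    then have "(\<Sum>a\<in>{1..n}. f (r a)) = (\<Sum>a\<in>?A i \<union> ?A j \<union> ?B. f (r a))" by simp
    also have "\<dots> = (\<Sum>a\<in>?A i \<union> ?A j. f (r a)) + (\<Sum>a\<in>?B. f (r a))"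
      by (rule sum.union_disjoint) auto
    also have "(\<Sum>a\<in>?A i \<union> ?A j. f (r a)) = (\<Sum>a\<in>?A i. f (r a)) + (\<Sum>a\<in>?A j. f (r a))"
      by (rule sum.union_disjoint) (use assms(1) in auto)
    finally show ?thesis by simp
  qed
  have B: "(\<Sum>a\<in>?B. swap i j (r a)) = (\<Sum>a\<in>?B. r a)"
    by (intro sum.cong) auto
  have "x * j + y * i < x * i + y * j" if "x < y" for x y :: nat
  proof -
    obtain m where m: "y = x + m" "m > 0" using \<open>x < y\<close> less_imp_add_positive by metis
    obtain k where k: "j = i + k" "k > 0" using assms(1) less_imp_add_positive by metis
    show ?thesis using m(2) k(2) unfolding m(1) k(1) by (simp add: algebra_simps)
  qed
  from this[OF assms(2)]
  have "card (?A i) * j + card (?A j) * i < card (?A i) * i + card (?A j) * j" .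
  then show ?thesis
    using split[of "swap i j"] split[of "\<lambda>x. x"] B by simp
qed

lemma sum_raise_less:
  fixes n :: nat and r :: "nat \<Rightarrow> nat"
  assumes "b \<in> {1..n}" "i < r b"
  shows "(\<Sum>a\<in>{1..n}. (r(b := i)) a) < (\<Sum>a\<in>{1..n}. r a)"
  by (rule sum_strict_mono_ex1) (use assms in auto)

text \<open>
  Induction on the sum of the row indices. If a row is shorter than a later one, exchanging their indices
  lowers this sum and keeps the Young subgroup. Otherwise the symmetrised function is a highest weight
  function, since the raising relations are symmetrisations over row functions with a smaller sum. It
  vanishes unless the row sizes form a shape of degree \<open>d\<close>. For such a shape it is a multiple of the
  symmetrised matching polytabloid \<open>w\<close> of a tableau with these rows, because both are determined by one
  value. As it is also orthogonal to \<open>w\<close>, and \<open>w\<close> is a nonzero integral vector, the multiple is zero.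
\<close>

lemma row_sum_of_orthogonal_vanishes:
  assumes n: "n > 0" and "polytabloid_orthogonal n d g" "M \<in> matchings n d"
  shows "row_sum n r g M = 0"
  using assms(2,3)
proof (induction "\<Sum>a\<in>{1..n}. r a" arbitrary: r g M rule: less_induct)
  case less
  show ?case
  proof (cases "\<exists>i j. i < j \<and> card {a \<in> {1..n}. r a = i} < card {a \<in> {1..n}. r a = j}")
    case True
    then obtain i j where ij: "i < j" "card {a \<in> {1..n}. r a = i} < card {a \<in> {1..n}. r a = j}" by blast
    let ?r = "\<lambda>a. swap i j (r a)"
    have "inj (swap i j)" by simp
    then have "young_group n ?r = young_group n r"
      by (simp add: young_group_def inj_eq)
    moreover have "row_sum n ?r g M = 0"
      by (rule less.hyps[OF sum_swap_rows_less[OF ij] less.prems])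
    ultimately show ?thesis by (simp add: row_sum_def)
  next
    case False
    define G where "G = row_sum n r g"
    have sep: "polytabloid_orthogonal n d G" unfolding G_def by (rule polytabloid_orthogonal_row_sum[OF less.prems(1)])
    have inv: "G (matching_act u N) = G N" if "u \<in> young_group n r" for u N
      using row_sum_invariant[OF that] by (simp add: G_def)
    have raise: "G N + (\<Sum>c\<in>{c \<in> {1..n}. r c = i}. G (matching_act (swap b c) N)) = 0"
      if b: "b \<in> {1..n}" "i < r b" and N: "N \<in> matchings n d" for b i N
    proof -
      have "(\<Sum>v\<in>young_group n (r(b := i)). G (matching_act v N)) = 0"
        using less.hyps[OF sum_raise_less[where r = r and b = b and i = i, OF b] sep N] by (simp add: row_sum_def fun_upd_def)
      then show ?thesis
        using raising_from_row_sum[where g = G and n = n and r = r and b = b and i = i and M = N] inv b by blast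
    qed
    then have hw: "highest_weight n d r G"
      using sep inv by unfold_locales (auto simp: polytabloid_orthogonal_def)
    interpret highest_weight n d r G by (rule hw)
    have "G M = 0"
    proof (cases "card {a \<in> {1..n}. r a = 0} + 2 * d = n \<and> (\<forall>i>0. even (card {a \<in> {1..n}. r a = i}))")
      case False
      then show ?thesis
        using vanishes_unless_first_row vanishes_unless_even_rows less.prems(2) by blast
    next
      case shp: True
      have "card {a \<in> {1..n}. r a = j} \<le> card {a \<in> {1..n}. r a = i}" if "i < j" for i j
        using False that by (meson not_le)
      then obtain l T where lT: "tableau n l T" "l \<noteq> []" "\<And>a. a \<in> {1..n} \<Longrightarrow> row_of l T a = r a"
        "\<And>i. i < length l \<Longrightarrow> l ! i = card {a \<in> {1..n}. r a = i}"
        by (rule tableau_of_rows[OF n]) blast+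
      interpret tableau n l T by (rule lT(1))
      have l: "l \<in> even_tail_shapes n d"
        using shape shp lT(2,4) by (auto simp: even_tail_shapes_def)
      define w where "w = row_sum n r (matching_polytabloid l T)"
      interpret w: highest_weight n d r "\<lambda>M. of_int (w M)"
        unfolding w_def by (rule highest_weight_row_sum[OF l lT(3)])
      obtain N where N: "N \<in> matchings n d" "row_matched r N" "w N \<noteq> 0"
        unfolding w_def by (rule row_sum_nonzero[OF l lT(3)])
      (* The multiple of w that agrees with G at N. *)
      define c where "c = G N / of_int (w N)"
      interpret h: highest_weight n d r "\<lambda>M. G M - c * of_int (w M)"
      proof
        show "exchange_relation n d (\<lambda>M. G M - c * of_int (w M))"
          by (rule exchange_relation_diff[OF highest_weight.exchange[OF hw] w.exchange])
        show "G (matching_act u M) - c * of_int (w (matching_act u M)) = G M - c * of_int (w M)"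
          if "u \<in> young_group n r" for u M
          using invariant[OF that] w.invariant[OF that] by simp
        fix b i M assume b: "b \<in> {1..n}" "i < r b" "M \<in> matchings n d"
        show "G M - c * of_int (w M) + (\<Sum>x\<in>{x \<in> {1..n}. r x = i}.
            G (matching_act (swap b x) M) - c * of_int (w (matching_act (swap b x) M))) = 0"
        proof -
          let ?A = "{x \<in> {1..n}. r x = i}" and ?t = "\<lambda>x. matching_act (swap b x) M"
          have "G M - c * of_int (w M) + (\<Sum>x\<in>?A. G (?t x) - c * of_int (w (?t x))) =
              (G M + (\<Sum>x\<in>?A. G (?t x))) - c * (of_int (w M) + (\<Sum>x\<in>?A. of_int (w (?t x))))"
            by (simp add: sum_subtractf sum_distrib_left algebra_simps)
          also have "\<dots> = 0" unfolding raising[OF b] w.raising[OF b] by simp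
          finally show ?thesis .
        qed
      qed
      have Gw: "G M' = c * of_int (w M')" if M': "M' \<in> matchings n d" for M'
      proof -
        have "G K - c * of_int (w K) = 0" if K: "K \<in> matchings n d" "row_matched r K" for K
        proof (rule ccontr)
          assume nz: "G K - c * of_int (w K) \<noteq> 0"
          have KU: "\<Union>K = {a \<in> {1..n}. r a \<noteq> 0}" by (rule h.row_matched_covers[OF K nz])
          have NU: "\<Union>N = {a \<in> {1..n}. r a \<noteq> 0}" by (rule w.row_matched_covers[OF N(1,2)]) (use N(3) in simp)
          have "G K - c * of_int (w K) = G N - c * of_int (w N)"
            by (rule h.constant_on_row_matched[OF K N(1,2)]) (simp add: KU NU)
          then show False using nz N(3) by (simp add: c_def)
        qed
        from h.determined_by_row_matched[OF this M'] show ?thesis by simp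
      qed
      have orth: "(\<Sum>M\<in>matchings n d. G M * of_int (w M)) = 0"
      proof -
        have "(\<Sum>M\<in>matchings n d. G M * of_int (w M)) =
          (\<Sum>v\<in>young_group n r. \<Sum>M\<in>matchings n d. G M * of_int (matching_polytabloid l T (matching_act v M)))"
          unfolding w_def row_sum_def of_int_sum sum_distrib_left by (rule sum.swap)
        also have "\<dots> = (\<Sum>v\<in>young_group n r. 0)"
        proof (rule sum.cong[OF refl])
          fix v assume "v \<in> young_group n r"
          then have vp: "v permutes {1..n}" by (simp add: young_group_def)
          have ivp: "inv' v permutes {1..n}" by (rule permutes_inv[OF vp])
          interpret vT: tableau n l "inv' v \<circ> T" by (rule permuted_tableau[OF ivp])
          have "matching_polytabloid l T (matching_act v M) = matching_polytabloid l (inv' v \<circ> T) M" for M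
            using equivariant[OF ivp, of "matching_act v M"] by (simp add: matching_act_inv[OF vp])
          then show "(\<Sum>M\<in>matchings n d. G M * of_int (matching_polytabloid l T (matching_act v M))) = 0"
            using sep l vT.filling by (simp add: polytabloid_orthogonal_def)
        qed
        finally show ?thesis by simp
      qed
      have "(\<Sum>M\<in>matchings n d. G M * of_int (w M)) = c * of_int (\<Sum>M\<in>matchings n d. w M * w M)"
        by (simp add: Gw sum_distrib_left mult.assoc)
      moreover have "(\<Sum>M\<in>matchings n d. w M * w M) > 0"
        by (rule sum_pos2[OF _ N(1)]) (use N(3) in \<open>auto simp: zero_less_mult_iff linorder_neq_iff\<close>)
      ultimately have "c = 0" using orth by (metis less_irrefl mult_eq_0_iff of_int_eq_0_iff)
      then show ?thesis using Gw[OF less.prems(2)] by simp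
    qed
    then show ?thesis by (simp add: G_def)
  qed
qed

text \<open>
  The case of distinct rows, where the Young subgroup is trivial.
\<close>

theorem polytabloid_orthogonal_vanishes:
  assumes "n > 0" "polytabloid_orthogonal n d g" "M \<in> matchings n d"
  shows "g M = 0"
proof -
  have "young_group n id = {id}"
  proof (intro equalityI subsetI)
    fix v assume "v \<in> young_group n id"
    then have "v a = a" for a
      using permutes_not_in[of v "{1..n}" a] by (cases "a \<in> {1..n}") (auto simp: young_group_def)
    then show "v \<in> {id}" by auto
  qed simp
  then show ?thesis using row_sum_of_orthogonal_vanishes[OF assms, of id] by (simp add: row_sum_def)
qed

section \<open>Linear extensions\<close>

lemma poly_mapping_add_induct [case_names zero single add]:
  fixes p :: "'a \<Rightarrow>\<^sub>0 'b::comm_monoid_add"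
  assumes "P 0" "\<And>t a. P (single t a)" "\<And>p q. P p \<Longrightarrow> P q \<Longrightarrow> P (p + q)"
  shows "P p"
proof -
  have eq: "p = (\<Sum>t\<in>keys p. single t (lookup p t))"
    by (rule poly_mapping_eqI) (auto simp: lookup_sum lookup_single when_def in_keys_iff sum.delta)
  have "P (\<Sum>t\<in>A. single t (lookup p t))" if "finite A" for A
    using that by induction (auto intro: assms)
  then show ?thesis using eq finite_keys by metis
qed

text \<open>
  The actions on tabloids, monomials and polynomials and the map from tabloids to polynomials are all defined by
  sums of this form.
\<close>

lemma linear_extension_add:
  fixes h :: "'a \<Rightarrow> 'b::comm_monoid_add \<Rightarrow> 'c::comm_monoid_add"
  assumes h0: "\<And>t. h t 0 = 0" and hadd: "\<And>t a b. h t (a + b) = h t a + h t b"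
  shows "(\<Sum>t\<in>keys (p + q). h t (lookup (p + q) t)) =
    (\<Sum>t\<in>keys p. h t (lookup p t)) +
    (\<Sum>t\<in>keys q. h t (lookup q t))"
proof -
  let ?K = "keys p \<union> keys q"
  have *: "(\<Sum>t\<in>keys r. h t (lookup r t)) = (\<Sum>t\<in>?K. h t (lookup r t))"
    if "keys r \<subseteq> ?K" for r
    using that by (intro sum.mono_neutral_left) (auto simp: in_keys_iff h0)
  show ?thesis
    unfolding *[OF keys_add] *[OF Un_upper1] *[OF Un_upper2] by (simp add: lookup_add hadd sum.distrib)
qed

section \<open>The polynomial ring\<close>

lemma poly_ring_simps [simp]:
  "mult (poly_ring n) = (*)" "one (poly_ring n) = 1" "zero (poly_ring n) = 0" "add (poly_ring n) = (+)"
  by (simp_all add: poly_ring_def)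

lemma poly_ring_carrier: "p \<in> carrier (poly_ring n) \<longleftrightarrow> (\<forall>m\<in>keys p. keys m \<subseteq> pairs n)"
  by (simp add: poly_ring_def)

lemma carrier_add: "p \<in> carrier (poly_ring n) \<Longrightarrow> q \<in> carrier (poly_ring n) \<Longrightarrow> p + q \<in> carrier (poly_ring n)"
  using keys_add[of p q] by (auto simp: poly_ring_carrier)

lemma carrier_mult:
  assumes "p \<in> carrier (poly_ring n)" "q \<in> carrier (poly_ring n)"
  shows "p * q \<in> carrier (poly_ring n)"
  unfolding poly_ring_carrier
proof
  fix m assume "m \<in> keys (p * q)"
  then obtain a b where "m = a + b" "a \<in> keys p" "b \<in> keys q" using keys_mult[of p q] by blast
  then show "keys m \<subseteq> pairs n" using assms keys_add[of a b] by (fastforce simp: poly_ring_carrier)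
qed

lemma carrier_single [simp]: "keys m \<subseteq> pairs n \<Longrightarrow> single m c \<in> carrier (poly_ring n)"
  by (simp add: poly_ring_carrier)

lemma carrier_uminus: "p \<in> carrier (poly_ring n) \<Longrightarrow> - p \<in> carrier (poly_ring n)"
  by (simp add: poly_ring_carrier in_keys_iff)

lemma carrier_zero [simp]: "0 \<in> carrier (poly_ring n)"
  by (simp add: poly_ring_carrier)

lemma carrier_one [simp]: "1 \<in> carrier (poly_ring n)"
  by (simp add: poly_ring_carrier)

lemma carrier_Const [simp]: "Const c \<in> carrier (poly_ring n)"
  by (simp add: Const_def)

lemma carrier_X [simp]: "S \<in> pairs n \<Longrightarrow> X S \<in> carrier (poly_ring n)"
  by (simp add: X_def)

lemma carrier_sum: "(\<And>i. i \<in> A \<Longrightarrow> f i \<in> carrier (poly_ring n)) \<Longrightarrow> sum f A \<in> carrier (poly_ring n)"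
  by (induction A rule: infinite_finite_induct) (auto intro: carrier_add)

lemma cring_poly_ring: "cring (poly_ring n)"
proof (rule cringI)
  show "abelian_group (poly_ring n)"
  proof (rule abelian_groupI)
    fix x assume "x \<in> carrier (poly_ring n)"
    then show "\<exists>y\<in>carrier (poly_ring n). y \<oplus>\<^bsub>poly_ring n\<^esub> x = \<zero>\<^bsub>poly_ring n\<^esub>"
      by (intro bexI[of _ "- x"]) (auto intro: carrier_uminus)
  qed (auto intro: carrier_add simp: add_ac)
  show "comm_monoid (poly_ring n)"
    by (rule comm_monoidI) (auto intro: carrier_mult simp: mult_ac)
qed (simp add: distrib_right)

lemma poly_ring_idealI:
  assumes "J \<subseteq> carrier (poly_ring n)" "0 \<in> J" "\<And>p q. p \<in> J \<Longrightarrow> q \<in> J \<Longrightarrow> p + q \<in> J"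
    "\<And>p q. p \<in> J \<Longrightarrow> q \<in> carrier (poly_ring n) \<Longrightarrow> p * q \<in> J"
  shows "ideal J (poly_ring n)"
proof (rule idealI)
  interpret cring "poly_ring n" by (rule cring_poly_ring)
  show "ring (poly_ring n)" by (rule ring_axioms)
  show "subgroup J (add_monoid (poly_ring n))"
  proof (rule group.subgroupI)
    show "group (add_monoid (poly_ring n))" using a_group .
    show "inv\<^bsub>add_monoid (poly_ring n)\<^esub> p \<in> J" if "p \<in> J" for p
    proof -
      have p: "p \<in> carrier (poly_ring n)" using that assms(1) by blast
      have "\<ominus>\<^bsub>poly_ring n\<^esub> p = - p"
        by (rule minus_equality) (auto simp: p carrier_uminus)
      moreover have "p * Const (- 1) \<in> J" using assms(4)[OF that] by simp
      moreover have "Const (- 1) = - 1" by (simp add: Const_def single_uminus)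
      ultimately show ?thesis by (simp add: a_inv_def)
    qed
  qed (use assms in auto)
  show "q \<otimes>\<^bsub>poly_ring n\<^esub> p \<in> J" if "p \<in> J" "q \<in> carrier (poly_ring n)" for p q
    using assms(4)[OF that] by (simp add: mult.commute)
qed (use assms in auto)

definition generators :: "nat \<Rightarrow> pair_poly set" where
  "generators n = {\<Sum>j\<in>{1..n} - {i}. X {i, j} | i. i \<in> {1..n}} \<union>
      {X S * X T | S T. S \<in> pairs n \<and> T \<in> pairs n \<and> S \<inter> T \<noteq> {}}"

lemma I_ideal_eq: "I_ideal n = Idl\<^bsub>poly_ring n\<^esub> (generators n)"
  by (simp add: I_ideal_def generators_def)

lemma generators_carrier: "generators n \<subseteq> carrier (poly_ring n)"
  unfolding generators_def by (auto intro!: carrier_sum carrier_mult carrier_X pair_mem)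

lemma ideal_I: "ideal (I_ideal n) (poly_ring n)"
  unfolding I_ideal_eq
  by (rule ring.genideal_ideal[OF cring.axioms(1)[OF cring_poly_ring] generators_carrier])

lemma generators_in_I: "g \<in> generators n \<Longrightarrow> g \<in> I_ideal n"
  unfolding I_ideal_eq
  using ring.genideal_self[OF cring.axioms(1)[OF cring_poly_ring] generators_carrier] by blast

lemma I_minimal:
  assumes "ideal J (poly_ring n)" "generators n \<subseteq> J"
  shows "I_ideal n \<subseteq> J"
  unfolding I_ideal_eq
  by (rule ring.genideal_minimal[OF cring.axioms(1)[OF cring_poly_ring] assms])

lemma I_zero [simp]: "0 \<in> I_ideal n"
  using additive_subgroup.zero_closed[OF ideal.axioms(1)[OF ideal_I]] by simp

lemma I_add: "p \<in> I_ideal n \<Longrightarrow> q \<in> I_ideal n \<Longrightarrow> p + q \<in> I_ideal n"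
  using additive_subgroup.a_closed[OF ideal.axioms(1)[OF ideal_I]] by simp

lemma I_mult: "p \<in> I_ideal n \<Longrightarrow> q \<in> carrier (poly_ring n) \<Longrightarrow> p * q \<in> I_ideal n"
  using ideal.I_r_closed[OF ideal_I] by simp

lemma I_mult_left: "p \<in> I_ideal n \<Longrightarrow> q \<in> carrier (poly_ring n) \<Longrightarrow> q * p \<in> I_ideal n"
  using I_mult by (simp add: mult.commute)

lemma I_uminus: "p \<in> I_ideal n \<Longrightarrow> - p \<in> I_ideal n"
  using I_mult[of p n "- 1"] by (simp add: carrier_uminus)

lemma I_diff: "p \<in> I_ideal n \<Longrightarrow> q \<in> I_ideal n \<Longrightarrow> p - q \<in> I_ideal n"
  using I_add[of p n "- q"] I_uminus by simp

lemma I_sum: "(\<And>i. i \<in> A \<Longrightarrow> f i \<in> I_ideal n) \<Longrightarrow> sum f A \<in> I_ideal n"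
  by (induction A rule: infinite_finite_induct) (auto intro: I_add)

section \<open>Matching monomials\<close>

definition matching_monomial :: "nat set set \<Rightarrow> (nat set \<Rightarrow>\<^sub>0 nat)" where
  "matching_monomial M = (\<Sum>S\<in>M. single S 1)"

lemma lookup_matching_monomial:
  "finite M \<Longrightarrow> lookup (matching_monomial M) S = (if S \<in> M then 1 else 0)"
  by (auto simp: matching_monomial_def lookup_sum lookup_single when_def sum.delta)

lemma keys_matching_monomial: "finite M \<Longrightarrow> keys (matching_monomial M) = M"
  by (auto simp: in_keys_iff lookup_matching_monomial split: if_splits)

lemma matching_monomial_inj:
  "finite M \<Longrightarrow> finite N \<Longrightarrow> matching_monomial M = matching_monomial N \<longleftrightarrow> M = N"
  using keys_matching_monomial by metis

lemma matching_monomial_insert: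
  "finite M \<Longrightarrow> S \<notin> M \<Longrightarrow> matching_monomial (insert S M) = single S 1 + matching_monomial M"
  by (simp add: matching_monomial_def)

lemma inj_on_matching_monomial: "inj_on matching_monomial (matchings n d)"
  using matching_monomial_inj matching_finite by (meson inj_onI)

definition matching_poly :: "nat \<Rightarrow> nat \<Rightarrow> (nat set set \<Rightarrow> complex) \<Rightarrow> pair_poly" where
  "matching_poly n d f = (\<Sum>M\<in>matchings n d. single (matching_monomial M) (f M))"

text \<open>
  Pairing with \<open>f\<close>, extended by 0 from the matchings with \<open>d\<close> edges to a linear functional on all polynomials,
  so that it can be tested on the ideal.
\<close>

definition matching_pairing :: "nat \<Rightarrow> nat \<Rightarrow> (nat set set \<Rightarrow> complex) \<Rightarrow> pair_poly \<Rightarrow> complex" where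
  "matching_pairing n d f p = (\<Sum>M\<in>matchings n d. f M * lookup p (matching_monomial M))"

lemma matching_monomial_carrier:
  "M \<in> matchings n d \<Longrightarrow> keys (matching_monomial M) \<subseteq> pairs n"
  by (simp add: keys_matching_monomial matching_finite) (simp add: matchings_def)

lemma matching_poly_carrier: "matching_poly n d f \<in> carrier (poly_ring n)"
  unfolding matching_poly_def by (intro carrier_sum carrier_single matching_monomial_carrier)

lemma matching_pairing_add: "matching_pairing n d f (p + q) = matching_pairing n d f p + matching_pairing n d f q"
  by (simp add: matching_pairing_def lookup_add algebra_simps sum.distrib)

lemma matching_pairing_zero [simp]: "matching_pairing n d f 0 = 0"
  by (simp add: matching_pairing_def)

lemma matching_pairing_sum: "matching_pairing n d f (sum g A) = (\<Sum>i\<in>A. matching_pairing n d f (g i))"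
  by (induction A rule: infinite_finite_induct) (auto simp: matching_pairing_add)

lemma matching_pairing_single:
  "matching_pairing n d f (single m c) =
     (\<Sum>M\<in>matchings n d. if matching_monomial M = m then f M * c else 0)"
  unfolding matching_pairing_def by (intro sum.cong) (auto simp: lookup_single when_def)

lemma matching_pairing_matching_poly:
  "matching_pairing n d f (matching_poly n d g) = (\<Sum>M\<in>matchings n d. f M * g M)"
proof -
  have "matching_pairing n d f (single (matching_monomial M) c) = f M * c" if "M \<in> matchings n d" for M c
  proof -
    have "(\<Sum>N\<in>matchings n d. if matching_monomial N = matching_monomial M then f N * c else 0) =
       (\<Sum>N\<in>matchings n d. if N = M then f N * c else 0)"
      using inj_on_matching_monomial that by (intro sum.cong) (auto dest: inj_onD)
    then show ?thesis using that by (simp add: matching_pairing_single sum.delta)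
  qed
  then show ?thesis by (simp add: matching_poly_def matching_pairing_sum)
qed

lemma X_times_single: "X S * single m c = single (single S 1 + m) c"
  by (simp add: X_def mult_single)

lemma matching_monomial_not_square:
  assumes "M \<in> matchings n d" "S \<inter> S' \<noteq> {}"
  shows "matching_monomial M \<noteq> single S 1 + (single S' 1 + m)"
proof
  assume eq: "matching_monomial M = single S 1 + (single S' 1 + m)"
  have fin: "finite M" by (rule matching_finite[OF assms(1)])
  have l: "(if U \<in> M then 1 else 0) = (1 when S = U) + ((1 when S' = U) + lookup m U)" for U
    using arg_cong[OF eq, of "\<lambda>m. lookup m U"] lookup_matching_monomial[OF fin, of U]
    by (simp add: lookup_add lookup_single)
  have "S \<in> M" using l[of S] by (auto split: if_splits)
  moreover have "S' \<in> M" using l[of S'] by (auto split: if_splits)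
  moreover have "S \<noteq> S'" using l[of S] by (auto split: if_splits)
  ultimately show False using assms by (auto simp: matchings_def pairwise_def disjnt_def)
qed

lemma star_monomial:
  assumes R: "R \<in> matchings n e" and i: "i \<in> {1..n}" "i \<notin> \<Union>R" and j: "j \<in> {1..n} - {i}" and N: "N \<in> matchings n (Suc e)"
  shows "matching_monomial N = single {i, j} 1 + matching_monomial R \<longleftrightarrow> j \<notin> \<Union>R \<and> N = insert {i, j} R"
proof
  assume eq: "matching_monomial N = single {i, j} 1 + matching_monomial R"
  have fin: "finite N" "finite R" using N R matching_finite by auto
  have nR: "{i, j} \<notin> R" using i by auto
  then have "matching_monomial N = matching_monomial (insert {i, j} R)"
    using eq fin by (simp add: matching_monomial_insert)
  then have N_eq: "N = insert {i, j} R" using fin by (simp add: matching_monomial_inj)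
  have "j \<notin> \<Union>R"
  proof
    assume "j \<in> \<Union>R"
    then obtain S where S: "S \<in> R" "j \<in> S" by blast
    then have "S = {i, j}" using matching_edge_eqI[OF N, of S "{i, j}" j] N_eq by auto
    then show False using S nR by simp
  qed
  then show "j \<notin> \<Union>R \<and> N = insert {i, j} R" using N_eq by simp
next
  assume a: "j \<notin> \<Union>R \<and> N = insert {i, j} R"
  have "{i, j} \<notin> R" using i by auto
  then show "matching_monomial N = single {i, j} 1 + matching_monomial R"
    using a matching_finite[OF R] by (simp add: matching_monomial_insert)
qed

text \<open>
  The product of \<open>\<Sum>j. x\<^bsub>{i,j}\<^esub>\<close> with a monomial has matching monomials of degree \<open>d\<close> only if the monomial comes from a
  matching \<open>R\<close> with one edge less that misses \<open>i\<close>; the pairing is then an instance of the exchange relation.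
\<close>

lemma matching_pairing_star:
  assumes ex: "exchange_relation n d f" and i: "i \<in> {1..n}"
  shows "matching_pairing n d f ((\<Sum>j\<in>{1..n} - {i}. X {i, j}) * single m c) = 0"
proof -
  let ?h = "\<lambda>j. single {i, j} 1 + m"
  have eq: "matching_pairing n d f ((\<Sum>j\<in>{1..n} - {i}. X {i, j}) * single m c) =
    (\<Sum>j\<in>{1..n} - {i}. \<Sum>M\<in>matchings n d. if matching_monomial M = ?h j then f M * c else 0)"
    by (simp add: sum_distrib_right X_times_single matching_pairing_sum matching_pairing_single)
  show ?thesis
  proof (cases "\<exists>j\<in>{1..n} - {i}. \<exists>M\<in>matchings n d. matching_monomial M = ?h j")
    case False
    then show ?thesis unfolding eq by (intro sum.neutral ballI) auto
  next
    case True
    then obtain j0 N where j0: "j0 \<in> {1..n} - {i}" and N: "N \<in> matchings n d" and eqN: "matching_monomial N = ?h j0" by blast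
    have finN: "finite N" by (rule matching_finite[OF N])
    have "lookup (matching_monomial N) {i, j0} \<noteq> 0" unfolding eqN by (simp add: lookup_add)
    then have mem: "{i, j0} \<in> N" using lookup_matching_monomial[OF finN, of "{i, j0}"] by (auto split: if_splits)
    obtain e where e: "d = Suc e" "N - {{i, j0}} \<in> matchings n e" "\<Union>(N - {{i, j0}}) = \<Union>N - {i, j0}"
      by (rule matching_remove_edge[OF N mem])
    define R where "R = N - {{i, j0}}"
    have R: "R \<in> matchings n e" "i \<notin> \<Union>R" using e by (auto simp: R_def)
    have "matching_monomial N = single {i, j0} 1 + matching_monomial R"
      using matching_monomial_insert[of R "{i, j0}"] mem finN by (simp add: R_def insert_absorb)
    then have m: "m = matching_monomial R" using eqN by simp
    have "(\<Sum>M\<in>matchings n d. if matching_monomial M = ?h j then f M * c else 0) =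
       (if j \<notin> \<Union>R then f (insert {i, j} R) * c else 0)" if j: "j \<in> {1..n} - {i}" for j
    proof -
      have "(\<Sum>M\<in>matchings n d. if matching_monomial M = ?h j then f M * c else 0) =
         (\<Sum>M\<in>matchings n d. if M = insert {i, j} R then (if j \<notin> \<Union>R then f M * c else 0) else 0)"
        by (intro sum.cong refl) (use star_monomial[OF R(1) i R(2) j] e(1) m in auto)
      also have "\<dots> = (if j \<notin> \<Union>R then f (insert {i, j} R) * c else 0)"
        using matching_insert_edge[OF R(1) i, of j] R(2) j e(1) by (auto simp: sum.delta)
      finally show ?thesis .
    qed
    then have "matching_pairing n d f ((\<Sum>j\<in>{1..n} - {i}. X {i, j}) * single m c) =
       (\<Sum>j\<in>{1..n} - {i}. if j \<notin> \<Union>R then f (insert {i, j} R) * c else 0)"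
      unfolding eq by (intro sum.cong refl) auto
    also have "\<dots> = (\<Sum>j\<in>{j \<in> {1..n} - {i}. j \<notin> \<Union>R}. f (insert {i, j} R) * c)"
      by (rule sum.inter_filter[symmetric]) simp
    also have "{j \<in> {1..n} - {i}. j \<notin> \<Union>R} = {1..n} - \<Union>R - {i}" by auto
    also have "(\<Sum>j\<in>{1..n} - \<Union>R - {i}. f (insert {i, j} R) * c) = 0"
      using exchange_relationD[OF ex e(1) R(1) i R(2)] by (simp add: sum_distrib_right[symmetric])
    finally show ?thesis .
  qed
qed

text \<open>
  The polynomials all of whose multiples are killed form an ideal, so it is enough to treat the products of
  generators with monomials.
\<close>

theorem matching_pairing_I:
  assumes ex: "exchange_relation n d f" and p: "p \<in> I_ideal n"
  shows "matching_pairing n d f p = 0"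
proof -
  let ?J = "{p \<in> carrier (poly_ring n). \<forall>q\<in>carrier (poly_ring n). matching_pairing n d f (p * q) = 0}"
  have "ideal ?J (poly_ring n)"
    by (rule poly_ring_idealI) (auto intro: carrier_add carrier_mult simp: distrib_right matching_pairing_add mult.assoc)
  moreover have "generators n \<subseteq> ?J"
  proof
    fix g assume g: "g \<in> generators n"
    have mono: "matching_pairing n d f (g * single m c) = 0" for m c
    proof -
      from g consider i where "i \<in> {1..n}" "g = (\<Sum>j\<in>{1..n} - {i}. X {i, j})"
        | S T where "g = X S * X T" "S \<inter> T \<noteq> {}"
        by (auto simp: generators_def)
      then show ?thesis
      proof cases
        case 1 then show ?thesis using matching_pairing_star[OF ex] by simp
      next
        case 2
        have "matching_pairing n d f (g * single m c) =
          (\<Sum>M\<in>matchings n d. if matching_monomial M = single S 1 + (single T 1 + m) then f M * c else 0)"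
          by (simp add: 2(1) mult.assoc X_times_single matching_pairing_single)
        also have "\<dots> = 0" using matching_monomial_not_square[OF _ 2(2)] by (intro sum.neutral) auto
        finally show ?thesis .
      qed
    qed
    have "matching_pairing n d f (g * q) = 0" for q
      by (induction q rule: poly_mapping_add_induct) (auto simp: mono distrib_left matching_pairing_add)
    then show "g \<in> ?J" using g generators_carrier by auto
  qed
  ultimately have "p \<in> ?J" using I_minimal p by blast
  then have "\<forall>q\<in>carrier (poly_ring n). matching_pairing n d f (p * q) = 0" by blast
  from bspec[OF this carrier_one] have "matching_pairing n d f (p * 1) = 0" .
  then show ?thesis by simp
qed

section \<open>Reduction to matching monomials\<close>

lemma intersecting_monomial_in_I:
  assumes keys: "keys m \<subseteq> pairs n"
    and S: "S \<in> keys m" "T \<in> keys m" "S \<inter> T \<noteq> {}" "S = T \<longrightarrow> lookup m S \<ge> 2"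
  shows "single m c \<in> I_ideal n"
proof -
  (* The subtraction of exponents is exact: S and T have enough multiplicity in m. *)
  define m' where "m' = m - single S 1 - single T 1"
  have "m = single S 1 + (single T 1 + m')"
    by (rule poly_mapping_eqI)
       (use S in \<open>auto simp: m'_def lookup_add lookup_minus lookup_single when_def in_keys_iff\<close>)
  then have "single m c = X S * X T * single m' c"
    by (simp add: mult.assoc X_times_single)
  moreover have "X S * X T \<in> generators n" unfolding generators_def using S keys by blast
  moreover have "keys m' \<subseteq> pairs n"
    using keys by (auto simp: m'_def in_keys_iff lookup_minus subset_iff)
  ultimately show ?thesis using generators_in_I I_mult by simp
qed

text \<open>
  A squarefree monomial with disjoint variables comes from a matching; any other is divisible by a product of two
  intersecting variables.
\<close>

lemma monomial_cases:
  assumes keys: "keys m \<subseteq> pairs n" and deg: "(\<Sum>S\<in>keys m. lookup m S) = d"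
  shows "single m c \<in> I_ideal n \<or> (\<exists>M\<in>matchings n d. m = matching_monomial M)"
proof (cases "(\<forall>S\<in>keys m. lookup m S = 1) \<and> pairwise disjnt (keys m)")
  case True
  have "card (keys m) = d" using deg True by simp
  then have "keys m \<in> matchings n d" using keys True by (simp add: matchings_def)
  moreover have "m = matching_monomial (keys m)"
    by (rule poly_mapping_eqI) (use True in \<open>auto simp: lookup_matching_monomial in_keys_iff\<close>)
  ultimately show ?thesis by blast
next
  case False
  then consider S where "S \<in> keys m" "lookup m S \<noteq> 1"
    | S T where "S \<in> keys m" "T \<in> keys m" "S \<noteq> T" "\<not> disjnt S T"
    by (auto simp: pairwise_def)
  then show ?thesis
  proof cases
    case 1
    have "S \<noteq> {}" using 1 keys by (auto simp: pairs_def)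
    moreover have "lookup m S \<ge> 2" using 1 by (auto simp: in_keys_iff)
    ultimately show ?thesis using intersecting_monomial_in_I[OF keys 1(1,1)] by simp
  next
    case 2
    then show ?thesis using intersecting_monomial_in_I[OF keys 2(1,2)] by (simp add: disjnt_def)
  qed
qed

lemma star_times_matching:
  assumes R: "R \<in> matchings n e" and i: "i \<in> {1..n}" "i \<notin> \<Union>R"
  shows "(\<Sum>k\<in>{1..n} - \<Union>R - {i}. single (matching_monomial (insert {i, k} R)) 1) \<in> I_ideal n"
proof -
  let ?s = "\<lambda>k. single (single {i, k} 1 + matching_monomial R) (1::complex)"
  let ?A = "{1..n} - \<Union>R - {i}" and ?B = "({1..n} - {i}) \<inter> \<Union>R"
  have finR: "finite R" by (rule matching_finite[OF R])
  have nR: "{i, k} \<notin> R" for k using i by auto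
  have kR: "keys (matching_monomial R) = R" by (rule keys_matching_monomial[OF finR])
  have "(\<Sum>j\<in>{1..n} - {i}. X {i, j}) * single (matching_monomial R) 1 = (\<Sum>k\<in>{1..n} - {i}. ?s k)"
    by (simp add: sum_distrib_right X_times_single)
  moreover have "(\<Sum>j\<in>{1..n} - {i}. X {i, j}) \<in> generators n" using i unfolding generators_def by blast
  ultimately have all: "(\<Sum>k\<in>{1..n} - {i}. ?s k) \<in> I_ideal n"
    using I_mult[OF generators_in_I carrier_single[OF matching_monomial_carrier[OF R]]] by metis
  have "?s k \<in> I_ideal n" if k: "k \<in> ?B" for k
  proof -
    obtain S where S: "S \<in> R" "k \<in> S" using k by blast
    have keys: "keys (single {i, k} 1 + matching_monomial R) \<subseteq> pairs n"
      using keys_add[of "single {i, k} 1" "matching_monomial R"] kR R k i pair_mem[of i n k]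
      by (auto simp: matchings_def)
    have "{i, k} \<in> keys (single {i, k} 1 + matching_monomial R)"
      by (simp add: in_keys_iff lookup_add)
    moreover have "S \<in> keys (single {i, k} 1 + matching_monomial R)"
      using S finR by (simp add: in_keys_iff lookup_add lookup_matching_monomial)
    ultimately show ?thesis
      by (rule intersecting_monomial_in_I[OF keys]) (use S nR in auto)
  qed
  then have B: "(\<Sum>k\<in>?B. ?s k) \<in> I_ideal n" by (rule I_sum)
  have "{1..n} - {i} = ?A \<union> ?B" by auto
  then have "(\<Sum>k\<in>{1..n} - {i}. ?s k) = (\<Sum>k\<in>?A \<union> ?B. ?s k)" by simp
  also have "\<dots> = (\<Sum>k\<in>?A. ?s k) + (\<Sum>k\<in>?B. ?s k)"
    by (rule sum.union_disjoint) auto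
  finally have "(\<Sum>k\<in>?A. ?s k) = (\<Sum>k\<in>{1..n} - {i}. ?s k) - (\<Sum>k\<in>?B. ?s k)" by simp
  then have "(\<Sum>k\<in>?A. ?s k) \<in> I_ideal n" using I_diff[OF all B] by simp
  then show ?thesis using nR finR by (simp add: matching_monomial_insert)
qed

lemma homogeneous_reduction:
  assumes p: "p \<in> carrier (poly_ring n)" "homogeneous d p"
  shows "p - matching_poly n d (\<lambda>M. lookup p (matching_monomial M)) \<in> I_ideal n"
proof -
  let ?Q = "matching_monomial ` matchings n d"
  let ?s = "\<lambda>m. single m (lookup p m)"
  have "p = (\<Sum>m\<in>keys p \<union> ?Q. ?s m)"
    by (rule poly_mapping_eqI) (auto simp: lookup_sum lookup_single when_def in_keys_iff sum.delta)
  also have "keys p \<union> ?Q = (keys p - ?Q) \<union> ?Q" by auto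
  also have "(\<Sum>m\<in>(keys p - ?Q) \<union> ?Q. ?s m) = (\<Sum>m\<in>keys p - ?Q. ?s m) + (\<Sum>m\<in>?Q. ?s m)"
    by (rule sum.union_disjoint) auto
  also have "(\<Sum>m\<in>?Q. ?s m) = matching_poly n d (\<lambda>M. lookup p (matching_monomial M))"
    unfolding matching_poly_def by (subst sum.reindex[OF inj_on_matching_monomial]) simp
  finally have eq: "p - matching_poly n d (\<lambda>M. lookup p (matching_monomial M)) = (\<Sum>m\<in>keys p - ?Q. ?s m)"
    by (simp add: algebra_simps)
  have "?s m \<in> I_ideal n" if m: "m \<in> keys p - ?Q" for m
  proof -
    have "keys m \<subseteq> pairs n" "(\<Sum>S\<in>keys m. lookup m S) = d"
      using p m by (auto simp: poly_ring_carrier homogeneous_def)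
    from monomial_cases[OF this] m show ?thesis by blast
  qed
  then show ?thesis unfolding eq by (intro I_sum)
qed

definition poly_scale :: "complex \<Rightarrow> pair_poly \<Rightarrow> pair_poly" where
  "poly_scale a p = Const a * p"

interpretation poly_vs: vector_space poly_scale
  by unfold_locales
     (simp_all add: poly_scale_def Const_def algebra_simps single_add mult_single mult.assoc[symmetric])

definition polytabloid_polys :: "nat \<Rightarrow> nat \<Rightarrow> pair_poly set" where
  "polytabloid_polys n d = {matching_poly n d (\<lambda>M. of_int (matching_polytabloid l T M)) | l T.
     l \<in> even_tail_shapes n d \<and> T \<in> tableaux l}"

text \<open>
  By duality: otherwise some linear functional vanishes on the ideal and on all matching polytabloids but
  not on \<open>x\<^sub>M\<close>, and its values on matching monomials contradict the vanishing theorem.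
\<close>

lemma matching_monomial_in_span:
  assumes n: "n > 0" and M: "M \<in> matchings n d"
  shows "single (matching_monomial M) 1 \<in> poly_vs.span (I_ideal n \<union> polytabloid_polys n d)"
    (is "?x M \<in> poly_vs.span ?S")
proof (rule ccontr)
  interpret poly_vsp: vector_space_pair poly_scale "(*) :: complex \<Rightarrow> complex \<Rightarrow> complex"
    by unfold_locales (simp_all add: algebra_simps)
  assume notin: "?x M \<notin> poly_vs.span ?S"
  obtain B where B: "B \<subseteq> ?S" "poly_vs.independent B" "?S \<subseteq> poly_vs.span B"
    by (rule poly_vs.maximal_independent_subset)
  have "poly_vs.span B \<subseteq> poly_vs.span ?S" by (rule poly_vs.span_mono[OF B(1)])
  then have xB: "?x M \<notin> poly_vs.span B" using notin by blast
  then have "poly_vs.independent (insert (?x M) B)"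
    using B(2) poly_vs.independent_insertI by blast
  (* A functional that is 1 at the monomial of M and 0 on a basis of the span. *)
  from poly_vsp.linear_independent_extend[OF this, of "\<lambda>b. if b = ?x M then 1 else 0"]
  obtain \<phi> where \<phi>: "Vector_Spaces.linear poly_scale (*) \<phi>"
    "\<And>b. b \<in> insert (?x M) B \<Longrightarrow> \<phi> b = (if b = ?x M then 1 else 0)" by blast
  interpret \<phi>: Vector_Spaces.linear poly_scale "(*) :: complex \<Rightarrow> complex \<Rightarrow> complex" \<phi> by (rule \<phi>(1))
  have "?x M \<notin> B" using xB poly_vs.span_base by blast
  then have B0: "\<phi> b = 0" if "b \<in> B" for b using \<phi>(2)[of b] that by auto
  have zero: "\<phi> p = 0" if "p \<in> ?S" for p
  proof -
    have "p \<in> poly_vs.span B" using that B(3) by blast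
    then show ?thesis
    proof (induction rule: poly_vs.span_induct)
      case base
      show ?case by (auto simp: poly_vs.subspace_def \<phi>.add \<phi>.scale)
    qed (rule B0)
  qed
  define g where "g N = \<phi> (?x N)" for N
  have "polytabloid_orthogonal n d g"
    unfolding polytabloid_orthogonal_def exchange_relation_def
  proof (intro conjI allI impI)
    fix e R i assume d: "d = Suc e" and R: "R \<in> matchings n e" and i: "i \<in> {1..n} - \<Union>R"
    have "(\<Sum>k\<in>{1..n} - \<Union>R - {i}. g (insert {i, k} R)) = \<phi> (\<Sum>k\<in>{1..n} - \<Union>R - {i}. ?x (insert {i, k} R))"
      by (simp add: g_def \<phi>.sum)
    also have "\<dots> = 0" using star_times_matching[OF R, of i] i by (intro zero) auto
    finally show "(\<Sum>k\<in>{1..n} - \<Union>R - {i}. g (insert {i, k} R)) = 0" .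
  next
    fix l T assume l: "l \<in> even_tail_shapes n d" "T \<in> tableaux l"
    have "single m c = poly_scale c (single m 1)" for m c
      by (simp add: poly_scale_def Const_def mult_single)
    then have "(\<Sum>N\<in>matchings n d. g N * of_int (matching_polytabloid l T N)) =
       \<phi> (matching_poly n d (\<lambda>N. of_int (matching_polytabloid l T N)))"
      unfolding matching_poly_def \<phi>.sum
      by (intro sum.cong refl) (metis (no_types) \<phi>.scale g_def mult.commute)
    also have "\<dots> = 0" by (rule zero) (use l in \<open>auto simp: polytabloid_polys_def\<close>)
    finally show "(\<Sum>N\<in>matchings n d. g N * of_int (matching_polytabloid l T N)) = 0" .
  qed
  from polytabloid_orthogonal_vanishes[OF n this M] have "\<phi> (?x M) = 0" by (simp add: g_def)
  then show False using \<phi>(2)[of "?x M"] by simp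
qed

theorem homogeneous_in_span:
  assumes n: "n > 0" and p: "p \<in> carrier (poly_ring n)" "homogeneous d p"
  obtains q where "q \<in> poly_vs.span (polytabloid_polys n d)" "p - q \<in> I_ideal n"
proof -
  let ?S = "I_ideal n \<union> polytabloid_polys n d"
  have sub: "poly_vs.subspace (I_ideal n)"
    by (auto simp: poly_vs.subspace_def poly_scale_def intro: I_add I_mult_left)
  have "matching_poly n d f \<in> poly_vs.span ?S" for f
    unfolding matching_poly_def
  proof (rule poly_vs.span_sum)
    fix M assume "M \<in> matchings n d"
    then have "poly_scale (f M) (single (matching_monomial M) 1) \<in> poly_vs.span ?S"
      by (intro poly_vs.span_scale matching_monomial_in_span[OF n])
    then show "single (matching_monomial M) (f M) \<in> poly_vs.span ?S"
      by (simp add: poly_scale_def Const_def mult_single)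
  qed
  then obtain a q where aq: "a \<in> I_ideal n" "q \<in> poly_vs.span (polytabloid_polys n d)"
    "matching_poly n d (\<lambda>M. lookup p (matching_monomial M)) = a + q"
    using poly_vs.span_Un[of "I_ideal n" "polytabloid_polys n d"] poly_vs.span_eq_iff[of "I_ideal n"] sub by blast
  have "p - q \<in> I_ideal n"
    using I_add[OF homogeneous_reduction[OF p] aq(1)] by (simp add: aq(3))
  with aq(2) show ?thesis by (rule that)
qed

section \<open>The action on polynomials\<close>

definition variable_act :: "(nat \<Rightarrow> nat) \<Rightarrow> (nat set \<Rightarrow>\<^sub>0 nat) \<Rightarrow> (nat set \<Rightarrow>\<^sub>0 nat)" where
  "variable_act w m = (\<Sum>S\<in>keys m. single (w ` S) (lookup m S))"

lemma variable_act_zero [simp]: "variable_act w 0 = 0"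
  by (simp add: variable_act_def)

lemma variable_act_add: "variable_act w (m + m') = variable_act w m + variable_act w m'"
  unfolding variable_act_def by (rule linear_extension_add) (auto simp: single_add)

lemma variable_act_single [simp]: "variable_act w (single S k) = single (w ` S) k"
  by (simp add: variable_act_def)

lemma variable_act_sum: "variable_act w (sum f A) = (\<Sum>i\<in>A. variable_act w (f i))"
  by (induction A rule: infinite_finite_induct) (auto simp: variable_act_add)

lemma variable_act_id: "variable_act id m = m"
  by (induction m rule: poly_mapping_add_induct) (simp_all add: variable_act_add)

lemma variable_act_compose: "variable_act (u \<circ> v) m = variable_act u (variable_act v m)"
  by (induction m rule: poly_mapping_add_induct) (auto simp: variable_act_add image_comp)

lemma X_power: "X S ^ k = single (single S k) 1"
  by (induction k) (simp_all add: X_def mult_single single_add[symmetric] plus_1_eq_Suc)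

lemma prod_single:
  "(\<Prod>i\<in>A. single (f i) (1::complex)) = single (\<Sum>i\<in>A. f i) 1"
  by (induction A rule: infinite_finite_induct) (auto simp: mult_single)

lemma poly_act_alt:
  "poly_act w p = (\<Sum>m\<in>keys p. single (variable_act w m) (lookup p m))"
  unfolding poly_act_def X_power prod_single variable_act_def by (simp add: Const_def mult_single)

lemma poly_act_zero [simp]: "poly_act w 0 = 0"
  by (simp add: poly_act_alt)

lemma poly_act_add: "poly_act w (p + q) = poly_act w p + poly_act w q"
  unfolding poly_act_alt by (rule linear_extension_add) (auto simp: single_add)

lemma poly_act_single [simp]: "poly_act w (single m c) = single (variable_act w m) c"
  by (simp add: poly_act_alt)

lemma poly_act_sum: "poly_act w (sum f A) = (\<Sum>i\<in>A. poly_act w (f i))"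
  by (induction A rule: infinite_finite_induct) (auto simp: poly_act_add)

lemma poly_act_mult: "poly_act w (p * q) = poly_act w p * poly_act w q"
proof (induction p rule: poly_mapping_add_induct)
  case (single m c)
  show ?case
    by (induction q rule: poly_mapping_add_induct) (auto simp: mult_single variable_act_add poly_act_add distrib_left)
qed (auto simp: poly_act_add distrib_right)

lemma poly_act_id: "poly_act id p = p"
  by (induction p rule: poly_mapping_add_induct) (simp_all only: poly_act_zero poly_act_add poly_act_single variable_act_id)

lemma poly_act_compose: "poly_act (u \<circ> v) p = poly_act u (poly_act v p)"
  by (induction p rule: poly_mapping_add_induct) (simp_all only: poly_act_zero poly_act_add poly_act_single variable_act_compose)

lemma poly_act_Const [simp]: "poly_act w (Const a) = Const a"
  by (simp add: Const_def)

lemma poly_act_X [simp]: "poly_act w (X S) = X (w ` S)"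
  by (simp add: X_def)

lemma variable_act_keys:
  assumes "w permutes {1..n}" "keys m \<subseteq> pairs n"
  shows "keys (variable_act w m) \<subseteq> pairs n"
proof
  fix U assume "U \<in> keys (variable_act w m)"
  then have "(\<Sum>S\<in>keys m. (lookup m S when w ` S = U)) \<noteq> 0"
    by (simp add: in_keys_iff variable_act_def lookup_sum lookup_single)
  then obtain S where "S \<in> keys m" "(lookup m S when w ` S = U) \<noteq> 0"
    by (rule sum.not_neutral_contains_not_neutral)
  then have "S \<in> keys m" "w ` S = U" by (simp_all add: when_def split: if_splits)
  then show "U \<in> pairs n" using assms pairs_image by blast
qed

lemma poly_act_carrier:
  assumes "w permutes {1..n}" "p \<in> carrier (poly_ring n)"
  shows "poly_act w p \<in> carrier (poly_ring n)"
  unfolding poly_act_alt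
  by (intro carrier_sum carrier_single variable_act_keys[OF assms(1)])
     (use assms(2) in \<open>auto simp: poly_ring_carrier\<close>)

text \<open>
  The preimage of the ideal is an ideal that contains the generators.
\<close>

lemma poly_act_I:
  assumes w: "w permutes {1..n}" and p: "p \<in> I_ideal n"
  shows "poly_act w p \<in> I_ideal n"
proof -
  let ?J = "{p \<in> carrier (poly_ring n). poly_act w p \<in> I_ideal n}"
  have "ideal ?J (poly_ring n)"
    by (rule poly_ring_idealI)
       (auto intro: carrier_add carrier_mult I_add I_mult poly_act_carrier[OF w] simp: poly_act_add poly_act_mult)
  moreover have "generators n \<subseteq> ?J"
  proof
    fix g assume g: "g \<in> generators n"
    from g consider i where "i \<in> {1..n}" "g = (\<Sum>j\<in>{1..n} - {i}. X {i, j})"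
      | S T where "g = X S * X T" "S \<in> pairs n" "T \<in> pairs n" "S \<inter> T \<noteq> {}"
      unfolding generators_def by blast
    then have "poly_act w g \<in> generators n"
    proof cases
      case 1
      have "poly_act w g = (\<Sum>j\<in>{1..n} - {i}. X {w i, w j})" by (simp add: 1 poly_act_sum)
      also have "\<dots> = (\<Sum>j\<in>w ` ({1..n} - {i}). X {w i, j})"
        by (subst sum.reindex) (use permutes_inj_on[OF w] in auto)
      also have "w ` ({1..n} - {i}) = {1..n} - {w i}"
        using permutes_image[OF w] permutes_inj[OF w] by (simp add: image_set_diff)
      finally show ?thesis using 1(1) permutes_in_image[OF w, of i] unfolding generators_def by blast
    next
      case 2
      then have "w ` S \<in> pairs n" "w ` T \<in> pairs n" "w ` S \<inter> w ` T \<noteq> {}"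
        using pairs_image[OF w] by auto
      moreover have "poly_act w g = X (w ` S) * X (w ` T)" by (simp add: 2 poly_act_mult)
      ultimately show ?thesis unfolding generators_def by blast
    qed
    then show "g \<in> ?J" using g generators_carrier generators_in_I by blast
  qed
  ultimately show ?thesis using I_minimal p by blast
qed

lemma poly_act_matching_poly:
  assumes w: "w permutes {1..n}"
  shows "poly_act w (matching_poly n d (\<lambda>M. f (matching_act w M))) = matching_poly n d f"
proof -
  have "variable_act w (matching_monomial M) = matching_monomial (matching_act w M)" for M
  proof -
    have "inj_on ((`) w) M" using permutes_inj[OF w] by (auto simp: inj_on_def inj_image_eq_iff)
    then show ?thesis
      by (simp add: matching_monomial_def matching_act_def variable_act_sum sum.reindex)
  qed
  then show ?thesis
    using sum_matching_act[OF w, of "\<lambda>M. single (matching_monomial M) (f M)" d]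
    by (simp add: matching_poly_def poly_act_sum)
qed

lemma variable_act_degree:
  assumes w: "inj w"
  shows "(\<Sum>S\<in>keys (variable_act w m). lookup (variable_act w m) S) =
    (\<Sum>S\<in>keys m. lookup m S)"
proof (induction m rule: poly_mapping_add_induct)
  case (add p q)
  then show ?case
    by (simp add: variable_act_add linear_extension_add[where h = "\<lambda>t c. c"])
qed auto

lemma poly_act_homogeneous:
  assumes w: "inj w" and p: "homogeneous d p"
  shows "homogeneous d (poly_act w p)"
  unfolding homogeneous_def
proof
  fix m assume "m \<in> keys (poly_act w p)"
  then have "(\<Sum>m'\<in>keys p. (lookup p m' when variable_act w m' = m)) \<noteq> 0"
    by (simp add: in_keys_iff poly_act_alt lookup_sum lookup_single)
  then obtain m' where "m' \<in> keys p" "(lookup p m' when variable_act w m' = m) \<noteq> 0"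
    by (rule sum.not_neutral_contains_not_neutral)
  then have "m' \<in> keys p" "variable_act w m' = m" by (simp_all add: when_def split: if_splits)
  then show "(\<Sum>S\<in>keys m. lookup m S) = d"
    using variable_act_degree[OF w, of m'] p by (simp add: homogeneous_def)
qed

lemma homogeneous_zero [simp]: "homogeneous d 0"
  by (simp add: homogeneous_def)

lemma homogeneous_add: "homogeneous d p \<Longrightarrow> homogeneous d q \<Longrightarrow> homogeneous d (p + q)"
  using keys_add[of p q] unfolding homogeneous_def by blast

lemma homogeneous_uminus: "homogeneous d p \<Longrightarrow> homogeneous d (- p)"
  by (simp add: homogeneous_def in_keys_iff)

lemma homogeneous_sum: "(\<And>i. i \<in> A \<Longrightarrow> homogeneous d (f i)) \<Longrightarrow> homogeneous d (sum f A)"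
  by (induction A rule: infinite_finite_induct) (auto intro: homogeneous_add)

lemma homogeneous_Const_mult:
  assumes "homogeneous d p"
  shows "homogeneous d (Const a * p)"
  unfolding homogeneous_def
proof
  fix m assume "m \<in> keys (Const a * p)"
  then obtain b c where "m = b + c" "b \<in> keys (Const a)" "c \<in> keys p"
    using keys_mult[of "Const a" p] by blast
  then have "m \<in> keys p" by (simp add: Const_def split: if_splits)
  then show "(\<Sum>S\<in>keys m. lookup m S) = d" using assms by (simp add: homogeneous_def)
qed

lemma homogeneous_matching_poly: "homogeneous d (matching_poly n d f)"
  unfolding matching_poly_def
proof (rule homogeneous_sum)
  fix M assume M: "M \<in> matchings n d"
  then have "finite M" "card M = d" using matching_finite[OF M] by (simp_all add: matchings_def)
  then show "homogeneous d (single (matching_monomial M) (f M))"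
    by (simp add: homogeneous_def keys_matching_monomial lookup_matching_monomial)
qed

section \<open>The components of the quotient\<close>

abbreviation coset :: "nat \<Rightarrow> pair_poly \<Rightarrow> pair_poly set" where
  "coset n p \<equiv> I_ideal n +>\<^bsub>poly_ring n\<^esub> p"

lemma coset_eq: "coset n p = (\<lambda>i. i + p) ` I_ideal n"
  by (auto simp: a_r_coset_def r_coset_def)

lemma coset_eq_iff: "coset n p = coset n q \<longleftrightarrow> p - q \<in> I_ideal n"
proof
  assume "coset n p = coset n q"
  moreover have "p \<in> coset n p" unfolding coset_eq by (rule image_eqI[of _ _ 0]) auto
  ultimately have "p \<in> (\<lambda>i. i + q) ` I_ideal n" unfolding coset_eq by simp
  then obtain i where "i \<in> I_ideal n" "p = i + q" by blast
  then show "p - q \<in> I_ideal n" by simp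
next
  assume pq: "p - q \<in> I_ideal n"
  show "coset n p = coset n q"
  proof (intro equalityI subsetI)
    fix x assume "x \<in> coset n p"
    then obtain i where "i \<in> I_ideal n" "x = i + p" unfolding coset_eq by blast
    then show "x \<in> coset n q" unfolding coset_eq using I_add[OF _ pq]
      by (intro image_eqI[of _ _ "i + (p - q)"]) auto
  next
    fix x assume "x \<in> coset n q"
    then obtain i where "i \<in> I_ideal n" "x = i + q" unfolding coset_eq by blast
    then show "x \<in> coset n p" unfolding coset_eq using I_diff[OF _ pq]
      by (intro image_eqI[of _ _ "i - (p - q)"]) auto
  qed
qed

lemma quotient_component_carrier:
  "carrier (quotient_component n d) = {coset n p | p. p \<in> carrier (poly_ring n) \<and> homogeneous d p}"
  by (simp add: quotient_component_def Let_def)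

lemma quotient_component_add:
  assumes "p \<in> carrier (poly_ring n)" "q \<in> carrier (poly_ring n)"
  shows "coset n p \<oplus>\<^bsub>quotient_component n d\<^esub> coset n q = coset n (p + q)"
  using ideal.a_rcos_sum[OF ideal_I assms] by (simp add: quotient_component_def Let_def FactRing_def)

lemma quotient_component_zero: "\<zero>\<^bsub>quotient_component n d\<^esub> = coset n 0"
  by (simp add: quotient_component_def Let_def FactRing_def coset_eq)

lemma quotient_component_smult:
  assumes "p \<in> carrier (poly_ring n)"
  shows "a \<odot>\<^bsub>quotient_component n d\<^esub> coset n p = coset n (Const a * p)"
  using ideal.rcoset_mult_add[OF ideal_I carrier_Const assms] by (simp add: quotient_component_def Let_def FactRing_def)

lemma quotient_component_act:
  assumes w: "w permutes {1..n}"
  shows "act (quotient_component n d) w (coset n p) = coset n (poly_act w p)"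
proof -
  have "poly_act w ` coset n p = coset n (poly_act w p)"
  proof (intro equalityI subsetI)
    fix x assume "x \<in> poly_act w ` coset n p"
    then show "x \<in> coset n (poly_act w p)"
      using poly_act_I[OF w] by (auto simp: coset_eq poly_act_add)
  next
    fix x assume "x \<in> coset n (poly_act w p)"
    then obtain i where i: "i \<in> I_ideal n" "x = i + poly_act w p" unfolding coset_eq by blast
    let ?j = "poly_act (inv' w) i"
    have "?j \<in> I_ideal n" by (rule poly_act_I[OF permutes_inv[OF w] i(1)])
    moreover have "x = poly_act w (?j + p)"
      by (simp add: i(2) poly_act_add poly_act_compose[symmetric] permutes_inv_o[OF w] poly_act_id)
    ultimately show "x \<in> poly_act w ` coset n p" unfolding coset_eq by blast
  qed
  then show ?thesis by (simp add: quotient_component_def Let_def)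
qed

lemma cring_complex_field: "cring complex_field"
proof (rule cringI)
  show "abelian_group complex_field"
    by (rule abelian_groupI) (auto simp: complex_field_def add_ac intro: exI[of _ "- x" for x])
  show "comm_monoid complex_field"
    by (rule comm_monoidI) (auto simp: complex_field_def)
qed (auto simp: complex_field_def distrib_right)

lemma Const_add: "Const (a + b) = Const a + Const b"
  by (simp add: Const_def single_add)

lemma Const_mult: "Const (a * b) = Const a * Const b"
  by (simp add: Const_def mult_single)

lemma Const_one [simp]: "Const 1 = 1"
  by (simp add: Const_def)

lemma Const_zero [simp]: "Const 0 = 0"
  by (simp add: Const_def)

lemma sym_module_quotient_component: "sym_module n (quotient_component n d)"
proof -
  let ?V = "quotient_component n d" and ?R = "poly_ring n"
  let ?H = "\<lambda>p. p \<in> carrier ?R \<and> homogeneous d p"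
  have V: "\<exists>p. x = coset n p \<and> ?H p" if "x \<in> carrier ?V" for x
    using that by (auto simp: quotient_component_carrier)
  have mem: "coset n p \<in> carrier ?V" if "?H p" for p
    using that by (auto simp: quotient_component_carrier)
  note ops = quotient_component_add quotient_component_zero quotient_component_smult
  have H_add: "?H (p + q)" if "?H p" "?H q" for p q
    using that by (auto intro: carrier_add homogeneous_add)
  have H_scale: "?H (Const a * p)" if "?H p" for a p
    using that by (auto intro: carrier_mult homogeneous_Const_mult)
  have H_act: "?H (poly_act w p)" if "?H p" "w permutes {1..n}" for w p
    using that by (auto intro: poly_act_carrier poly_act_homogeneous permutes_inj)
  have "abelian_group ?V"
  proof (rule abelian_groupI)
    fix x y z assume "x \<in> carrier ?V" "y \<in> carrier ?V" "z \<in> carrier ?V"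
    then obtain p q r where e: "x = coset n p" "y = coset n q" "z = coset n r" "?H p" "?H q" "?H r"
      using V by metis
    show "x \<oplus>\<^bsub>?V\<^esub> y \<in> carrier ?V" using e H_add by (simp add: ops mem)
    show "x \<oplus>\<^bsub>?V\<^esub> y \<oplus>\<^bsub>?V\<^esub> z = x \<oplus>\<^bsub>?V\<^esub> (y \<oplus>\<^bsub>?V\<^esub> z)" using e H_add by (simp add: ops add_ac)
    show "x \<oplus>\<^bsub>?V\<^esub> y = y \<oplus>\<^bsub>?V\<^esub> x" using e by (simp add: ops add_ac)
    show "\<zero>\<^bsub>?V\<^esub> \<oplus>\<^bsub>?V\<^esub> x = x" using e by (simp add: ops)
    show "\<exists>y\<in>carrier ?V. y \<oplus>\<^bsub>?V\<^esub> x = \<zero>\<^bsub>?V\<^esub>"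
    proof (rule bexI[of _ "coset n (- p)"])
      have "?H (- p)" using e by (auto intro: carrier_uminus homogeneous_uminus)
      then show "coset n (- p) \<in> carrier ?V" "coset n (- p) \<oplus>\<^bsub>?V\<^esub> x = \<zero>\<^bsub>?V\<^esub>"
        using e by (simp_all add: ops mem)
    qed
  qed (auto simp: quotient_component_zero intro!: mem)
  moreover have "module_axioms complex_field ?V"
  proof
    fix a b x y assume "x \<in> carrier ?V" "y \<in> carrier ?V"
    then obtain p q where e: "x = coset n p" "y = coset n q" "?H p" "?H q" using V by metis
    show "a \<odot>\<^bsub>?V\<^esub> x \<in> carrier ?V" using e H_scale by (simp add: ops mem)
    show "(a \<oplus>\<^bsub>complex_field\<^esub> b) \<odot>\<^bsub>?V\<^esub> x = a \<odot>\<^bsub>?V\<^esub> x \<oplus>\<^bsub>?V\<^esub> b \<odot>\<^bsub>?V\<^esub> x"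
      using e H_scale by (simp add: ops complex_field_def Const_add distrib_right)
    show "a \<odot>\<^bsub>?V\<^esub> (x \<oplus>\<^bsub>?V\<^esub> y) = a \<odot>\<^bsub>?V\<^esub> x \<oplus>\<^bsub>?V\<^esub> a \<odot>\<^bsub>?V\<^esub> y"
      using e H_scale H_add by (simp add: ops distrib_left)
    show "(a \<otimes>\<^bsub>complex_field\<^esub> b) \<odot>\<^bsub>?V\<^esub> x = a \<odot>\<^bsub>?V\<^esub> (b \<odot>\<^bsub>?V\<^esub> x)"
      using e H_scale by (simp add: ops complex_field_def Const_mult mult.assoc)
    show "\<one>\<^bsub>complex_field\<^esub> \<odot>\<^bsub>?V\<^esub> x = x"
      using e by (simp add: ops complex_field_def)
  qed
  ultimately have "Module.module complex_field ?V"
    by (intro Module.module.intro cring_complex_field)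
  moreover have "sym_module_axioms n ?V"
  proof (rule sym_module_axioms.intro)
    fix w x y a assume "x \<in> carrier ?V" and w': "w \<in> carrier (sym_group n)"
    then obtain p where e: "x = coset n p" "?H p" using V by metis
    have w: "w permutes {1..n}" using w' by (simp add: sym_group_carrier)
    note a = quotient_component_act[OF w]
    show "act ?V w x \<in> carrier ?V" using e H_act[OF _ w] by (simp add: a mem)
    show "act ?V w (a \<odot>\<^bsub>?V\<^esub> x) = a \<odot>\<^bsub>?V\<^esub> act ?V w x"
      using e H_act[OF _ w] by (simp add: a ops poly_act_mult)
    { assume "y \<in> carrier ?V"
      then obtain q where e': "y = coset n q" "?H q" using V by metis
      show "act ?V w (x \<oplus>\<^bsub>?V\<^esub> y) = act ?V w x \<oplus>\<^bsub>?V\<^esub> act ?V w y"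
        using e e' H_act[OF _ w] by (simp add: a ops poly_act_add) }
    { fix u assume u': "u \<in> carrier (sym_group n)"
      then have u: "u permutes {1..n}" by (simp add: sym_group_carrier)
      show "act ?V (w \<otimes>\<^bsub>sym_group n\<^esub> u) x = act ?V w (act ?V u x)"
        unfolding sym_group_mult e(1) a quotient_component_act[OF u]
          quotient_component_act[OF permutes_compose[OF u w]] poly_act_compose .. }
  next
    fix x assume "x \<in> carrier ?V"
    then obtain p where e: "x = coset n p" using V by metis
    show "act ?V \<one>\<^bsub>sym_group n\<^esub> x = x"
      using quotient_component_act[OF permutes_id] by (simp add: e sym_group_one poly_act_id)
  qed
  ultimately show ?thesis by (rule sym_module.intro)
qed

section \<open>From tabloids to polynomials\<close>

lemma lookup_tabloid_scale [simp]:
  "lookup (tabloid_scale a v) t = a * lookup v t"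
  by (simp add: tabloid_scale_def Poly_Mapping.map.rep_eq when_def)

interpretation tabloid_vs: vector_space tabloid_scale
  by unfold_locales (auto intro!: poly_mapping_eqI simp: lookup_add algebra_simps)

lemma tabloid_scale_single [simp]: "tabloid_scale a (single t b) = single t (a * b)"
  by (rule poly_mapping_eqI) (simp add: lookup_single when_def)

definition tabloid_poly :: "nat \<Rightarrow> nat \<Rightarrow> nat set list \<Rightarrow> pair_poly" where
  "tabloid_poly n d t = matching_poly n d (\<lambda>M. of_bool (compatible t M))"

definition tabloids_to_poly :: "nat \<Rightarrow> nat \<Rightarrow> (nat set list \<Rightarrow>\<^sub>0 complex) \<Rightarrow> pair_poly" where
  "tabloids_to_poly n d v = (\<Sum>t\<in>keys v. Const (lookup v t) * tabloid_poly n d t)"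

lemma tabloids_to_poly_zero [simp]: "tabloids_to_poly n d 0 = 0"
  by (simp add: tabloids_to_poly_def)

lemma tabloids_to_poly_single [simp]: "tabloids_to_poly n d (single t c) = Const c * tabloid_poly n d t"
  by (simp add: tabloids_to_poly_def)

lemma tabloids_to_poly_add: "tabloids_to_poly n d (u + v) = tabloids_to_poly n d u + tabloids_to_poly n d v"
  unfolding tabloids_to_poly_def by (rule linear_extension_add) (auto simp: Const_add distrib_right)

lemma tabloids_to_poly_scale: "tabloids_to_poly n d (tabloid_scale a v) = Const a * tabloids_to_poly n d v"
  by (induction v rule: poly_mapping_add_induct)
     (simp_all add: tabloids_to_poly_add tabloid_vs.scale_right_distrib distrib_left Const_mult mult.assoc)

lemma tabloids_to_poly_sum: "tabloids_to_poly n d (sum f A) = (\<Sum>i\<in>A. tabloids_to_poly n d (f i))"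
  by (induction A rule: infinite_finite_induct) (auto simp: tabloids_to_poly_add)

lemma matching_poly_add: "matching_poly n d f + matching_poly n d g = matching_poly n d (\<lambda>M. f M + g M)"
  by (simp add: matching_poly_def single_add sum.distrib)

lemma Const_mult_matching_poly: "Const a * matching_poly n d f = matching_poly n d (\<lambda>M. a * f M)"
  by (simp add: matching_poly_def Const_def sum_distrib_left mult_single)

lemma matching_poly_zero: "matching_poly n d (\<lambda>M. 0) = 0"
  by (simp add: matching_poly_def)

lemma matching_poly_sum: "(\<Sum>i\<in>A. matching_poly n d (f i)) = matching_poly n d (\<lambda>M. \<Sum>i\<in>A. f i M)"
  by (induction A rule: infinite_finite_induct) (auto simp: matching_poly_zero matching_poly_add)

lemma tabloids_to_poly_alt:
  "tabloids_to_poly n d v = matching_poly n d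
     (\<lambda>M. \<Sum>t\<in>keys v. lookup v t * of_bool (compatible t M))"
  by (simp add: tabloids_to_poly_def tabloid_poly_def Const_mult_matching_poly matching_poly_sum)

lemma tabloids_to_poly_carrier: "tabloids_to_poly n d v \<in> carrier (poly_ring n)"
  by (simp add: tabloids_to_poly_alt matching_poly_carrier)

lemma tabloids_to_poly_homogeneous: "homogeneous d (tabloids_to_poly n d v)"
  by (simp add: tabloids_to_poly_alt homogeneous_matching_poly)

lemma tabloids_to_poly_polytabloid:
  "tabloids_to_poly n d (polytabloid l T) = matching_poly n d (\<lambda>M. of_int (matching_polytabloid l T M))"
  by (simp add: polytabloid_def tabloids_to_poly_sum tabloid_poly_def Const_mult_matching_poly
      matching_poly_sum matching_polytabloid_def)

lemma tabloid_act_zero [simp]: "tabloid_act w 0 = 0"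
  by (simp add: tabloid_act_def)

lemma tabloid_act_single [simp]: "tabloid_act w (single t c) = single (map ((`) w) t) c"
  by (simp add: tabloid_act_def)

lemma tabloid_act_add: "tabloid_act w (u + v) = tabloid_act w u + tabloid_act w v"
  unfolding tabloid_act_def by (rule linear_extension_add) (auto simp: single_add)

lemma tabloid_act_sum: "tabloid_act w (sum f A) = (\<Sum>i\<in>A. tabloid_act w (f i))"
  by (induction A rule: infinite_finite_induct) (auto simp: tabloid_act_add)

lemma tabloid_act_scale: "tabloid_act w (tabloid_scale a v) = tabloid_scale a (tabloid_act w v)"
  by (induction v rule: poly_mapping_add_induct)
     (simp_all add: tabloid_act_add tabloid_vs.scale_right_distrib)

lemma (in tableau) tabloid_act_polytabloid:
  assumes w: "w permutes {1..n}"
  shows "tabloid_act w (polytabloid l T) = polytabloid l (w \<circ> T)"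
proof -
  have "w \<circ> s \<circ> inv' w \<circ> (w \<circ> T) = w \<circ> (s \<circ> T)" for s
    by (simp add: fun_eq_iff permutes_inverses[OF w])
  then have "polytabloid l (w \<circ> T) = (\<Sum>s\<in>column_stabilizer l T.
      single (map ((`) w) (tabloid l (s \<circ> T))) (of_int (sign (w \<circ> s \<circ> inv' w))))"
    by (simp add: polytabloid_def sum_column_stabilizer_permuted[OF w] tabloid_permuted[of l w])
  also have "\<dots> = (\<Sum>s\<in>column_stabilizer l T.
      single (map ((`) w) (tabloid l (s \<circ> T))) (of_int (sign s)))"
    by (intro sum.cong refl) (simp add: sign_conj[OF w] column_stabilizer_iff)
  finally show ?thesis by (simp add: polytabloid_def tabloid_act_sum)
qed

lemma tabloids_to_poly_act:
  assumes w: "w permutes {1..n}"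
  shows "tabloids_to_poly n d (tabloid_act w v) = poly_act w (tabloids_to_poly n d v)"
proof (induction v rule: poly_mapping_add_induct)
  case (single t c)
  have "tabloid_poly n d (map ((`) w) t) = poly_act w (tabloid_poly n d t)"
    using poly_act_matching_poly[OF w, where d = d and f = "\<lambda>M. of_bool (compatible (map ((`) w) t) M)"]
    by (simp add: tabloid_poly_def compatible_act permutes_inj[OF w])
  then show ?case by (simp add: poly_act_mult)
qed (simp_all add: tabloid_act_add tabloids_to_poly_add poly_act_add)

lemma specht_carrier: "carrier (specht l) = tabloid_vs.span (polytabloid l ` tableaux l)"
  by (simp add: specht_def)

lemma specht_act_closed:
  assumes l: "l \<in> partitions n" and w: "w permutes {1..n}" and v: "v \<in> carrier (specht l)"
  shows "tabloid_act w v \<in> carrier (specht l)"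
  using v unfolding specht_carrier
proof (induction rule: tabloid_vs.span_induct)
  case base
  show ?case
    by (auto simp: tabloid_vs.subspace_def tabloid_act_add tabloid_act_scale
        intro: tabloid_vs.span_zero tabloid_vs.span_add tabloid_vs.span_scale)
next
  case (step x)
  then obtain T where T: "T \<in> tableaux l" "x = polytabloid l T" by blast
  interpret tableau n l T using l T by unfold_locales
  interpret wT: tableau n l "w \<circ> T" by (rule permuted_tableau[OF w])
  show ?case unfolding T(2) tabloid_act_polytabloid[OF w]
    by (rule tabloid_vs.span_base) (use wT.filling in auto)
qed

lemma specht_keys:
  assumes l: "l \<in> partitions n" and v: "v \<in> carrier (specht l)"
  shows "keys v \<subseteq> tabloid l ` tableaux l"
  using v unfolding specht_carrier
proof (induction rule: tabloid_vs.span_induct)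
  case base
  show ?case
    by (auto simp: tabloid_vs.subspace_def in_keys_iff lookup_add subset_iff) (metis add_0)
next
  case (step x)
  then obtain T where T: "T \<in> tableaux l" "x = polytabloid l T" by blast
  interpret tableau n l T using l T by unfold_locales
  show ?case
  proof
    fix t assume "t \<in> keys x"
    then have "(\<Sum>s\<in>column_stabilizer l T. of_bool (tabloid l (s \<circ> T) = t) * sign s) \<noteq> 0"
      by (auto simp: T(2) in_keys_iff polytabloid_coefficient simp del: of_int_sum)
    then obtain s where s: "s \<in> column_stabilizer l T" "of_bool (tabloid l (s \<circ> T) = t) * sign s \<noteq> 0"
      by (rule sum.not_neutral_contains_not_neutral)
    have sp: "s permutes {1..n}" using s(1) by (simp add: column_stabilizer_iff)
    have "s \<circ> T \<in> tableaux l" by (rule tableau.filling[OF permuted_tableau[OF sp]])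
    moreover have "t = tabloid l (s \<circ> T)" using s(2) by (auto split: if_splits)
    ultimately show "t \<in> tabloid l ` tableaux l" by blast
  qed
qed

text \<open>
  The bilinear form for which the tabloids are orthonormal.
\<close>

definition tabloid_form :: "(nat set list \<Rightarrow>\<^sub>0 complex) \<Rightarrow> (nat set list \<Rightarrow>\<^sub>0 complex) \<Rightarrow> complex" where
  "tabloid_form v u = (\<Sum>t\<in>keys v. lookup v t * lookup u t)"

definition conjugate :: "(nat set list \<Rightarrow>\<^sub>0 complex) \<Rightarrow> (nat set list \<Rightarrow>\<^sub>0 complex)" where
  "conjugate v = Poly_Mapping.map cnj v"

lemma lookup_conjugate [simp]: "lookup (conjugate v) t = cnj (lookup v t)"
  by (simp add: conjugate_def Poly_Mapping.map.rep_eq when_def)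

lemma conjugate_specht:
  assumes l: "l \<in> partitions n" and v: "v \<in> carrier (specht l)"
  shows "conjugate v \<in> carrier (specht l)"
  using v unfolding specht_carrier
proof (induction rule: tabloid_vs.span_induct)
  case base
  have "conjugate (u + v) = conjugate u + conjugate v" "conjugate (tabloid_scale a v) = tabloid_scale (cnj a) (conjugate v)"
    "conjugate 0 = 0" for u v a
    by (rule poly_mapping_eqI; simp add: lookup_add)+
  then show ?case
    by (auto simp: tabloid_vs.subspace_def intro: tabloid_vs.span_zero tabloid_vs.span_add tabloid_vs.span_scale)
next
  case (step x)
  then obtain T where T: "T \<in> tableaux l" "x = polytabloid l T" by blast
  interpret tableau n l T using l T by unfold_locales
  have "conjugate x = x" unfolding T(2)
    by (rule poly_mapping_eqI) (simp add: polytabloid_coefficient del: of_int_sum)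
  then show ?case using T by (auto intro: tabloid_vs.span_base)
qed

text \<open>
  Polytabloids have integral coefficients, so a Specht module contains the complex conjugate \<open>u\<close> of each of its
  elements \<open>v\<close>; the form of \<open>v\<close> and \<open>u\<close> is the sum of the squared absolute values.
\<close>

lemma specht_nondegenerate:
  assumes l: "l \<in> partitions n" and v: "v \<in> carrier (specht l)"
    and orth: "\<And>T. T \<in> tableaux l \<Longrightarrow> tabloid_form v (polytabloid l T) = 0"
  shows "v = 0"
proof -
  have "tabloid_form v u = 0" if "u \<in> carrier (specht l)" for u
    using that unfolding specht_carrier
  proof (induction rule: tabloid_vs.span_induct)
    case base
    have "tabloid_form v (u + u') = tabloid_form v u + tabloid_form v u'"
      "tabloid_form v (tabloid_scale a u) = a * tabloid_form v u" "tabloid_form v 0 = 0" for u u' a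
      by (simp_all add: tabloid_form_def lookup_add distrib_left sum.distrib sum_distrib_left mult_ac)
    then show ?case by (auto simp: tabloid_vs.subspace_def)
  qed (use orth in auto)
  from this[OF conjugate_specht[OF l v]]
  have "(\<Sum>t\<in>keys v. complex_of_real ((norm (lookup v t))\<^sup>2)) = 0"
    by (simp only: tabloid_form_def lookup_conjugate complex_norm_square)
  then have "(\<Sum>t\<in>keys v. (norm (lookup v t))\<^sup>2) = 0"
    by (simp only: of_real_sum[symmetric] of_real_eq_0_iff)
  then have "\<forall>t\<in>keys v. lookup v t = 0"
    by (subst (asm) sum_nonneg_eq_0_iff) auto
  then have "lookup v t = 0" for t by (cases "t \<in> keys v") (auto simp: in_keys_iff)
  then show ?thesis by (intro poly_mapping_eqI) simp
qed

lemma matching_pairing_tabloids_to_poly: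
  "matching_pairing n d f (tabloids_to_poly n d v) =
     (\<Sum>t\<in>keys v. lookup v t * (\<Sum>M\<in>matchings n d. of_bool (compatible t M) * f M))"
  unfolding tabloids_to_poly_alt matching_pairing_matching_poly sum_distrib_left
  by (subst sum.swap) (simp add: mult_ac)

lemma (in tableau) matching_pairing_same_shape:
  assumes v: "v \<in> carrier (specht l)"
  shows "matching_pairing n d (\<lambda>M. of_int (matching_polytabloid l T M)) (tabloids_to_poly n d v) =
    of_int (\<Sum>M\<in>matchings n d. of_bool (compatible (tabloid l T) M) * matching_polytabloid l T M) *
      tabloid_form v (polytabloid l T)"
  unfolding matching_pairing_tabloids_to_poly tabloid_form_def
    sum_distrib_left[where r = "of_int (\<Sum>M\<in>matchings n d. of_bool (compatible (tabloid l T) M) * matching_polytabloid l T M)"]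
proof (rule sum.cong[OF refl])
  fix t assume "t \<in> keys v"
  then obtain T' where T': "T' \<in> tableaux l" "t = tabloid l T'" using specht_keys[OF shape v] by blast
  have tab: "tableau n l T'" using shape T' by unfold_locales
  have "(\<Sum>M\<in>matchings n d. of_bool (compatible t M) * complex_of_int (matching_polytabloid l T M)) =
     of_int (\<Sum>M\<in>matchings n d. of_bool (compatible t M) * matching_polytabloid l T M)"
    by simp
  also have "\<dots> = of_int (\<Sum>M\<in>matchings n d. of_bool (compatible (tabloid l T) M) * matching_polytabloid l T M) *
      lookup (polytabloid l T) t"
    unfolding T'(2) by (rule tabloid_pairing[OF tab])
  finally show "lookup v t * (\<Sum>M\<in>matchings n d. of_bool (compatible t M) * complex_of_int (matching_polytabloid l T M)) =
     of_int (\<Sum>M\<in>matchings n d. of_bool (compatible (tabloid l T) M) * matching_polytabloid l T M) *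
      (lookup v t * lookup (polytabloid l T) t)" by (simp only: mult_ac)
qed

lemma (in tableau) matching_pairing_other_shape:
  assumes l': "l' \<in> partitions n" "l \<noteq> l'" and v: "v \<in> carrier (specht l')"
  shows "matching_pairing n d (\<lambda>M. of_int (matching_polytabloid l T M)) (tabloids_to_poly n d v) = 0"
  using v unfolding specht_carrier
proof (induction rule: tabloid_vs.span_induct)
  case base
  have "matching_pairing n d f (Const a * tabloids_to_poly n d u) = a * matching_pairing n d f (tabloids_to_poly n d u)" for f a u
    by (simp add: tabloids_to_poly_alt Const_mult_matching_poly matching_pairing_matching_poly sum_distrib_left mult_ac)
  then show ?case
    by (auto simp: tabloid_vs.subspace_def tabloids_to_poly_add tabloids_to_poly_scale matching_pairing_add)
next
  case (step x)
  then obtain T' where T': "T' \<in> tableaux l'" "x = polytabloid l' T'" by blast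
  have tab: "tableau n l' T'" using l' T' by unfold_locales
  have "matching_pairing n d (\<lambda>M. of_int (matching_polytabloid l T M)) (tabloids_to_poly n d x) =
     of_int (\<Sum>M\<in>matchings n d. matching_polytabloid l' T' M * matching_polytabloid l T M)"
    by (simp add: T'(2) tabloids_to_poly_polytabloid matching_pairing_matching_poly mult.commute)
  then show ?case using orthogonal_shapes[OF tab l'(2), of d] by simp
qed

section \<open>The decomposition\<close>

lemma sym_iso_from_inverse:
  assumes bij: "bij_betw f (carrier W) (carrier V)"
    and add: "\<And>x y. x \<in> carrier W \<Longrightarrow> y \<in> carrier W \<Longrightarrow> x \<oplus>\<^bsub>W\<^esub> y \<in> carrier W \<and> f (x \<oplus>\<^bsub>W\<^esub> y) = f x \<oplus>\<^bsub>V\<^esub> f y"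
    and smult: "\<And>a x. x \<in> carrier W \<Longrightarrow> a \<odot>\<^bsub>W\<^esub> x \<in> carrier W \<and> f (a \<odot>\<^bsub>W\<^esub> x) = a \<odot>\<^bsub>V\<^esub> f x"
    and act: "\<And>w x. w \<in> carrier (sym_group n) \<Longrightarrow> x \<in> carrier W \<Longrightarrow> act W w x \<in> carrier W \<and> f (act W w x) = act V w (f x)"
  shows "sym_iso n V W"
proof -
  define g where "g = the_inv_into (carrier W) f"
  have g: "bij_betw g (carrier V) (carrier W)" unfolding g_def by (rule bij_betw_the_inv_into[OF bij])
  have gf: "g (f x) = x" if "x \<in> carrier W" for x
    unfolding g_def using bij that by (simp add: bij_betw_def the_inv_into_f_f)
  have ex: "\<exists>x\<in>carrier W. v = f x" if "v \<in> carrier V" for v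
    using bij that by (auto simp: bij_betw_def)
  show ?thesis
    unfolding sym_iso_def
  proof (intro exI[of _ g] conjI ballI allI g)
    fix u v assume "u \<in> carrier V" "v \<in> carrier V"
    then obtain x y where "x \<in> carrier W" "u = f x" "y \<in> carrier W" "v = f y" using ex by metis
    then show "g (u \<oplus>\<^bsub>V\<^esub> v) = g u \<oplus>\<^bsub>W\<^esub> g v" using add by (metis gf)
  next
    fix a v assume "v \<in> carrier V"
    then obtain y where "y \<in> carrier W" "v = f y" using ex by metis
    then show "g (a \<odot>\<^bsub>V\<^esub> v) = a \<odot>\<^bsub>W\<^esub> g v" using smult by (metis gf)
  next
    fix w v assume "w \<in> carrier (sym_group n)" "v \<in> carrier V"
    moreover from this obtain y where "y \<in> carrier W" "v = f y" using ex by metis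
    ultimately show "g (act V w v) = act W w (g v)" using act by (metis gf)
  qed
qed

lemma finite_partitions: "finite (partitions n)"
proof (rule finite_subset)
  show "partitions n \<subseteq> {l. set l \<subseteq> {..n} \<and> length l \<le> n}"
  proof
    fix l assume l: "l \<in> partitions n"
    have "x \<le> n" if "x \<in> set l" for x using l member_le_sum_list[OF that] by (simp add: partitions_def)
    moreover have "length l \<le> sum_list l"
      using partitions_pos[OF l] sum_list_mono2[of "replicate (length l) 1" l]
      by (simp add: Suc_leI sum_list_replicate One_nat_def)
    ultimately show "l \<in> {l. set l \<subseteq> {..n} \<and> length l \<le> n}" using l by (auto simp: partitions_def)
  qed
  show "finite {l. set l \<subseteq> {..n} \<and> length l \<le> n}"
    by (rule finite_lists_length_le) simp
qed

text \<open>
  The inverse of the isomorphism is \<open>f\<close> followed by the projection to the quotient, where \<open>f\<close> adds up the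
  polynomials of the components. For injectivity, the functional given by the matching polytabloid of a
  tableau \<open>T\<close> of shape \<open>l\<close> kills the ideal and all components except that of \<open>l\<close>, where it is a nonzero
  multiple of the form with the polytabloid of \<open>T\<close>; these forms separate the Specht module. Surjectivity holds
  because the matching polytabloids span every homogeneous component modulo the ideal.
\<close>

theorem quotient_component_decomposition:
  assumes n: "n > 0"
  shows "sym_iso n (quotient_component n d)
    (direct_sum (SIGMA l:partitions n. {..<of_bool (l \<in> even_tail_shapes n d) :: nat}) (\<lambda>(l, k). specht l))"
    (is "sym_iso n ?V (direct_sum ?J ?S)")
proof -
  let ?W = "direct_sum ?J ?S"
  let ?\<Phi> = "tabloids_to_poly n d"
  define f where "f x = (\<Sum>j\<in>?J. ?\<Phi> (x j))" for x :: "nat list \<times> nat \<Rightarrow> (nat set list \<Rightarrow>\<^sub>0 complex)"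
  have finJ: "finite ?J" using finite_partitions by (intro finite_SigmaI) auto
  have J: "j \<in> ?J \<longleftrightarrow> (\<exists>l. j = (l, 0) \<and> l \<in> even_tail_shapes n d)" for j
    by (cases j) (auto simp: even_tail_shapes_def of_bool_def split: if_splits)
  have part: "l \<in> partitions n" if "(l, k) \<in> ?J" for l k using that by auto
  have W: "x \<in> carrier ?W \<longleftrightarrow> x \<in> extensional ?J \<and> (\<forall>j\<in>?J. x j \<in> carrier (specht (fst j)))" for x
    by (auto simp: direct_sum_def PiE_iff case_prod_beta)
  have f_carrier: "f x \<in> carrier (poly_ring n)" "homogeneous d (f x)" for x
    unfolding f_def by (auto intro: carrier_sum homogeneous_sum tabloids_to_poly_carrier tabloids_to_poly_homogeneous)
  have f_add: "f (\<lambda>j\<in>?J. x j + y j) = f x + f y" for x y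
    unfolding f_def by (simp add: tabloids_to_poly_add sum.distrib)
  have f_scale: "f (\<lambda>j\<in>?J. tabloid_scale a (x j)) = Const a * f x" for a x
    unfolding f_def by (simp add: tabloids_to_poly_scale sum_distrib_left)
  have f_act: "f (\<lambda>j\<in>?J. tabloid_act w (x j)) = poly_act w (f x)" if "w permutes {1..n}" for w x
    unfolding f_def by (simp add: tabloids_to_poly_act[OF that] poly_act_sum)
  have W_add: "x \<oplus>\<^bsub>?W\<^esub> y = (\<lambda>j\<in>?J. x j + y j)" for x y
    by (auto simp: direct_sum_def specht_def case_prod_beta)
  have W_scale: "a \<odot>\<^bsub>?W\<^esub> x = (\<lambda>j\<in>?J. tabloid_scale a (x j))" for a x
    by (auto simp: direct_sum_def specht_def case_prod_beta)
  have W_act: "act ?W w x = (\<lambda>j\<in>?J. tabloid_act w (x j))" for w x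
    by (auto simp: direct_sum_def specht_def case_prod_beta)
  have W_add_closed: "(\<lambda>j\<in>?J. x j + y j) \<in> carrier ?W" if "x \<in> carrier ?W" "y \<in> carrier ?W" for x y
    using that unfolding W specht_carrier by (auto intro: tabloid_vs.span_add)
  have W_scale_closed: "(\<lambda>j\<in>?J. tabloid_scale a (x j)) \<in> carrier ?W" if "x \<in> carrier ?W" for a x
    using that unfolding W specht_carrier by (auto intro: tabloid_vs.span_scale)
  have W_act_closed: "(\<lambda>j\<in>?J. tabloid_act w (x j)) \<in> carrier ?W" if "x \<in> carrier ?W" "w permutes {1..n}" for w x
    using that part unfolding W by (auto intro: specht_act_closed)
  have injective: "z j = 0" if z: "z \<in> carrier ?W" and fz: "f z \<in> I_ideal n" and j: "j \<in> ?J" for z j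
  proof -
    obtain l where l: "j = (l, 0)" "l \<in> even_tail_shapes n d" using j J by blast
    have lp: "l \<in> partitions n" using l(2) by (simp add: even_tail_shapes_def)
    have zj: "z j \<in> carrier (specht l)" using z j l(1) unfolding W by force
    have "tabloid_form (z j) (polytabloid l T) = 0" if T: "T \<in> tableaux l" for T
    proof -
      interpret tableau n l T using lp T by unfold_locales
      let ?p = "matching_pairing n d (\<lambda>M. of_int (matching_polytabloid l T M))"
      have "0 = ?p (f z)"
        by (rule matching_pairing_I[OF exchange_relation_of_int[OF exchange[OF l(2)]] fz, symmetric])
      also have "\<dots> = (\<Sum>i\<in>?J. ?p (?\<Phi> (z i)))" by (simp add: f_def matching_pairing_sum)
      also have "\<dots> = (\<Sum>i\<in>{j}. ?p (?\<Phi> (z i)))"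
      proof (rule sum.mono_neutral_right[OF finJ])
        show "{j} \<subseteq> ?J" using j by simp
        show "\<forall>i\<in>?J - {j}. ?p (?\<Phi> (z i)) = 0"
        proof
          fix i assume i: "i \<in> ?J - {j}"
          then obtain l' where l': "i = (l', 0)" "l' \<in> even_tail_shapes n d" using J by blast
          have "z i \<in> carrier (specht l')" using z i l'(1) unfolding W by force
          moreover have "l \<noteq> l'" using i l(1) l'(1) by auto
          moreover have "l' \<in> partitions n" using l'(2) by (simp add: even_tail_shapes_def)
          ultimately show "?p (?\<Phi> (z i)) = 0" by (intro matching_pairing_other_shape)
        qed
      qed
      also have "\<dots> = ?p (?\<Phi> (z j))" by simp
      also have "\<dots> = of_int (\<Sum>M\<in>matchings n d. of_bool (compatible (tabloid l T) M) * matching_polytabloid l T M) *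
         tabloid_form (z j) (polytabloid l T)"
        by (rule matching_pairing_same_shape[OF zj])
      finally have "of_int (\<Sum>M\<in>matchings n d. of_bool (compatible (tabloid l T) M) * matching_polytabloid l T M) *
         tabloid_form (z j) (polytabloid l T) = 0" by simp
      moreover have "(\<Sum>M\<in>matchings n d. of_bool (compatible (tabloid l T) M) * matching_polytabloid l T M) \<noteq> 0"
        using pairing_with_tabloid_pos[OF l(2)] by linarith
      ultimately show ?thesis by (simp only: mult_eq_0_iff of_int_eq_0_iff) blast
    qed
    then show ?thesis by (rule specht_nondegenerate[OF lp zj])
  qed
  have surjective: "\<exists>x\<in>carrier ?W. f x = q" if "q \<in> poly_vs.span (polytabloid_polys n d)" for q
    using that
  proof (induction rule: poly_vs.span_induct)
    case base
    have "(\<lambda>j\<in>?J. 0) \<in> carrier ?W" unfolding W specht_carrier by (auto intro: tabloid_vs.span_zero)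
    moreover have "f (\<lambda>j\<in>?J. 0) = 0" by (simp add: f_def)
    ultimately have "\<exists>x\<in>carrier ?W. f x = 0" by blast
    moreover have "\<exists>x\<in>carrier ?W. f x = p + q"
      if "\<exists>x\<in>carrier ?W. f x = p" "\<exists>x\<in>carrier ?W. f x = q" for p q
      using that W_add_closed f_add by blast
    moreover have "\<exists>x\<in>carrier ?W. f x = Const a * p" if "\<exists>x\<in>carrier ?W. f x = p" for a p
      using that W_scale_closed f_scale by blast
    ultimately show ?case
      unfolding poly_vs.subspace_def poly_scale_def mem_Collect_eq by blast
  next
    case (step q)
    then obtain l T where lT: "l \<in> even_tail_shapes n d" "T \<in> tableaux l"
      "q = matching_poly n d (\<lambda>M. of_int (matching_polytabloid l T M))" by (auto simp: polytabloid_polys_def)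
    let ?x = "\<lambda>j\<in>?J. if j = (l, 0) then polytabloid l T else 0"
    have "?x \<in> carrier ?W" using lT(2) unfolding W specht_carrier
      by (auto intro: tabloid_vs.span_zero tabloid_vs.span_base)
    moreover have "f ?x = q"
    proof -
      have "f ?x = (\<Sum>j\<in>?J. if j = (l, 0) then ?\<Phi> (polytabloid l T) else 0)"
        unfolding f_def by (intro sum.cong) auto
      also have "\<dots> = ?\<Phi> (polytabloid l T)" using J lT(1) finJ by (subst sum.delta) auto
      finally show ?thesis by (simp add: lT(3) tabloids_to_poly_polytabloid)
    qed
    ultimately show ?case by blast
  qed
  show ?thesis
  proof (rule sym_iso_from_inverse[where f = "\<lambda>x. coset n (f x)"])
    show "bij_betw (\<lambda>x. coset n (f x)) (carrier ?W) (carrier ?V)"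
      unfolding bij_betw_def
    proof
      show "inj_on (\<lambda>x. coset n (f x)) (carrier ?W)"
      proof (rule inj_onI)
        fix x y assume x: "x \<in> carrier ?W" and y: "y \<in> carrier ?W" and "coset n (f x) = coset n (f y)"
        then have diff: "f x - f y \<in> I_ideal n" by (simp add: coset_eq_iff)
        (* The difference of x and y, written with the operations under which the carrier is closed. *)
        define y' where "y' = (\<lambda>j\<in>?J. tabloid_scale (- 1) (y j))"
        define z where "z = (\<lambda>j\<in>?J. x j + y' j)"
        have z: "z \<in> carrier ?W" unfolding z_def y'_def by (rule W_add_closed[OF x W_scale_closed[OF y]])
        have "Const (- 1) = - 1" by (simp add: Const_def single_uminus)
        then have "f z = f x - f y" unfolding z_def f_add y'_def f_scale by simp
        then have "z j = 0" if "j \<in> ?J" for j using injective[OF z _ that] diff by simp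
        then have "x j = y j" if "j \<in> ?J" for j
          using that by (simp add: z_def y'_def)
        then show "x = y" using x y unfolding W by (auto intro: extensionalityI)
      qed
      show "(\<lambda>x. coset n (f x)) ` carrier ?W = carrier ?V"
      proof (intro equalityI subsetI)
        fix c assume "c \<in> (\<lambda>x. coset n (f x)) ` carrier ?W"
        then show "c \<in> carrier ?V" using f_carrier by (auto simp: quotient_component_carrier)
      next
        fix c assume "c \<in> carrier ?V"
        then obtain p where p: "c = coset n p" "p \<in> carrier (poly_ring n)" "homogeneous d p"
          by (auto simp: quotient_component_carrier)
        obtain q where q: "q \<in> poly_vs.span (polytabloid_polys n d)" "p - q \<in> I_ideal n"
          by (rule homogeneous_in_span[OF n p(2,3)])
        obtain x where "x \<in> carrier ?W" "f x = q" using surjective[OF q(1)] by blast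
        moreover have "c = coset n q" using p(1) q(2) by (simp add: coset_eq_iff)
        ultimately show "c \<in> (\<lambda>x. coset n (f x)) ` carrier ?W" by blast
      qed
    qed
  next
    fix x y assume "x \<in> carrier ?W" "y \<in> carrier ?W"
    then show "x \<oplus>\<^bsub>?W\<^esub> y \<in> carrier ?W \<and> coset n (f (x \<oplus>\<^bsub>?W\<^esub> y)) = coset n (f x) \<oplus>\<^bsub>?V\<^esub> coset n (f y)"
      using W_add_closed f_carrier by (simp add: W_add f_add quotient_component_add)
  next
    fix a x assume "x \<in> carrier ?W"
    then show "a \<odot>\<^bsub>?W\<^esub> x \<in> carrier ?W \<and> coset n (f (a \<odot>\<^bsub>?W\<^esub> x)) = a \<odot>\<^bsub>?V\<^esub> coset n (f x)"
      using W_scale_closed f_carrier by (simp add: W_scale f_scale quotient_component_smult)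
  next
    fix w x assume w: "w \<in> carrier (sym_group n)" and "x \<in> carrier ?W"
    then have "w permutes {1..n}" by (simp add: sym_group_carrier)
    then show "act ?W w x \<in> carrier ?W \<and> coset n (f (act ?W w x)) = act ?V w (coset n (f x))"
      using W_act_closed \<open>x \<in> carrier ?W\<close> by (simp add: W_act f_act quotient_component_act)
  qed
qed

text \<open>
  The rows other than row 0 add up to an even number, so nothing is lost in the division by 2.
\<close>

lemma even_tail_shapes_iff:
  assumes n: "n > 0"
  shows "l \<in> even_tail_shapes n d \<longleftrightarrow>
    l \<in> partitions n \<and> (\<forall>i. 0 < i \<and> i < length l \<longrightarrow> even (l ! i)) \<and> (n - l ! 0) div 2 = d"
proof -
  have "(n - l ! 0) div 2 = d \<longleftrightarrow> l \<noteq> [] \<and> l ! 0 + 2 * d = n"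
    if l: "l \<in> partitions n" and ev: "\<forall>i. 0 < i \<and> i < length l \<longrightarrow> even (l ! i)"
  proof -
    obtain x xs where e: "l = x # xs" using l n by (cases l) (auto simp: partitions_def)
    have "even y" if "y \<in> set xs" for y
    proof -
      obtain i where "i < length xs" "xs ! i = y" using \<open>y \<in> set xs\<close> by (auto simp: in_set_conv_nth)
      then show ?thesis using ev[rule_format, of "Suc i"] by (simp add: e)
    qed
    then have "even (sum_list xs)" by (induction xs) auto
    moreover have "n = x + sum_list xs" using l by (simp add: partitions_def e)
    ultimately show ?thesis by (auto simp: e elim!: evenE)
  qed
  then show ?thesis by (auto simp: even_tail_shapes_def)
qed

theorem theorem3p14:
  fixes n :: nat
  assumes "n > 0"
  shows "has_grFrob n (quotient_component n)
    (\<lambda>\<alpha>. \<Sum>l \<in> {l \<in> partitions n. \<forall>i. 0 < i \<and> i < length l \<longrightarrow> even (l ! i)}.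
       fps_X ^ ((n - l ! 0) div 2) * fps_const (schur l \<alpha>))"
  unfolding has_grFrob_def
proof (intro exI conjI allI)
  let ?c = "\<lambda>d l. of_bool (l \<in> even_tail_shapes n d) :: nat"
  let ?G = "\<lambda>d \<alpha>. \<Sum>l\<in>partitions n. int (?c d l) * schur l \<alpha>"
  let ?L = "{l \<in> partitions n. \<forall>i. 0 < i \<and> i < length l \<longrightarrow> even (l ! i)}"
  show "has_Frob n (quotient_component n d) (?G d)" for d
    unfolding has_Frob_def
    by (intro conjI exI[of _ "?c d"] refl sym_module_quotient_component
        quotient_component_decomposition[OF assms])
  show "(\<lambda>\<alpha>. \<Sum>l\<in>?L. fps_X ^ ((n - l ! 0) div 2) * fps_const (schur l \<alpha>)) = (\<lambda>\<alpha>. Abs_fps (\<lambda>d. ?G d \<alpha>))"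
  proof (intro ext fps_ext)
    fix \<alpha> d
    have "fps_nth (\<Sum>l\<in>?L. fps_X ^ ((n - l ! 0) div 2) * fps_const (schur l \<alpha>)) d =
       (\<Sum>l\<in>?L. if (n - l ! 0) div 2 = d then schur l \<alpha> else 0)"
      unfolding fps_sum_nth by (intro sum.cong refl) (auto simp: fps_X_power_mult_nth)
    also have "\<dots> = (\<Sum>l\<in>?L. int (?c d l) * schur l \<alpha>)"
      by (intro sum.cong refl) (auto simp: even_tail_shapes_iff[OF assms])
    also have "\<dots> = ?G d \<alpha>"
      using finite_partitions
      by (intro sum.mono_neutral_left) (auto simp: even_tail_shapes_iff[OF assms])
    finally show "fps_nth (\<Sum>l\<in>?L. fps_X ^ ((n - l ! 0) div 2) * fps_const (schur l \<alpha>)) d =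
       fps_nth (Abs_fps (\<lambda>d. ?G d \<alpha>)) d" by simp
  qed
qed

end
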